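(* Let $\varphi:\mathbb{R}^n\times\mathbb{R}^m\to(-\infty,\infty]$ be a closed proper function, let $\bar x$ be a locally optimal solution to the problem of minimizing $\varphi(x,0)$ with respect to $x\in\mathbb{R}^n$, with $\varphi(\bar x,0)$ finite, and assume the basic constraint qualification $$(0,y)\in\partial^\infty\varphi(\bar x,0)\implies y=0 .$$ Then (A) $\Rightarrow$ (B) $\Rightarrow$ (C) for the following conditions: (A) full stability holds at $\bar x$ with full multiplier prox-regularity; (B) strong variational sufficiency holds at $\bar x$; (C) full substability holds at $\bar x$ with full multiplier prox-regularity. Under (C), hence also under (A) and (B), an open convex neighborhood $\mathcal{V}\times\mathcal{U}$ of $(0,0)\in\mathbb{R}^n\times\mathbb{R}^m$ exists such that, for small enough $\delta>0$ and low enough $\alpha>m_\delta(0,0)=\varphi(\bar x,0)$, for $(v,u)\in\mathcal{V}\times\mathcal{U}$, $$M_\delta(v,u)=M(v,u)\cap\{x : |x-\bar x|<\delta,\ \varphi(x,u)<\alpha\},$$ and $m_\delta(v,u)$ is $C^1$ in $v\in\mathcal{V}$ for each $u\in\mathcal{U}$ with $\nabla_v m_\delta(v,u)=M_\delta(v,u)$. Under (B), furthermore, $m_\delta(v,u)$ is uniformly hypo-convex in $u\in\mathcal{U}$ for $v\in\mathcal{V}$, with $$\partial_u m_\delta(v,u)=Y(x,u,v)\quad\text{for } x=M_\delta(v,u),$$ where the uniform hypo-convexity refers to the existence of $e\ge 0$ such that $m_\delta(v,u)+\frac{e}{2}|u|^2$ is convex in $u\in\mathcal{U}$ for each $v\i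n\mathcal{V}$.
   Context: Subgradients $\partial$ are the general (limiting) subgradients and $\partial^\infty$ the horizon subgradients of variational analysis (Rockafellar–Wets); closed means lower semicontinuous. $\partial_u m_\delta(v,u)$ is the set of subgradients of $m_\delta(v,\cdot)$ at $u$. When a set is a singleton it is identified with its element. For $\delta>0$ and $(v,u)\in\mathbb{R}^n\times\mathbb{R}^m$, $$M_\delta(v,u)=\operatorname{argmin}_{|x-\bar x|<\delta}\{\varphi(x,u)-v\cdot[x-\bar x]\},\qquad m_\delta(v,u)=\min_{|x-\bar x|<\delta}\{\varphi(x,u)-v\cdot[x-\bar x]\}.$$ Also $Y(x,u,v)=\{y\in\mathbb{R}^m : (v,y)\in\partial\varphi(x,u)\}$, $M(v,u)=\{x: Y(x,u,v)\ne\emptyset\}$, and $\bar Y=Y(\bar x,0,0)$ is the set of multiplier vectors associated with $\bar x$. Full stability at $\bar x$: for small enough $\delta>0$, $M_\delta(v,u)$ and $m_\delta(v,u)$ are Lipschitz continuous in $(v,u)$ in a neighborhood of $(0,0)$, with $M_\delta$ single-valued there and $M_\delta(0,0)=\bar x$. Full substability at $\bar x$: for small enough $\delta>0$, in a neighborhood of $(0,0)$, $M_\delta$ is single-valued with $M_\delta(0,0)=\bar x$, and $M_\delta(v,u)$ and $m_\delta(v,u)$ are just continuous in $(v,u)$ but Lipschitz continuous in $v$, locally uniformly in $u$. For a closed proper function $f$ on a Euclidean space, an open set $\mathcal{X}$ and $\alpha\in\mathbb{R}$, let $\mathcal{X}^\alpha_f=\{x\in\mathcal{X}: f(x)<\alpha\}$.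 $f$ is prox-regular at $\bar z$ for $\bar w\in\partial f(\bar z)$ if there are open neighborhoods $\mathcal{X}$ of $\bar z$, $\mathcal{W}$ of $\bar w$, some $\alpha>f(\bar z)$ and $r\in\mathbb{R}$ such that $f(z')\ge f(z)+w\cdot[z'-z]-\frac r2|z'-z|^2$ for all $z'\in\mathcal{X}$ and all $(z,w)\in(\mathcal{X}^\alpha_f\times\mathcal{W})\cap\operatorname{gph}\partial f$. A function $g$ is $s$-convex if $g-\frac s2|\cdot|^2$ is convex. $f$ is variationally $s$-convex at $\bar z$ for $\bar w\in\partial f(\bar z)$ if there are open convex neighborhoods $\mathcal{X}$ of $\bar z$, $\mathcal{W}$ of $\bar w$, some $\alpha>f(\bar z)$, and a closed proper $s$-convex function $\hat f$ such that $\hat f\le f$ on $\mathcal{X}$, $(\mathcal{X}\times\mathcal{W})\cap\operatorname{gph}\partial\hat f=(\mathcal{X}^\alpha_f\times\mathcal{W})\cap\operatorname{gph}\partial f$, and $\hat f(z)=f(z)$ for all $(z,w)$ in this truncated graph. It is variationally strongly convex there if this holds for some $s>0$. Full multiplier prox-regularity at $\bar x$: $\varphi$ is prox-regular at $(\bar x,0)$ for $(0,\bar y)$ for every $\bar y\in\bar Y$. Strong variational sufficiency at $\bar x$: for every $\bar y\in\bar Y$ there exists $e\ge0$ such that the function $\varphi_e(x,u)=\varphi(x,u)+\frac e2|u|^2$ is variationally strongly convex at $(\bar x,0)$ for the subgradient $(0,\bar y)\in\partial\varphi_e(\bar x,0)=\partial\varphi(\bar x,0)$.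
   Formalization: The gradient formula is corrected to ∇_v m_δ(v,u) = x̄ − M_δ(v,u) (the printed one fails for φ=|x|²/2, x̄=0, where the gradient is −v), and the neighborhood V×U may depend on δ and α (one V×U for all small δ fails for φ=x²/2+u). *)

theory Defs
  imports "HOL-Analysis.Analysis"
begin

subsection \<open>Extended-real-valued functions\<close>

definition proper_fun :: "('a \<Rightarrow> ereal) \<Rightarrow> bool" where
  "proper_fun f \<longleftrightarrow> (\<forall>x. f x \<noteq> -\<infinity>) \<and> (\<exists>x. f x \<noteq> \<infinity>)"

text \<open>The lower limit is taken along the full neighborhood filter, so that it includes the
  point itself, as in Rockafellar and Wets.\<close>

definition closed_fun :: "('a::topological_space \<Rightarrow> ereal) \<Rightarrow> bool" where
  "closed_fun f \<longleftrightarrow> (\<forall>x. f x \<le> Liminf (nhds x) f)"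

text \<open>In \<^typ>\<open>ereal\<close> one has \<open>\<infinity> + -\<infinity> = \<infinity>\<close>, which is the inf-addition convention of
  variational analysis; the weights below are strictly positive, so no product \<open>0 * \<infinity>\<close> occurs.\<close>

definition econvex_on :: "'a::real_vector set \<Rightarrow> ('a \<Rightarrow> ereal) \<Rightarrow> bool" where
  "econvex_on S g \<longleftrightarrow> convex S \<and>
     (\<forall>x\<in>S. \<forall>y\<in>S. \<forall>t. 0 < t \<and> t < 1 \<longrightarrow>
        g ((1 - t) *\<^sub>R x + t *\<^sub>R y) \<le> ereal (1 - t) * g x + ereal t * g y)"

definition s_convex :: "real \<Rightarrow> ('a::real_inner \<Rightarrow> ereal) \<Rightarrow> bool" where
  "s_convex s g \<longleftrightarrow> econvex_on UNIV (\<lambda>z. g z - ereal (s / 2 * (norm z)\<^sup>2))"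

text \<open>Following Rockafellar and Wets, a function that is identically \<open>\<infinity>\<close> on the feasible set has
  no minimizers.\<close>

definition argmin_on :: "'a set \<Rightarrow> ('a \<Rightarrow> ereal) \<Rightarrow> 'a set" where
  "argmin_on S g = {x \<in> S. g x = (INF z\<in>S. g z) \<and> g x < \<infinity>}"


subsection \<open>Subgradients\<close>

text \<open>The condition \<open>f z \<ge> f x + w \<bullet> (z - x) + o(|z - x|)\<close>.\<close>

definition regular_subgrad :: "('a::euclidean_space \<Rightarrow> ereal) \<Rightarrow> 'a \<Rightarrow> 'a set" where
  "regular_subgrad f x = {w. \<bar>f x\<bar> \<noteq> \<infinity> \<and>
     (\<forall>\<epsilon>>0. \<forall>\<^sub>F z in nhds x. f z \<ge> f x + ereal (w \<bullet> (z - x) - \<epsilon> * norm (z - x)))}"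

definition subgrad :: "('a::euclidean_space \<Rightarrow> ereal) \<Rightarrow> 'a \<Rightarrow> 'a set" where
  "subgrad f x = {w. \<bar>f x\<bar> \<noteq> \<infinity> \<and>
     (\<exists>X W. X \<longlonglongrightarrow> x \<and> (\<lambda>k. f (X k)) \<longlonglongrightarrow> f x \<and>
        (\<forall>k::nat. W k \<in> regular_subgrad f (X k)) \<and> W \<longlonglongrightarrow> w)}"

definition horizon_subgrad :: "('a::euclidean_space \<Rightarrow> ereal) \<Rightarrow> 'a \<Rightarrow> 'a set" where
  "horizon_subgrad f x = {w. \<bar>f x\<bar> \<noteq> \<infinity> \<and>
     (\<exists>X W c. X \<longlonglongrightarrow> x \<and> (\<lambda>k. f (X k)) \<longlonglongrightarrow> f x \<and>
        (\<forall>k::nat. W k \<in> regular_subgrad f (X k)) \<and>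
        (\<forall>k. c k > (0::real)) \<and> c \<longlonglongrightarrow> 0 \<and> (\<lambda>k. c k *\<^sub>R W k) \<longlonglongrightarrow> w)}"

definition gph :: "('a \<Rightarrow> 'b set) \<Rightarrow> ('a \<times> 'b) set" where
  "gph T = {(z, w). w \<in> T z}"


subsection \<open>Prox-regularity and variational convexity\<close>

definition prox_regular :: "('a::euclidean_space \<Rightarrow> ereal) \<Rightarrow> 'a \<Rightarrow> 'a \<Rightarrow> bool" where
  "prox_regular f zb wb \<longleftrightarrow> wb \<in> subgrad f zb \<and>
     (\<exists>X W \<alpha> r. open X \<and> zb \<in> X \<and> open W \<and> wb \<in> W \<and> f zb < ereal \<alpha> \<and>
        (\<forall>z'\<in>X. \<forall>(z, w) \<in> ({x \<in> X. f x < ereal \<alpha>} \<times> W) \<inter> gph (subgrad f).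
           f z' \<ge> f z + ereal (w \<bullet> (z' - z) - r / 2 * (norm (z' - z))\<^sup>2)))"

definition variationally_convex ::
    "real \<Rightarrow> ('a::euclidean_space \<Rightarrow> ereal) \<Rightarrow> 'a \<Rightarrow> 'a \<Rightarrow> bool" where
  "variationally_convex s f zb wb \<longleftrightarrow> wb \<in> subgrad f zb \<and>
     (\<exists>X W \<alpha> fh. open X \<and> convex X \<and> zb \<in> X \<and> open W \<and> convex W \<and> wb \<in> W \<and> f zb < ereal \<alpha> \<and>
        closed_fun fh \<and> proper_fun fh \<and> s_convex s fh \<and>
        (\<forall>z\<in>X. fh z \<le> f z) \<and>
        (X \<times> W) \<inter> gph (subgrad fh) = ({x \<in> X. f x < ereal \<alpha>} \<times> W) \<inter> gph (subgrad f) \<and>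
        (\<forall>(z, w) \<in> (X \<times> W) \<inter> gph (subgrad fh). fh z = f z))"

definition variationally_strongly_convex ::
    "('a::euclidean_space \<Rightarrow> ereal) \<Rightarrow> 'a \<Rightarrow> 'a \<Rightarrow> bool" where
  "variationally_strongly_convex f zb wb \<longleftrightarrow> (\<exists>s>0. variationally_convex s f zb wb)"


subsection \<open>The parametric problem\<close>

definition tilted ::
    "((real^'n) \<times> (real^'m) \<Rightarrow> ereal) \<Rightarrow> real^'n \<Rightarrow> real^'n \<Rightarrow> real^'m \<Rightarrow> real^'n \<Rightarrow> ereal" where
  "tilted \<phi> xb v u x = \<phi> (x, u) - ereal (v \<bullet> (x - xb))"

definition M_loc ::
    "((real^'n) \<times> (real^'m) \<Rightarrow> ereal) \<Rightarrow> real^'n \<Rightarrow> real \<Rightarrow> real^'n \<Rightarrow> real^'m \<Rightarrow> (real^'n) set" where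
  "M_loc \<phi> xb \<delta> v u = argmin_on {x. norm (x - xb) < \<delta>} (tilted \<phi> xb v u)"

definition m_loc ::
    "((real^'n) \<times> (real^'m) \<Rightarrow> ereal) \<Rightarrow> real^'n \<Rightarrow> real \<Rightarrow> real^'n \<Rightarrow> real^'m \<Rightarrow> ereal" where
  "m_loc \<phi> xb \<delta> v u = (INF x\<in>{x. norm (x - xb) < \<delta>}. tilted \<phi> xb v u x)"

definition Y_mult ::
    "((real^'n) \<times> (real^'m) \<Rightarrow> ereal) \<Rightarrow> real^'n \<Rightarrow> real^'m \<Rightarrow> real^'n \<Rightarrow> (real^'m) set" where
  "Y_mult \<phi> x u v = {y. (v, y) \<in> subgrad \<phi> (x, u)}"

definition M_stat ::
    "((real^'n) \<times> (real^'m) \<Rightarrow> ereal) \<Rightarrow> real^'n \<Rightarrow> real^'m \<Rightarrow> (real^'n) set" where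
  "M_stat \<phi> v u = {x. Y_mult \<phi> x u v \<noteq> {}}"

text \<open>Where \<^const>\<open>M_loc\<close> is a singleton, the minimum is attained and, for proper \<open>\<phi>\<close>,
  \<^const>\<open>m_loc\<close> is finite, so \<^const>\<open>real_of_ereal\<close> loses nothing below.
  The radii \<open>\<delta>\<close> range over all sufficiently small positive numbers, and the neighborhood of
  \<open>(0, 0)\<close> may depend on \<open>\<delta>\<close>.\<close>

definition full_stability :: "((real^'n) \<times> (real^'m) \<Rightarrow> ereal) \<Rightarrow> real^'n \<Rightarrow> bool" where
  "full_stability \<phi> xb \<longleftrightarrow> (\<exists>\<delta>0>0. \<forall>\<delta>. 0 < \<delta> \<and> \<delta> < \<delta>0 \<longrightarrow>
     M_loc \<phi> xb \<delta> 0 0 = {xb} \<and>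
     (\<exists>N. open N \<and> (0, 0) \<in> N \<and>
        (\<forall>(v, u)\<in>N. is_singleton (M_loc \<phi> xb \<delta> v u)) \<and>
        (\<exists>L. L-lipschitz_on N (\<lambda>(v, u). the_elem (M_loc \<phi> xb \<delta> v u))) \<and>
        (\<exists>L. L-lipschitz_on N (\<lambda>(v, u). real_of_ereal (m_loc \<phi> xb \<delta> v u)))))"

text \<open>Lipschitz continuity in \<open>v\<close>, locally uniformly in \<open>u\<close>: after shrinking the
  neighborhood there is one Lipschitz constant that serves all \<open>u \<in> U\<close>.\<close>

definition full_substability :: "((real^'n) \<times> (real^'m) \<Rightarrow> ereal) \<Rightarrow> real^'n \<Rightarrow> bool" where
  "full_substability \<phi> xb \<longleftrightarrow> (\<exists>\<delta>0>0. \<forall>\<delta>. 0 < \<delta> \<and> \<delta> < \<delta>0 \<longrightarrow>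
     M_loc \<phi> xb \<delta> 0 0 = {xb} \<and>
     (\<exists>V U. open V \<and> 0 \<in> V \<and> open U \<and> 0 \<in> U \<and>
        (\<forall>v\<in>V. \<forall>u\<in>U. is_singleton (M_loc \<phi> xb \<delta> v u)) \<and>
        continuous_on (V \<times> U) (\<lambda>(v, u). the_elem (M_loc \<phi> xb \<delta> v u)) \<and>
        continuous_on (V \<times> U) (\<lambda>(v, u). real_of_ereal (m_loc \<phi> xb \<delta> v u)) \<and>
        (\<exists>L. \<forall>u\<in>U. L-lipschitz_on V (\<lambda>v. the_elem (M_loc \<phi> xb \<delta> v u))) \<and>
        (\<exists>L. \<forall>u\<in>U. L-lipschitz_on V (\<lambda>v. real_of_ereal (m_loc \<phi> xb \<delta> v u)))))"

definition full_multiplier_prox_regularity ::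
    "((real^'n) \<times> (real^'m) \<Rightarrow> ereal) \<Rightarrow> real^'n \<Rightarrow> bool" where
  "full_multiplier_prox_regularity \<phi> xb \<longleftrightarrow>
     (\<forall>yb \<in> Y_mult \<phi> xb 0 0. prox_regular \<phi> (xb, 0) (0, yb))"

definition strong_variational_sufficiency ::
    "((real^'n) \<times> (real^'m) \<Rightarrow> ereal) \<Rightarrow> real^'n \<Rightarrow> bool" where
  "strong_variational_sufficiency \<phi> xb \<longleftrightarrow>
     (\<forall>yb \<in> Y_mult \<phi> xb 0 0. \<exists>e\<ge>0.
        variationally_strongly_convex
          (\<lambda>(x, u). \<phi> (x, u) + ereal (e / 2 * (norm u)\<^sup>2)) (xb, 0) (0, yb))"


subsection \<open>Consequences for the localized problem\<close>

text \<open>By the envelope formula, the gradient of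
  \<open>v \<mapsto> min {\<phi>(x, u) - v \<bullet> (x - xb)}\<close> is \<open>-(x - xb)\<close> at the minimizer \<open>x\<close>.
  The shorthand \<open>\<nabla>\<^sub>v m = M\<close> disregards the sign and the shift by \<open>xb\<close>; taken
  literally it already fails for \<open>\<phi>(x, u) = |x|\<^sup>2 / 2\<close>, \<open>xb = 0\<close>.\<close>

definition localized_solution_property ::
    "((real^'n) \<times> (real^'m) \<Rightarrow> ereal) \<Rightarrow> real^'n \<Rightarrow> real \<Rightarrow> real \<Rightarrow>
       (real^'n) set \<Rightarrow> (real^'m) set \<Rightarrow> bool" where
  "localized_solution_property \<phi> xb \<delta> \<alpha> V U \<longleftrightarrow>
     (\<forall>v\<in>V. \<forall>u\<in>U. is_singleton (M_loc \<phi> xb \<delta> v u) \<and>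
        M_loc \<phi> xb \<delta> v u = M_stat \<phi> v u \<inter> {x. norm (x - xb) < \<delta> \<and> \<phi> (x, u) < ereal \<alpha>}) \<and>
     (\<forall>u\<in>U. continuous_on V (\<lambda>v. xb - the_elem (M_loc \<phi> xb \<delta> v u)) \<and>
        (\<forall>v\<in>V. GDERIV (\<lambda>v'. real_of_ereal (m_loc \<phi> xb \<delta> v' u)) v
                 :> (xb - the_elem (M_loc \<phi> xb \<delta> v u))))"

definition hypo_convex_property ::
    "((real^'n) \<times> (real^'m) \<Rightarrow> ereal) \<Rightarrow> real^'n \<Rightarrow> real \<Rightarrow>
       (real^'n) set \<Rightarrow> (real^'m) set \<Rightarrow> bool" where
  "hypo_convex_property \<phi> xb \<delta> V U \<longleftrightarrow>
     (\<exists>e\<ge>0. \<forall>v\<in>V. econvex_on U (\<lambda>u. m_loc \<phi> xb \<delta> v u + ereal (e / 2 * (norm u)\<^sup>2))) \<and>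
     (\<forall>v\<in>V. \<forall>u\<in>U. subgrad (\<lambda>u'. m_loc \<phi> xb \<delta> v u') u
                    = Y_mult \<phi> (the_elem (M_loc \<phi> xb \<delta> v u)) u v)"

end

theory Submission
  imports Defs
begin

text \<open>Everything rests on the inequality
  \<open>\<phi>(x', u') \<ge> \<phi>(x, u) + (v, y) \<bullet> (x' - x, u' - u) + s/2 |x' - x|\<^sup>2 - e/2 |u' - u|\<^sup>2\<close>
  for \<open>(v, y) \<in> \<partial>\<phi>(x, u)\<close> with \<open>(x, u, v)\<close> near \<open>(xb, 0, 0)\<close> and \<open>\<phi>(x, u)\<close> near \<open>\<phi>(xb, 0)\<close>.
  With \<open>s > 0\<close> around each multiplier it is strong variational sufficiency, with \<open>s = -e\<close> it is
  prox-regularity. The constraint qualification bounds the multipliers \<open>y\<close>, so by compactness the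
  constants can be chosen uniformly.

  Under substability, prox-regularity makes every nearby stationary point the local minimizer
  \<open>M(v, u)\<close>. Given full stability, Lipschitz continuity of \<open>M\<close> in \<open>v\<close> makes
  \<open>\<phi>(\<cdot>, u')\<close> grow quadratically around \<open>M(v, u')\<close>, Lipschitz continuity in \<open>u\<close> transfers this to
  \<open>x = M(v, u)\<close>, and the inequality with \<open>s > 0\<close> results. Conversely, that inequality yields uniqueness
  and Lipschitz continuity of minimizers as well as hypo-convexity of \<open>m\<close> in \<open>u\<close>, whereas existence and
  continuity of \<open>m\<close> in \<open>u\<close> come from an exact penalty based on the bound on multipliers.\<close>


subsection \<open>Lower semicontinuity and subgradients\<close>

text \<open>Two obstacles shape the argument. Lower semicontinuity alone does not exclude that
  \<phi>(., u) is infinite near xb for small u, so minimizers at such u cannot be obtained from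
  compactness alone. They come from minimizing jointly in x and u' with the penalty (K + 1) |u' -
  u|, where K bounds the multipliers: a rate above K forces u' = u. Secondly, prox-regularity and
  variational sufficiency supply constants for one multiplier at a time, and there may be infinitely
  many multipliers. The uniform inequality is therefore tested with constants \<open>s k\<close>,
  \<open>e k\<close> and radius 1 / (k + 1) that become weaker with k than any given local
  constants. Violations for every k would have multipliers clustering at one of (xb, 0), where the
  local inequality contradicts them. The choice \<open>s k\<close> = 1 / (k + 1) keeps the modulus
  positive. For the way back to variational convexity a strongly convex minorant has to be produced;
  it is the supremum of the quadratics that the inequality itself puts below the function.\<close>

lemma closed_fun_iff:
  "closed_fun f \<longleftrightarrow> (\<forall>x c. c < f x \<longrightarrow> (\<forall>\<^sub>F z in nhds x. c < f z))"
  unfolding closed_fun_def le_Liminf_iff by auto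

lemma closed_fun_open:
  assumes "closed_fun f" shows "open {x. c < f x}"
proof (subst open_subopen, intro ballI)
  fix x assume "x \<in> {x. c < f x}"
  then have "\<forall>\<^sub>F z in nhds x. c < f z" using assms by (auto simp: closed_fun_iff)
  then show "\<exists>T. open T \<and> x \<in> T \<and> T \<subseteq> {x. c < f x}" by (auto simp: eventually_nhds)
qed

lemma closed_fun_add_continuous:
  fixes g :: "'a::topological_space \<Rightarrow> real"
  assumes "closed_fun f" "continuous_on UNIV g"
  shows "closed_fun (\<lambda>z. f z + ereal (g z))"
  unfolding closed_fun_iff
proof (intro allI impI)
  fix x c assume "c < f x + ereal (g x)"
  then have "c - ereal (g x) < f x"
    by (cases c; cases "f x") auto
  then obtain d where d: "c - ereal (g x) < ereal d" "ereal d < f x"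
    using ereal_dense2 by blast
  have "(g \<longlongrightarrow> g x) (nhds x)"
    using assms(2) unfolding continuous_on_def by (metis UNIV_I tendsto_at_iff_tendsto_nhds)
  then have "((\<lambda>z. ereal (d + g z)) \<longlongrightarrow> ereal (d + g x)) (nhds x)"
    by (intro tendsto_intros)
  moreover have "c < ereal (d + g x)" using d(1) by (cases c) auto
  ultimately have 1: "\<forall>\<^sub>F z in nhds x. c < ereal (d + g z)"
    by (rule order_tendstoD(1))
  have 2: "\<forall>\<^sub>F z in nhds x. ereal d < f z"
    using assms(1) d(2) unfolding closed_fun_iff by blast
  show "\<forall>\<^sub>F z in nhds x. c < f z + ereal (g z)"
    using 1 2
  proof eventually_elim
    case (elim z)
    have "ereal (d + g z) \<le> f z + ereal (g z)" using elim(2) by (cases "f z") auto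
    then show ?case using elim(1) by (rule order.strict_trans2[rotated])
  qed
qed

text \<open>Weierstrass for extended values: without a minimizer the open sets
  \<open>{x. f y < f x}\<close> would cover S, but among the finitely many y of a subcover the one
  with least value lies in none of the sets.\<close>

lemma closed_fun_attains_min:
  assumes "closed_fun f" "compact S" "S \<noteq> {}"
  obtains x where "x \<in> S" "\<And>y. y \<in> S \<Longrightarrow> f x \<le> f y"
proof -
  have "\<exists>x\<in>S. \<forall>y\<in>S. f x \<le> f y"
  proof (rule ccontr)
    assume no: "\<not> ?thesis"
    have "S \<subseteq> (\<Union>y\<in>S. {x. f y < f x})"
    proof
      fix x assume "x \<in> S"
      then show "x \<in> (\<Union>y\<in>S. {x. f y < f x})" using no by (auto simp: not_le)
    qed
    then obtain T where T: "T \<subseteq> S" "finite T" "S \<subseteq> (\<Union>y\<in>T. {x. f y < f x})"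
      using compactE_image[OF assms(2), of S "\<lambda>y. {x. f y < f x}"] closed_fun_open[OF assms(1)]
      by metis
    then have "T \<noteq> {}" using assms(3) by auto
    have "Min (f ` T) \<in> f ` T" using T \<open>T \<noteq> {}\<close> by (intro Min_in) auto
    then obtain y where y: "y \<in> T" "f y = Min (f ` T)" by auto
    with T obtain z where "z \<in> T" "f z < f y" by blast
    moreover have "f y \<le> f z" using y(2) T(2) \<open>z \<in> T\<close> by auto
    ultimately show False by auto
  qed
  then show thesis using that by blast
qed

text \<open>Limits of subgradients require the function values to converge as well. Lower
  semicontinuity gives the lower half of that convergence and the bounds B k the upper half.\<close>

lemma closed_fun_tendsto:
  assumes "closed_fun f" "X \<longlonglongrightarrow> x" "f x = ereal a"
    and "\<And>k::nat. f (X k) \<le> ereal (B k)" "B \<longlonglongrightarrow> a"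
  shows "(\<lambda>k. f (X k)) \<longlonglongrightarrow> f x"
proof (rule order_tendstoI)
  fix c assume "c < f x"
  then have "\<forall>\<^sub>F z in nhds x. c < f z" using assms(1) by (auto simp: closed_fun_iff)
  then show "\<forall>\<^sub>F k in sequentially. c < f (X k)"
    using assms(2) unfolding filterlim_iff by blast
next
  fix c assume "f x < c"
  moreover have "(\<lambda>k. ereal (B k)) \<longlonglongrightarrow> ereal a" using assms(5) by (intro tendsto_intros)
  ultimately have "\<forall>\<^sub>F k in sequentially. ereal (B k) < c"
    using assms(3) order_tendstoD(2) by metis
  then show "\<forall>\<^sub>F k in sequentially. f (X k) < c"
    by (elim eventually_mono) (meson assms(4) order.strict_trans1)
qed

text \<open>Fermat's rule for f + g with g differentiable at x; perturbed minimization problems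
  thereby produce regular subgradients of f itself.\<close>

lemma regular_subgradI_min:
  assumes fin: "\<bar>f x\<bar> \<noteq> \<infinity>"
    and min: "\<forall>\<^sub>F z in nhds x. f x + ereal (g x) \<le> f z + ereal (g z)"
    and der: "(g has_derivative (\<lambda>h. d \<bullet> h)) (at x)"
  shows "- d \<in> regular_subgrad f x"
  unfolding regular_subgrad_def
proof (intro CollectI conjI allI impI fin)
  fix e :: real assume "e > 0"
  then obtain \<delta> where \<delta>: "\<delta> > 0"
    "\<And>z. norm (z - x) < \<delta> \<Longrightarrow> norm (g z - g x - d \<bullet> (z - x)) \<le> e * norm (z - x)"
    using der unfolding has_derivative_at_alt by blast
  have "\<forall>\<^sub>F z in nhds x. norm (z - x) < \<delta>"
    using eventually_nhds_ball[OF \<delta>(1), of x] by eventually_elim (simp add: dist_norm norm_minus_commute)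
  with min show "\<forall>\<^sub>F z in nhds x. f x + ereal (- d \<bullet> (z - x) - e * norm (z - x)) \<le> f z"
  proof eventually_elim
    case (elim z)
    from \<delta>(2)[OF elim(2)] have "g z - g x \<le> d \<bullet> (z - x) + e * norm (z - x)" by simp
    then show ?case using elim(1) fin by (cases "f x"; cases "f z") auto
  qed
qed

lemma regular_subgrad_add_smooth:
  assumes w: "w \<in> regular_subgrad f x"
    and der: "(g has_derivative (\<lambda>h. d \<bullet> h)) (at x)"
  shows "w + d \<in> regular_subgrad (\<lambda>z. f z + ereal (g z)) x"
  unfolding regular_subgrad_def
proof (intro CollectI conjI allI impI)
  have fin: "\<bar>f x\<bar> \<noteq> \<infinity>" using w by (simp add: regular_subgrad_def)
  then show "\<bar>f x + ereal (g x)\<bar> \<noteq> \<infinity>" by (cases "f x") auto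
  fix e :: real assume "e > 0"
  then obtain \<delta> where \<delta>: "\<delta> > 0"
    "\<And>z. norm (z - x) < \<delta> \<Longrightarrow> norm (g z - g x - d \<bullet> (z - x)) \<le> e / 2 * norm (z - x)"
    using der unfolding has_derivative_at_alt by (meson half_gt_zero)
  have "\<forall>\<^sub>F z in nhds x. norm (z - x) < \<delta>"
    using eventually_nhds_ball[OF \<delta>(1), of x] by eventually_elim (simp add: dist_norm norm_minus_commute)
  moreover have "\<forall>\<^sub>F z in nhds x. f x + ereal (w \<bullet> (z - x) - e / 2 * norm (z - x)) \<le> f z"
    using w half_gt_zero[OF \<open>e > 0\<close>] unfolding regular_subgrad_def by blast
  ultimately show "\<forall>\<^sub>F z in nhds x. f x + ereal (g x) + ereal ((w + d) \<bullet> (z - x) - e * norm (z - x))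
      \<le> f z + ereal (g z)"
  proof eventually_elim
    case (elim z)
    from \<delta>(2)[OF elim(1)] have "g z - g x \<ge> d \<bullet> (z - x) - e / 2 * norm (z - x)"
      unfolding real_norm_def by linarith
    then show ?case using elim(2) fin
      by (cases "f x"; cases "f z") (auto simp: inner_add_left field_simps)
  qed
qed

lemma subgradE:
  assumes "w \<in> subgrad f x"
  obtains X W where "\<bar>f x\<bar> \<noteq> \<infinity>" "X \<longlonglongrightarrow> x" "(\<lambda>k. f (X k)) \<longlonglongrightarrow> f x"
    "\<forall>k::nat. W k \<in> regular_subgrad f (X k)" "W \<longlonglongrightarrow> w"
  using assms unfolding subgrad_def by auto

lemma tendsto_if_dist_less_inverse:
  assumes "\<And>k::nat. dist (X k) x < 1 / real (Suc k)"
  shows "X \<longlonglongrightarrow> x"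
proof -
  have "(\<lambda>k. dist (X k) x) \<longlonglongrightarrow> 0"
    by (rule tendsto_sandwich[OF _ _ tendsto_const LIMSEQ_inverse_real_of_nat])
      (use assms in \<open>auto intro!: always_eventually less_imp_le simp: inverse_eq_divide simp del: of_nat_Suc\<close>)
  then show ?thesis using tendsto_dist_iff by blast
qed

text \<open>A form without sequences: closedness of the subgradient mapping becomes an e/2 argument
  in place of a diagonal sequence, and naming the real value a turns convergence of the values into
  |a' - a| < e.\<close>

lemma subgrad_iff:
  "w \<in> subgrad f x \<longleftrightarrow> (\<exists>a. f x = ereal a \<and> (\<forall>e>0. \<exists>x' w' a'. dist x' x < e \<and> dist w' w < e
      \<and> f x' = ereal a' \<and> \<bar>a' - a\<bar> < e \<and> w' \<in> regular_subgrad f x'))" (is "?L \<longleftrightarrow> ?R")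
proof
  assume ?L
  then obtain X W where fin: "\<bar>f x\<bar> \<noteq> \<infinity>" and X: "X \<longlonglongrightarrow> x" "(\<lambda>k. f (X k)) \<longlonglongrightarrow> f x"
    "\<forall>k::nat. W k \<in> regular_subgrad f (X k)" "W \<longlonglongrightarrow> w"
    by (rule subgradE)
  from fin obtain a where a: "f x = ereal a" by (cases "f x") auto
  have f: "f (X k) = ereal (real_of_ereal (f (X k)))" for k
    using X(3)[rule_format, of k] by (simp add: regular_subgrad_def ereal_real)
  have lim: "(\<lambda>k. real_of_ereal (f (X k))) \<longlonglongrightarrow> a"
    using X(2) a f lim_real_of_ereal by metis
  show ?R
  proof (rule exI[of _ a], intro conjI a allI impI)
    fix e :: real assume "e > 0"
    have "\<forall>\<^sub>F k in sequentially. dist (X k) x < e \<and> dist (W k) w < e \<and> dist (real_of_ereal (f (X k))) a < e"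
      by (intro eventually_conj tendstoD X lim \<open>e > 0\<close>)
    then obtain k where "dist (X k) x < e \<and> dist (W k) w < e \<and> dist (real_of_ereal (f (X k))) a < e"
      by (auto dest!: eventually_happens'[OF sequentially_bot])
    then show "\<exists>x' w' a'. dist x' x < e \<and> dist w' w < e \<and> f x' = ereal a' \<and> \<bar>a' - a\<bar> < e
        \<and> w' \<in> regular_subgrad f x'"
      using X(3)[rule_format, of k] f[of k] unfolding dist_real_def by metis
  qed
next
  assume ?R
  then obtain a where a: "f x = ereal a" and R: "\<forall>e>0. \<exists>x' w' a'. dist x' x < e \<and> dist w' w < e
      \<and> f x' = ereal a' \<and> \<bar>a' - a\<bar> < e \<and> w' \<in> regular_subgrad f x'" by blast
  define P where "P k x' w' a' \<longleftrightarrow> dist x' x < 1 / real (Suc k) \<and> dist w' w < 1 / real (Suc k)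
      \<and> f x' = ereal a' \<and> \<bar>a' - a\<bar> < 1 / real (Suc k) \<and> w' \<in> regular_subgrad f x'" for k x' w' a'
  have "\<exists>x' w' a'. P k x' w' a'" for k
    using R[rule_format, of "1 / real (Suc k)"] unfolding P_def by simp
  then obtain X W A where "\<And>k. P k (X k) (W k) (A k)" by metis
  then have X: "\<And>k::nat. dist (X k) x < 1 / real (Suc k)" "\<And>k::nat. dist (W k) w < 1 / real (Suc k)"
      "\<And>k. f (X k) = ereal (A k)" "\<And>k. \<bar>A k - a\<bar> < 1 / real (Suc k)" "\<And>k. W k \<in> regular_subgrad f (X k)"
    unfolding P_def by blast+
  have 1: "X \<longlonglongrightarrow> x" "W \<longlonglongrightarrow> w" "A \<longlonglongrightarrow> a"
    using X by (auto intro!: tendsto_if_dist_less_inverse simp: dist_real_def simp del: of_nat_Suc)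
  show ?L unfolding subgrad_def
  proof (intro CollectI conjI exI allI)
    show "(\<lambda>k. f (X k)) \<longlonglongrightarrow> f x" using 1(3) by (simp add: X(3) a)
  qed (use a 1 X(5) in auto)
qed

lemma regular_subset_subgrad: "regular_subgrad f x \<subseteq> subgrad f x"
proof
  fix w assume w: "w \<in> regular_subgrad f x"
  then obtain a where "f x = ereal a" by (cases "f x") (auto simp: regular_subgrad_def)
  with w show "w \<in> subgrad f x"
    unfolding subgrad_iff by (intro exI[of _ a]) (metis abs_zero diff_self dist_self)
qed

lemma subgrad_closed:
  assumes "\<And>k::nat. W k \<in> subgrad f (X k)" "X \<longlonglongrightarrow> x" "(\<lambda>k. f (X k)) \<longlonglongrightarrow> f x" "\<bar>f x\<bar> \<noteq> \<infinity>" "W \<longlonglongrightarrow> w"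
  shows "w \<in> subgrad f x"
proof -
  obtain a where a: "f x = ereal a" using assms(4) by (cases "f x") auto
  obtain A where A: "\<And>k. f (X k) = ereal (A k)" using assms(1) unfolding subgrad_iff by metis
  have lim: "A \<longlonglongrightarrow> a" using assms(3) by (simp add: a A)
  show ?thesis unfolding subgrad_iff
  proof (rule exI[of _ a], intro conjI a allI impI)
    fix e :: real assume "e > 0"
    then have e: "e / 2 > 0" by simp
    have "\<forall>\<^sub>F k in sequentially. dist (X k) x < e / 2 \<and> dist (W k) w < e / 2 \<and> dist (A k) a < e / 2"
      by (intro eventually_conj tendstoD assms lim e)
    then obtain k where k: "dist (X k) x < e / 2" "dist (W k) w < e / 2" "dist (A k) a < e / 2"
      by (auto dest!: eventually_happens'[OF sequentially_bot])
    obtain x' w' a' where *: "dist x' (X k) < e / 2" "dist w' (W k) < e / 2" "f x' = ereal a'"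
        "\<bar>a' - A k\<bar> < e / 2" "w' \<in> regular_subgrad f x'"
      using assms(1)[of k] e unfolding subgrad_iff A by fastforce
    have "dist x' x < e" using *(1) k(1) dist_triangle[of x' x "X k"] by linarith
    moreover have "dist w' w < e" using *(2) k(2) dist_triangle[of w' w "W k"] by linarith
    moreover have "\<bar>a' - a\<bar> < e" using *(4) k(3) by (simp add: dist_real_def abs_if split: if_splits)
    ultimately show "\<exists>x' w' a'. dist x' x < e \<and> dist w' w < e \<and> f x' = ereal a' \<and> \<bar>a' - a\<bar> < e
        \<and> w' \<in> regular_subgrad f x'" using *(3,5) by metis
  qed
qed

lemma subgrad_add_smooth:
  assumes w: "w \<in> subgrad f x"
    and der: "\<And>z. (g has_derivative (\<lambda>h. D z \<bullet> h)) (at z)" and D: "continuous_on UNIV D"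
  shows "w + D x \<in> subgrad (\<lambda>z. f z + ereal (g z)) x"
proof -
  from w obtain X W where fin: "\<bar>f x\<bar> \<noteq> \<infinity>" and X: "X \<longlonglongrightarrow> x" "(\<lambda>k. f (X k)) \<longlonglongrightarrow> f x"
    "\<forall>k::nat. W k \<in> regular_subgrad f (X k)" "W \<longlonglongrightarrow> w"
    by (rule subgradE)
  have g: "(\<lambda>k. g (X k)) \<longlonglongrightarrow> g x"
    using has_derivative_continuous[OF der] X(1) isCont_tendsto_compose by blast
  have DX: "(\<lambda>k. D (X k)) \<longlonglongrightarrow> D x"
    using D X(1) by (simp add: continuous_on_eq_continuous_at isCont_tendsto_compose)
  have "(\<lambda>k. f (X k) + ereal (g (X k))) \<longlonglongrightarrow> f x + ereal (g x)"
    by (rule tendsto_add_ereal) (use X g fin in auto)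
  moreover have "\<bar>f x + ereal (g x)\<bar> \<noteq> \<infinity>" using fin by (cases "f x") auto
  moreover have "(\<lambda>k. W k + D (X k)) \<longlonglongrightarrow> w + D x" by (intro tendsto_intros X DX)
  ultimately show ?thesis
    unfolding subgrad_def
    by (intro CollectI conjI exI[of _ X] exI[of _ "\<lambda>k. W k + D (X k)"] allI X(1) regular_subgrad_add_smooth[OF X(3)[rule_format] der])
qed


subsection \<open>Variational convexity as uniform quadratic growth\<close>

text \<open>At x + t (y - x), s-convexity bounds f from above with the gain s/2 t (1 - t) |y - x|^2,
  and the regular subgradient bounds it from below. Dividing by t and letting t tend to 0 keeps the
  full term s/2 |y - x|^2.\<close>

lemma s_convex_regular_subgrad:
  assumes conv: "s_convex s f" and w: "w \<in> regular_subgrad f x" and y: "f y \<noteq> -\<infinity>"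
  shows "f x + ereal (w \<bullet> (y - x) + s / 2 * (norm (y - x))\<^sup>2) \<le> f y"
proof (cases "f y")
  case (real b)
  obtain a where a: "f x = ereal a"
    using w by (cases "f x") (auto simp: regular_subgrad_def)
  define d where "d = y - x"
  have "w \<bullet> d + s / 2 * (norm d)\<^sup>2 \<le> b - a + e" if "e > 0" for e
  proof -
    \<comment> \<open>Makes the error \<epsilon> |d| at most e; the added 1 covers d = 0.\<close>
    define \<epsilon> where "\<epsilon> = e / (norm d + 1)"
    have "norm d + 1 > 0" by (simp add: add_nonneg_pos)
    then have \<epsilon>: "\<epsilon> > 0" "\<epsilon> * norm d \<le> e"
      unfolding \<epsilon>_def using that by (auto simp: field_simps)
    have "\<forall>\<^sub>F z in nhds x. f x + ereal (w \<bullet> (z - x) - \<epsilon> * norm (z - x)) \<le> f z"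
      using w \<epsilon>(1) unfolding regular_subgrad_def by blast
    moreover have "filterlim (\<lambda>t. x + t *\<^sub>R d) (nhds x) (at_right (0::real))"
      by (rule tendsto_eq_intros | simp)+
    ultimately have "\<forall>\<^sub>F t in at_right 0. f x + ereal (w \<bullet> (x + t *\<^sub>R d - x) - \<epsilon> * norm (x + t *\<^sub>R d - x))
        \<le> f (x + t *\<^sub>R d)"
      unfolding filterlim_iff by blast
    moreover have "\<forall>\<^sub>F t in at_right 0. (0::real) < t \<and> t < 1"
      using eventually_at_right_real[of 0 1] by (auto elim: eventually_mono)
    ultimately have ev: "\<forall>\<^sub>F t in at_right 0. w \<bullet> d - \<epsilon> * norm d + s / 2 * (1 - t) * (norm d)\<^sup>2 \<le> b - a"
    proof eventually_elim
      case (elim t)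
      define z where "z = (1 - t) *\<^sub>R x + t *\<^sub>R y"
      have z: "x + t *\<^sub>R d = z" by (simp add: z_def d_def algebra_simps)
      have "f z - ereal (s / 2 * (norm z)\<^sup>2) \<le> ereal (1 - t) * (f x - ereal (s / 2 * (norm x)\<^sup>2))
          + ereal t * (f y - ereal (s / 2 * (norm y)\<^sup>2))"
        using conv elim(2) unfolding s_convex_def econvex_on_def z_def by blast
      then have "f z \<le> ereal (s / 2 * (norm z)\<^sup>2 + (1 - t) * (a - s / 2 * (norm x)\<^sup>2) + t * (b - s / 2 * (norm y)\<^sup>2))"
        by (cases "f z") (auto simp: a real)
      also have "s / 2 * (norm z)\<^sup>2 + (1 - t) * (a - s / 2 * (norm x)\<^sup>2) + t * (b - s / 2 * (norm y)\<^sup>2)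
          = (1 - t) * a + t * b - s / 2 * (t * (1 - t)) * (norm d)\<^sup>2"
        unfolding z_def d_def power2_norm_eq_inner
        by (simp add: inner_simps inner_commute) (simp add: field_simps inner_commute)
      finally have "f z \<le> ereal ((1 - t) * a + t * b - s / 2 * (t * (1 - t)) * (norm d)\<^sup>2)" .
      with elim(1) have "f x + ereal (w \<bullet> (t *\<^sub>R d) - \<epsilon> * norm (t *\<^sub>R d))
          \<le> ereal ((1 - t) * a + t * b - s / 2 * (t * (1 - t)) * (norm d)\<^sup>2)"
        unfolding z by (simp add: z[symmetric])
      then have "t * (w \<bullet> d - \<epsilon> * norm d + s / 2 * (1 - t) * (norm d)\<^sup>2) \<le> t * (b - a)"
        using elim(2) by (simp add: a algebra_simps)
      then show ?case using elim(2) by simp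
    qed
    have "((\<lambda>t. w \<bullet> d - \<epsilon> * norm d + s / 2 * (1 - t) * (norm d)\<^sup>2)
        \<longlongrightarrow> w \<bullet> d - \<epsilon> * norm d + s / 2 * (1 - 0) * (norm d)\<^sup>2) (at_right (0::real))"
      by (intro tendsto_intros)
    then have "w \<bullet> d - \<epsilon> * norm d + s / 2 * (1 - 0) * (norm d)\<^sup>2 \<le> b - a"
      by (rule tendsto_upperbound[OF _ ev]) simp
    then show ?thesis using \<epsilon>(2) by simp
  qed
  then have "w \<bullet> d + s / 2 * (norm d)\<^sup>2 \<le> b - a" by (rule field_le_epsilon)
  then show ?thesis by (simp add: a real d_def)
qed (use y in auto)

lemma s_convex_subgrad:
  assumes conv: "s_convex s f" and w: "w \<in> subgrad f x" and y: "f y \<noteq> -\<infinity>"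
  shows "f x + ereal (w \<bullet> (y - x) + s / 2 * (norm (y - x))\<^sup>2) \<le> f y"
proof -
  from w obtain X W where fin: "\<bar>f x\<bar> \<noteq> \<infinity>" and X: "X \<longlonglongrightarrow> x" "(\<lambda>k. f (X k)) \<longlonglongrightarrow> f x"
    "\<forall>k::nat. W k \<in> regular_subgrad f (X k)" "W \<longlonglongrightarrow> w"
    by (rule subgradE)
  have "(\<lambda>k. W k \<bullet> (y - X k) + s / 2 * (norm (y - X k))\<^sup>2) \<longlonglongrightarrow> w \<bullet> (y - x) + s / 2 * (norm (y - x))\<^sup>2"
    by (intro tendsto_intros X)
  then have "(\<lambda>k. f (X k) + ereal (W k \<bullet> (y - X k) + s / 2 * (norm (y - X k))\<^sup>2))
      \<longlonglongrightarrow> f x + ereal (w \<bullet> (y - x) + s / 2 * (norm (y - x))\<^sup>2)"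
    by (intro tendsto_add_ereal) (use X fin in auto)
  then show ?thesis
    by (rule LIMSEQ_le_const2) (use s_convex_regular_subgrad[OF conv X(3)[rule_format] y] in auto)
qed

lemma closed_fun_SUP:
  assumes "\<And>i. i \<in> I \<Longrightarrow> continuous_on UNIV (g i)"
  shows "closed_fun (\<lambda>z. SUP i\<in>I. ereal (g i z))"
  unfolding closed_fun_iff less_SUP_iff
proof (intro allI impI)
  fix x c assume "\<exists>i\<in>I. c < ereal (g i x)"
  then obtain i where i: "i \<in> I" "c < ereal (g i x)" by blast
  have "(g i \<longlongrightarrow> g i x) (nhds x)"
    using assms[OF i(1)] unfolding continuous_on_def by (metis UNIV_I tendsto_at_iff_tendsto_nhds)
  then have "((\<lambda>z. ereal (g i z)) \<longlongrightarrow> ereal (g i x)) (nhds x)" by (intro tendsto_intros)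
  from order_tendstoD(1)[OF this i(2)] show "\<forall>\<^sub>F z in nhds x. \<exists>i\<in>I. c < ereal (g i z)"
    by eventually_elim (use i(1) in blast)
qed

text \<open>Each quadratic minus s/2 |p|^2 is affine in p, and a supremum of affine functions is
  convex.\<close>

lemma s_convex_SUP_quadratic:
  fixes z w :: "'i \<Rightarrow> 'a::real_inner"
  assumes "I \<noteq> {}"
  shows "s_convex s (\<lambda>p. SUP i\<in>I. ereal (a i + w i \<bullet> (p - z i) + s / 2 * (norm (p - z i))\<^sup>2))"
    (is "s_convex s ?f")
  unfolding s_convex_def econvex_on_def
proof (intro conjI ballI allI impI convex_UNIV)
  fix x y :: 'a and t :: real assume t: "0 < t \<and> t < 1"
  define q where "q p i = a i + w i \<bullet> (p - z i) + s / 2 * (norm (p - z i))\<^sup>2" for p i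
  have f: "?f p = (SUP i\<in>I. ereal (q p i))" for p by (simp add: q_def)
  have ub: "ereal (q p i) \<le> ?f p" if "i \<in> I" for p i
    unfolding f by (rule SUP_upper[OF that])
  obtain i0 where "i0 \<in> I" using assms by auto
  then have nm: "?f p \<noteq> -\<infinity>" for p using ub[of i0 p] by auto
  let ?p = "(1 - t) *\<^sub>R x + t *\<^sub>R y"
  show "?f ?p - ereal (s / 2 * (norm ?p)\<^sup>2)
    \<le> ereal (1 - t) * (?f x - ereal (s / 2 * (norm x)\<^sup>2)) + ereal t * (?f y - ereal (s / 2 * (norm y)\<^sup>2))"
  proof (cases "?f x = \<infinity> \<or> ?f y = \<infinity>")
    case True
    have E: "ereal (1 - t) * (?f x - ereal (s / 2 * (norm x)\<^sup>2)) + ereal t * (?f y - ereal (s / 2 * (norm y)\<^sup>2)) = \<infinity>"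
      using True nm[of x] nm[of y] t by (cases "?f x"; cases "?f y") auto
    show ?thesis unfolding E by (rule ereal_less_eq(1))
  next
    case False
    then obtain A B where AB: "?f x = ereal A" "?f y = ereal B"
      using nm[of x] nm[of y] by (cases "?f x"; cases "?f y") auto
    have "?f ?p \<le> ereal ((1 - t) * (A - s / 2 * (norm x)\<^sup>2) + t * (B - s / 2 * (norm y)\<^sup>2) + s / 2 * (norm ?p)\<^sup>2)"
    proof (rule SUP_least)
      fix i assume i: "i \<in> I"
      have 1: "(1 - t) * q x i \<le> (1 - t) * A" "t * q y i \<le> t * B"
        using ub[OF i, of x] ub[OF i, of y] t unfolding AB by auto
      have "q ?p i = (1 - t) * (q x i - s / 2 * (norm x)\<^sup>2) + t * (q y i - s / 2 * (norm y)\<^sup>2) + s / 2 * (norm ?p)\<^sup>2"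
        unfolding q_def power2_norm_eq_inner
        by (simp add: inner_simps inner_commute) (simp add: field_simps inner_commute)
      with 1 show "ereal (a i + w i \<bullet> (?p - z i) + s / 2 * (norm (?p - z i))\<^sup>2)
        \<le> ereal ((1 - t) * (A - s / 2 * (norm x)\<^sup>2) + t * (B - s / 2 * (norm y)\<^sup>2) + s / 2 * (norm ?p)\<^sup>2)"
        unfolding q_def[symmetric] by (simp add: algebra_simps)
    qed
    then show ?thesis unfolding AB by (cases "?f ?p") auto
  qed
qed

text \<open>The minorant \<open>fh\<close> is the supremum of the quadratics given by
  \<open>growth\<close> over the truncated graph G. At a point of G it touches f and keeps the
  subgradient. For the reverse inclusion of graphs, a subgradient w of \<open>fh\<close> at z is
  compared with a minimizer p of f - w near zb: p belongs to w in the graph of f, and strong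
  convexity of \<open>fh\<close> allows only one point with subgradient w.\<close>

lemma variationally_convexI:
  fixes f :: "'a::euclidean_space \<Rightarrow> ereal"
  assumes cl: "closed_fun f" and wb: "wb \<in> subgrad f zb" and s: "s > 0" and \<rho>: "\<rho> > 0" and \<alpha>: "f zb < ereal \<alpha>"
    and growth: "\<And>z w z'. \<lbrakk>z \<in> ball zb \<rho>; f z < ereal \<alpha>; w \<in> ball wb \<rho>; w \<in> subgrad f z; z' \<in> ball zb \<rho>\<rbrakk>
      \<Longrightarrow> f z + ereal (w \<bullet> (z' - z) + s / 2 * (norm (z' - z))\<^sup>2) \<le> f z'"
  shows "variationally_convex s f zb wb"
proof -
  obtain c where c: "f zb = ereal c" using wb unfolding subgrad_iff by blast
  define G where "G = {(z, w). z \<in> ball zb \<rho> \<and> f z < ereal \<alpha> \<and> w \<in> ball wb \<rho> \<and> w \<in> subgrad f z}"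
  define fr where "fr z = real_of_ereal (f z)" for z
  have fr: "f z = ereal (fr z)" if "w \<in> subgrad f z" for z w
    using that unfolding subgrad_iff fr_def by fastforce
  define fh where "fh p = (SUP i\<in>G. ereal (fr (fst i) + snd i \<bullet> (p - fst i) + s / 2 * (norm (p - fst i))\<^sup>2))" for p
  have G0: "(zb, wb) \<in> G" using wb \<rho> \<alpha> by (auto simp: G_def)
  have le: "fh p \<le> f p" if "p \<in> ball zb \<rho>" for p
    unfolding fh_def
  proof (rule SUP_least)
    fix i assume "i \<in> G"
    then obtain z w where i: "i = (z, w)" and zw: "(z, w) \<in> G" by (metis surj_pair)
    then have "f z + ereal (w \<bullet> (p - z) + s / 2 * (norm (p - z))\<^sup>2) \<le> f p"
      using growth that by (auto simp: G_def)
    moreover have "f z = ereal (fr z)" using zw fr by (auto simp: G_def)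
    ultimately show "ereal (fr (fst i) + snd i \<bullet> (p - fst i) + s / 2 * (norm (p - fst i))\<^sup>2) \<le> f p"
      by (simp add: i add.assoc)
  qed
  have ge: "ereal (fr z + w \<bullet> (p - z) + s / 2 * (norm (p - z))\<^sup>2) \<le> fh p" if "(z, w) \<in> G" for z w p
    unfolding fh_def using SUP_upper[OF that, of "\<lambda>i. ereal (fr (fst i) + snd i \<bullet> (p - fst i) + s / 2 * (norm (p - fst i))\<^sup>2)"]
    by simp
  have nm: "fh p \<noteq> -\<infinity>" for p using ge[OF G0, of p] by auto
  have fh_eq: "fh z = f z" if "(z, w) \<in> G" for z w
  proof (rule antisym)
    show "fh z \<le> f z" using le that by (auto simp: G_def)
    show "f z \<le> fh z" using ge[OF that, of z] that fr by (auto simp: G_def)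
  qed
  have cl_h: "closed_fun fh" unfolding fh_def
    by (rule closed_fun_SUP) (intro continuous_intros)
  have conv_h: "s_convex s fh" unfolding fh_def
    by (rule s_convex_SUP_quadratic) (use G0 in auto)
  have pr_h: "proper_fun fh"
    unfolding proper_fun_def using nm fh_eq[OF G0] c by (metis PInfty_neq_ereal(1))
  have sub_h: "w \<in> subgrad fh z" if zw: "(z, w) \<in> G" for z w
  proof (rule subsetD[OF regular_subset_subgrad])
    have f: "fh z = ereal (fr z)" using fh_eq[OF zw] zw fr by (auto simp: G_def)
    show "w \<in> regular_subgrad fh z" unfolding regular_subgrad_def
    proof (intro CollectI conjI allI impI always_eventually)
      show "\<bar>fh z\<bar> \<noteq> \<infinity>" by (simp add: f)
      fix \<epsilon> :: real and p assume "\<epsilon> > 0"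
      have "fh z + ereal (w \<bullet> (p - z) - \<epsilon> * norm (p - z))
          \<le> ereal (fr z + w \<bullet> (p - z) + s / 2 * (norm (p - z))\<^sup>2)"
      proof -
        have "0 \<le> \<epsilon> * norm (p - z)" "0 \<le> s / 2 * (norm (p - z))\<^sup>2" using \<open>\<epsilon> > 0\<close> s by simp_all
        then show ?thesis unfolding f plus_ereal.simps ereal_less_eq by linarith
      qed
      also have "\<dots> \<le> fh p" by (rule ge[OF zw])
      finally show "fh z + ereal (w \<bullet> (p - z) - \<epsilon> * norm (p - z)) \<le> fh p" .
    qed
  qed
  \<comment> \<open>For |w - wb| < \<sigma> the minimizer p below satisfies |p - zb| \<le> 2
    \<sigma> / s, and f p exceeds f zb by at most (|wb| + \<sigma>) 2 \<sigma> / s. The two bounds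
    keep p in the interior of the compact ball and its value below \<alpha>.\<close>
  have "\<forall>\<^sub>F \<sigma> in at_right (0::real). \<sigma> > 0 \<and> \<sigma> < \<rho> \<and> 2 * \<sigma> / s < \<rho> / 2 \<and> (norm wb + \<sigma>) * (2 * \<sigma> / s) < \<alpha> - c"
  proof (intro eventually_conj)
    show "\<forall>\<^sub>F \<sigma> in at_right (0::real). \<sigma> > 0" using eventually_at_right_real[OF \<rho>] by (auto elim: eventually_mono)
    show "\<forall>\<^sub>F \<sigma> in at_right (0::real). \<sigma> < \<rho>" using eventually_at_right_real[OF \<rho>] by (auto elim: eventually_mono)
    have "((\<lambda>\<sigma>. 2 * \<sigma> / s) \<longlongrightarrow> 2 * 0 / s) (at_right 0)" by (intro tendsto_intros) (use s in auto)
    then show "\<forall>\<^sub>F \<sigma> in at_right 0. 2 * \<sigma> / s < \<rho> / 2" by (rule order_tendstoD(2)) (use \<rho> in auto)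
    have "((\<lambda>\<sigma>. (norm wb + \<sigma>) * (2 * \<sigma> / s)) \<longlongrightarrow> (norm wb + 0) * (2 * 0 / s)) (at_right 0)"
      by (intro tendsto_intros) (use s in auto)
    then show "\<forall>\<^sub>F \<sigma> in at_right 0. (norm wb + \<sigma>) * (2 * \<sigma> / s) < \<alpha> - c"
      by (rule order_tendstoD(2)) (use \<alpha> c in auto)
  qed
  then obtain \<sigma> where \<sigma>: "\<sigma> > 0" "\<sigma> < \<rho>" "2 * \<sigma> / s < \<rho> / 2" "(norm wb + \<sigma>) * (2 * \<sigma> / s) < \<alpha> - c"
    by (auto dest!: eventually_happens'[OF trivial_limit_at_right_real])
  define X where "X = ball zb \<sigma>"
  define W where "W = ball wb \<sigma>"
  have subG: "(z, w) \<in> G" if "z \<in> X" "f z < ereal \<alpha>" "w \<in> W" "w \<in> subgrad f z" for z w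
    using that \<sigma> by (auto simp: G_def X_def W_def)
  have inG: "(z, w) \<in> G" if "z \<in> X" "w \<in> W" "w \<in> subgrad fh z" for z w
  proof -
    \<comment> \<open>The point at which f has subgradient w is found by minimizing f - w over a
      closed ball. Growth at (zb, wb) against minimality yields s/2 |p - zb|^2 \<le> (w - wb)
      \<bullet> (p - zb).\<close>
    have "closed_fun (\<lambda>p. f p + ereal ((- w) \<bullet> p))"
      by (intro closed_fun_add_continuous cl continuous_intros)
    moreover have "compact (cball zb (\<rho> / 2))" "cball zb (\<rho> / 2) \<noteq> {}" using \<rho> by auto
    ultimately obtain p where p: "p \<in> cball zb (\<rho> / 2)"
      and min: "\<And>q. q \<in> cball zb (\<rho> / 2) \<Longrightarrow> f p + ereal ((- w) \<bullet> p) \<le> f q + ereal ((- w) \<bullet> q)"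
      by (rule closed_fun_attains_min) blast
    have p\<rho>: "p \<in> ball zb \<rho>" using p \<rho> by auto
    have "f zb + ereal (wb \<bullet> (p - zb) + s / 2 * (norm (p - zb))\<^sup>2) \<le> f p"
      by (rule growth) (use wb \<rho> \<alpha> p\<rho> in auto)
    moreover have min0: "f p + ereal ((- w) \<bullet> p) \<le> f zb + ereal ((- w) \<bullet> zb)" by (rule min) (use \<rho> in auto)
    ultimately obtain b where b: "f p = ereal b" by (cases "f p") (auto simp: c)
    have "c + wb \<bullet> (p - zb) + s / 2 * (norm (p - zb))\<^sup>2 \<le> b"
      using \<open>f zb + ereal (wb \<bullet> (p - zb) + s / 2 * (norm (p - zb))\<^sup>2) \<le> f p\<close> by (simp add: b c)
    moreover have bc: "b \<le> c + w \<bullet> (p - zb)" using min0 by (simp add: b c inner_diff_right)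
    ultimately have "s / 2 * (norm (p - zb))\<^sup>2 \<le> (w - wb) \<bullet> (p - zb)"
      by (simp add: inner_diff_left)
    also have "\<dots> \<le> norm (w - wb) * norm (p - zb)" by (rule norm_cauchy_schwarz)
    also have "\<dots> \<le> \<sigma> * norm (p - zb)"
      using that(2) by (intro mult_right_mono) (auto simp: W_def dist_norm norm_minus_commute)
    finally have "norm (p - zb) * (s / 2 * norm (p - zb)) \<le> norm (p - zb) * \<sigma>"
      by (simp add: power2_eq_square mult_ac)
    then have "norm (p - zb) = 0 \<or> s / 2 * norm (p - zb) \<le> \<sigma>"
      by (metis mult_le_cancel_left_pos norm_ge_zero order_le_less)
    then have pn: "norm (p - zb) \<le> 2 * \<sigma> / s" using s \<sigma>(1) by (auto simp: field_simps)
    have "w \<bullet> (p - zb) \<le> norm w * norm (p - zb)" by (rule norm_cauchy_schwarz)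
    also have "\<dots> \<le> (norm wb + \<sigma>) * (2 * \<sigma> / s)"
    proof (rule mult_mono[OF _ pn])
      show "norm w \<le> norm wb + \<sigma>"
        using that(2) norm_triangle_sub[of w wb] by (auto simp: W_def dist_norm norm_minus_commute)
    qed (use \<sigma> in auto)
    finally have "b < \<alpha>" using bc \<sigma>(4) by simp
    have "p \<in> ball zb (\<rho> / 2)" using pn \<sigma>(3) by (auto simp: dist_norm norm_minus_commute)
    then have "\<forall>\<^sub>F q in nhds p. q \<in> ball zb (\<rho> / 2)" by (intro eventually_nhds_in_open) auto
    then have "\<forall>\<^sub>F q in nhds p. f p + ereal ((- w) \<bullet> p) \<le> f q + ereal ((- w) \<bullet> q)"
      by eventually_elim (rule min, auto)
    moreover have "((\<lambda>q. (- w) \<bullet> q) has_derivative (\<lambda>h. (- w) \<bullet> h)) (at p)"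
      by (rule has_derivative_inner_right) (rule has_derivative_ident)
    ultimately have "- (- w) \<in> regular_subgrad f p"
      by (intro regular_subgradI_min) (auto simp: b)
    then have wp: "w \<in> subgrad f p" using regular_subset_subgrad by fastforce
    then have pG: "(p, w) \<in> G"
      using p\<rho> \<open>b < \<alpha>\<close> b that(2) \<sigma> by (auto simp: G_def W_def)
    \<comment> \<open>Both p and z have w as subgradient of \<open>fh\<close>; in the sum of the two
      strong convexity inequalities everything cancels except s |z - p|^2 \<le> 0.\<close>
    have "fh p + ereal (w \<bullet> (z - p) + s / 2 * (norm (z - p))\<^sup>2) \<le> fh z"
      by (rule s_convex_subgrad[OF conv_h sub_h[OF pG] nm])
    moreover have "fh z + ereal (w \<bullet> (p - z) + s / 2 * (norm (p - z))\<^sup>2) \<le> fh p"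
      by (rule s_convex_subgrad[OF conv_h that(3) nm])
    moreover have "fh p = ereal b" using fh_eq[OF pG] b by simp
    moreover obtain d where "fh z = ereal d" using \<open>w \<in> subgrad fh z\<close> unfolding subgrad_iff by blast
    ultimately have "s * (norm (z - p))\<^sup>2 \<le> 0"
      by (simp add: inner_diff_right norm_minus_commute)
    then have "z = p" using s by (simp add: mult_le_0_iff)
    then show ?thesis using pG by simp
  qed
  show ?thesis
    unfolding variationally_convex_def
  proof (intro conjI wb, rule exI[of _ X], rule exI[of _ W], rule exI[of _ \<alpha>], rule exI[of _ fh],
      intro conjI cl_h pr_h conv_h \<alpha>)
    show "open X" "convex X" "zb \<in> X" "open W" "convex W" "wb \<in> W" using \<sigma> by (auto simp: X_def W_def)
    show "\<forall>z\<in>X. fh z \<le> f z" using le \<sigma> by (auto simp: X_def)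
    show "X \<times> W \<inter> gph (subgrad fh) = ({x \<in> X. f x < ereal \<alpha>} \<times> W) \<inter> gph (subgrad f)"
    proof (intro set_eqI iffI)
      fix q assume "q \<in> X \<times> W \<inter> gph (subgrad fh)"
      then obtain z w where q: "q = (z, w)" "z \<in> X" "w \<in> W" "w \<in> subgrad fh z" by (auto simp: gph_def)
      with inG[OF q(2-4)] show "q \<in> ({x \<in> X. f x < ereal \<alpha>} \<times> W) \<inter> gph (subgrad f)"
        by (auto simp: gph_def G_def)
    next
      fix q assume "q \<in> ({x \<in> X. f x < ereal \<alpha>} \<times> W) \<inter> gph (subgrad f)"
      then obtain z w where q: "q = (z, w)" "z \<in> X" "f z < ereal \<alpha>" "w \<in> W" "w \<in> subgrad f z"
        by (auto simp: gph_def)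
      with sub_h[OF subG[OF q(2-5)]] show "q \<in> X \<times> W \<inter> gph (subgrad fh)" by (auto simp: gph_def)
    qed
    show "\<forall>(z, w)\<in>X \<times> W \<inter> gph (subgrad fh). fh z = f z"
      using inG fh_eq by (auto simp: gph_def)
  qed
qed

text \<open>The strong convexity inequality of \<open>fh\<close> carries over to f because
  \<open>fh\<close> equals f at the graph point z and lies below f at z'.\<close>

lemma variationally_convexD:
  fixes f :: "'a::euclidean_space \<Rightarrow> ereal"
  assumes "variationally_convex s f zb wb"
  obtains \<rho> \<alpha> where "\<rho> > 0" "f zb < ereal \<alpha>"
    "\<And>z w z'. \<lbrakk>z \<in> ball zb \<rho>; f z < ereal \<alpha>; w \<in> ball wb \<rho>; w \<in> subgrad f z; z' \<in> ball zb \<rho>\<rbrakk>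
      \<Longrightarrow> f z + ereal (w \<bullet> (z' - z) + s / 2 * (norm (z' - z))\<^sup>2) \<le> f z'"
proof -
  from assms obtain X W \<alpha> fh where h: "open X" "zb \<in> X" "open W" "wb \<in> W" "f zb < ereal \<alpha>"
      "proper_fun fh" "s_convex s fh" "\<forall>z\<in>X. fh z \<le> f z"
      "X \<times> W \<inter> gph (subgrad fh) = ({x \<in> X. f x < ereal \<alpha>} \<times> W) \<inter> gph (subgrad f)"
      "\<forall>(z, w)\<in>X \<times> W \<inter> gph (subgrad fh). fh z = f z"
    unfolding variationally_convex_def by blast
  obtain r1 where r1: "r1 > 0" "ball zb r1 \<subseteq> X" using h(1,2) open_contains_ball by metis
  obtain r2 where r2: "r2 > 0" "ball wb r2 \<subseteq> W" using h(3,4) open_contains_ball by metis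
  show thesis
  proof (rule that[of "min r1 r2" \<alpha>])
    fix z w z' assume z: "z \<in> ball zb (min r1 r2)" "f z < ereal \<alpha>" "w \<in> ball wb (min r1 r2)"
      "w \<in> subgrad f z" "z' \<in> ball zb (min r1 r2)"
    have X: "z \<in> X" "w \<in> W" "z' \<in> X" using z r1 r2 by auto
    then have "(z, w) \<in> ({x \<in> X. f x < ereal \<alpha>} \<times> W) \<inter> gph (subgrad f)" using z by (auto simp: gph_def)
    then have zw: "(z, w) \<in> X \<times> W \<inter> gph (subgrad fh)" unfolding h(9) .
    then have "w \<in> subgrad fh z" by (auto simp: gph_def)
    moreover have "fh z' \<noteq> -\<infinity>" using h(6) by (auto simp: proper_fun_def)
    ultimately have "fh z + ereal (w \<bullet> (z' - z) + s / 2 * (norm (z' - z))\<^sup>2) \<le> fh z'"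
      by (intro s_convex_subgrad[OF h(7)])
    moreover have "fh z = f z" using h(10) zw by blast
    moreover have "fh z' \<le> f z'" using h(8) X by blast
    ultimately show "f z + ereal (w \<bullet> (z' - z) + s / 2 * (norm (z' - z))\<^sup>2) \<le> f z'" by simp
  qed (use r1 r2 h in auto)
qed


subsection \<open>Multipliers under the constraint qualification\<close>

lemma closed_fun_limit_le:
  assumes "closed_fun f" "X \<longlonglongrightarrow> x" "\<And>k::nat. f (X k) \<le> ereal (B k)" "B \<longlonglongrightarrow> b"
  shows "f x \<le> ereal b"
proof (rule ccontr)
  assume "\<not> f x \<le> ereal b"
  then obtain d where d: "ereal b < ereal d" "ereal d < f x"
    using ereal_dense2[of "ereal b" "f x"] by (auto simp: not_le)
  have "\<forall>\<^sub>F k in sequentially. ereal d < f (X k)"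
    using assms(1,2) d(2) unfolding closed_fun_iff filterlim_iff by blast
  moreover have "\<forall>\<^sub>F k in sequentially. B k < d"
    using assms(4) d(1) by (intro order_tendstoD(2)) auto
  ultimately have "\<forall>\<^sub>F k in sequentially. False"
    by eventually_elim (use assms(3) in \<open>meson ereal_less_eq(3) leD less_imp_le order.strict_trans2\<close>)
  then show False by simp
qed

text \<open>Lower semicontinuity supplies the lower estimate of \<open>\<phi> (x, u)\<close>, so an upper bound is enough to make
  the neighborhood \<open>\<phi>\<close>-attentive.\<close>

definition multiplier_near ::
    "('a::euclidean_space \<times> 'b::euclidean_space \<Rightarrow> ereal) \<Rightarrow> 'a \<Rightarrow> real \<Rightarrow> 'a \<Rightarrow> 'b \<Rightarrow> 'a \<Rightarrow> 'b \<Rightarrow> bool" where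
  "multiplier_near \<phi> xb \<rho> x u v y \<longleftrightarrow> norm (x - xb) < \<rho> \<and> norm u < \<rho> \<and> norm v < \<rho> \<and>
     \<phi> (x, u) < \<phi> (xb, 0) + ereal \<rho> \<and> (v, y) \<in> subgrad \<phi> (x, u)"

lemma multiplier_near_mono:
  assumes "multiplier_near \<phi> xb \<rho> x u v y" "\<rho> \<le> \<rho>'"
  shows "multiplier_near \<phi> xb \<rho>' x u v y"
proof -
  have "\<phi> (xb, 0) + ereal \<rho> \<le> \<phi> (xb, 0) + ereal \<rho>'" using assms(2) by (intro add_left_mono) simp
  then show ?thesis using assms unfolding multiplier_near_def by (auto intro: order.strict_trans2)
qed

lemma multiplier_near_tendsto:
  assumes cl: "closed_fun \<phi>" and c: "\<phi> (xb, 0) = ereal c"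
    and near: "\<And>k::nat. multiplier_near \<phi> xb (1 / real (Suc k)) (X k) (U k) (V k) (Y k)"
  shows "X \<longlonglongrightarrow> xb" "U \<longlonglongrightarrow> 0" "V \<longlonglongrightarrow> 0" "(\<lambda>k. \<phi> (X k, U k)) \<longlonglongrightarrow> \<phi> (xb, 0)"
proof -
  show *: "X \<longlonglongrightarrow> xb" "U \<longlonglongrightarrow> 0" "V \<longlonglongrightarrow> 0"
    using near unfolding multiplier_near_def
    by (auto intro!: tendsto_if_dist_less_inverse simp: dist_norm simp del: of_nat_Suc)
  show "(\<lambda>k. \<phi> (X k, U k)) \<longlonglongrightarrow> \<phi> (xb, 0)"
  proof (rule closed_fun_tendsto[OF cl _ c, where B="\<lambda>k. c + 1 / real (Suc k)"])
    show "(\<lambda>k. (X k, U k)) \<longlonglongrightarrow> (xb, 0)" by (intro tendsto_intros *)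
    show "\<phi> (X k, U k) \<le> ereal (c + 1 / real (Suc k))" for k
      using near[of k] unfolding multiplier_near_def by (auto simp: c)
    have "(\<lambda>k. 1 / real (Suc k)) \<longlonglongrightarrow> 0"
      using LIMSEQ_inverse_real_of_nat by (simp add: inverse_eq_divide)
    then have "(\<lambda>k. c + 1 / real (Suc k)) \<longlonglongrightarrow> c + 0" by (intro tendsto_intros)
    then show "(\<lambda>k. c + 1 / real (Suc k)) \<longlonglongrightarrow> c" by simp
  qed
qed

text \<open>Horizon subgradients are built from regular subgradients, so a large limiting multiplier
  has to be traded for a large regular one. All conditions involved are strict, and h is the
  smallest of their slacks.\<close>

lemma multiplier_near_regular:
  assumes near: "multiplier_near \<phi> xb \<rho> x u v y" and c: "\<phi> (xb, 0) = ereal c" and K: "norm y > K"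
  shows "\<exists>x' u' v' y'. multiplier_near \<phi> xb \<rho> x' u' v' y' \<and> (v', y') \<in> regular_subgrad \<phi> (x', u') \<and> norm y' > K"
proof -
  obtain a where a: "\<phi> (x, u) = ereal a" and
    sub: "\<forall>h>0. \<exists>x' w' a'. dist x' (x, u) < h \<and> dist w' (v, y) < h \<and> \<phi> x' = ereal a' \<and> \<bar>a' - a\<bar> < h
        \<and> w' \<in> regular_subgrad \<phi> x'"
    using near unfolding multiplier_near_def subgrad_iff by blast
  define h where "h = Min {\<rho> - norm (x - xb), \<rho> - norm u, \<rho> - norm v, c + \<rho> - a, norm y - K}"
  have "h > 0" using near K unfolding multiplier_near_def h_def by (simp add: a c)
  then obtain z w a' where zw: "dist z (x, u) < h" "dist w (v, y) < h" "\<phi> z = ereal a'" "\<bar>a' - a\<bar> < h"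
      "w \<in> regular_subgrad \<phi> z" using sub by blast
  obtain x' u' v' y' where eq: "z = (x', u')" "w = (v', y')" by (metis surj_pair)
  have d: "norm (x' - x) < h" "norm (u' - u) < h" "norm (v' - v) < h" "norm (y' - y) < h"
    using zw(1,2) dist_fst_le[of z "(x, u)"] dist_snd_le[of z "(x, u)"] dist_fst_le[of w "(v, y)"]
      dist_snd_le[of w "(v, y)"] by (auto simp: eq dist_norm)
  have h: "h \<le> \<rho> - norm (x - xb)" "h \<le> \<rho> - norm u" "h \<le> \<rho> - norm v" "h \<le> c + \<rho> - a" "h \<le> norm y - K"
    unfolding h_def by auto
  have 1: "norm (x' - xb) < \<rho>" using norm_triangle_ineq[of "x' - x" "x - xb"] d(1) h(1) by simp
  have 2: "norm u' < \<rho>" using norm_triangle_sub[of u' u] d(2) h(2) by simp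
  have 3: "norm v' < \<rho>" using norm_triangle_sub[of v' v] d(3) h(3) by simp
  have 4: "norm y' > K" using norm_triangle_sub[of y y'] d(4) h(5) by (simp add: norm_minus_commute)
  have 5: "a' < c + \<rho>" using zw(4) h(4) by simp
  show ?thesis
    using 1 2 3 4 5 zw regular_subset_subgrad[of \<phi> "(x', u')"] unfolding multiplier_near_def eq c
    by (rule_tac exI[of _ x'], rule_tac exI[of _ u'], rule_tac exI[of _ v'], rule_tac exI[of _ y']) auto
qed

text \<open>Normalizing multipliers of unbounded size produces a nonzero horizon subgradient.\<close>

lemma multiplier_near_bounded:
  assumes cl: "closed_fun \<phi>" and c: "\<phi> (xb, 0) = ereal c"
    and bcq: "\<forall>y. (0, y) \<in> horizon_subgrad \<phi> (xb, 0) \<longrightarrow> y = 0"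
  obtains \<rho> K where "\<rho> > 0" "\<And>x u v y. multiplier_near \<phi> xb \<rho> x u v y \<Longrightarrow> norm y \<le> K"
proof -
  have "\<exists>\<rho>>0. \<exists>K. \<forall>x u v y. multiplier_near \<phi> xb \<rho> x u v y \<longrightarrow> norm y \<le> K"
  proof (rule ccontr)
    assume no: "\<not> ?thesis"
    define P where "P k x u v y \<longleftrightarrow> multiplier_near \<phi> xb (1 / real (Suc k)) x u v y
        \<and> (v, y) \<in> regular_subgrad \<phi> (x, u) \<and> norm y > real (Suc k)" for k x u v y
    have "\<exists>x u v y. P k x u v y" for k
    proof -
      have "(1 / real (Suc k)) > 0" by simp
      with no obtain x u v y where "multiplier_near \<phi> xb (1 / real (Suc k)) x u v y" "norm y > real (Suc k)"
        by (meson not_le)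
      from multiplier_near_regular[OF this(1) c this(2)] show ?thesis unfolding P_def by blast
    qed
    then obtain X U V Y where P: "\<And>k. P k (X k) (U k) (V k) (Y k)" by metis
    then have near: "\<And>k. multiplier_near \<phi> xb (1 / real (Suc k)) (X k) (U k) (V k) (Y k)"
      and reg: "\<And>k. (V k, Y k) \<in> regular_subgrad \<phi> (X k, U k)" and big: "\<And>k. norm (Y k) > real (Suc k)"
      unfolding P_def by blast+
    note lim = multiplier_near_tendsto[OF cl c near]
    define t where "t k = 1 / norm (Y k)" for k
    have pos: "norm (Y k) > 0" for k using big[of k] by linarith
    have tpos: "t k > 0" for k using pos[of k] by (simp add: t_def)
    have t0: "t \<longlonglongrightarrow> 0"
    proof (rule tendsto_if_dist_less_inverse)
      show "dist (t k) 0 < 1 / real (Suc k)" for k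
        using big[of k] pos[of k] unfolding t_def dist_real_def by (simp add: frac_less2)
    qed
    have "(t k *\<^sub>R Y k) \<in> sphere 0 1" for k using pos[of k] by (simp add: t_def)
    then obtain \<eta> r where \<eta>: "\<eta> \<in> sphere 0 1" "strict_mono r" "((\<lambda>k. t k *\<^sub>R Y k) \<circ> r) \<longlonglongrightarrow> \<eta>"
      using compact_sphere[of 0 1] unfolding compact_def by (metis (no_types, lifting))
    have "(0, \<eta>) \<in> horizon_subgrad \<phi> (xb, 0)"
      unfolding horizon_subgrad_def
    proof (intro CollectI conjI)
      show "\<bar>\<phi> (xb, 0)\<bar> \<noteq> \<infinity>" by (simp add: c)
      have l: "(\<lambda>k. (X (r k), U (r k))) \<longlonglongrightarrow> (xb, 0)"
        by (intro tendsto_intros LIMSEQ_subseq_LIMSEQ[OF lim(1) \<eta>(2), unfolded o_def]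
            LIMSEQ_subseq_LIMSEQ[OF lim(2) \<eta>(2), unfolded o_def])
      have l2: "(\<lambda>k. \<phi> (X (r k), U (r k))) \<longlonglongrightarrow> \<phi> (xb, 0)"
        using LIMSEQ_subseq_LIMSEQ[OF lim(4) \<eta>(2)] by (simp add: o_def)
      have tr: "(\<lambda>k. t (r k)) \<longlonglongrightarrow> 0" using LIMSEQ_subseq_LIMSEQ[OF t0 \<eta>(2)] by (simp add: o_def)
      \<comment> \<open>The v-components tend to 0 already before scaling, so the limit has the form
        (0, \<eta>) with |\<eta>| = 1, which the constraint qualification excludes.\<close>
      have "(\<lambda>k. t (r k) *\<^sub>R V (r k)) \<longlonglongrightarrow> 0 *\<^sub>R 0"
        by (intro tendsto_intros tr LIMSEQ_subseq_LIMSEQ[OF lim(3) \<eta>(2), unfolded o_def])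
      then have "(\<lambda>k. (t (r k) *\<^sub>R V (r k), t (r k) *\<^sub>R Y (r k))) \<longlonglongrightarrow> (0, \<eta>)"
        using \<eta>(3) by (intro tendsto_Pair) (auto simp: o_def)
      then have l3: "(\<lambda>k. t (r k) *\<^sub>R (V (r k), Y (r k))) \<longlonglongrightarrow> (0, \<eta>)" by simp
      show "\<exists>X W c. X \<longlonglongrightarrow> (xb, 0) \<and> (\<lambda>k. \<phi> (X k)) \<longlonglongrightarrow> \<phi> (xb, 0) \<and>
          (\<forall>k. W k \<in> regular_subgrad \<phi> (X k)) \<and> (\<forall>k. 0 < (c k :: real)) \<and> c \<longlonglongrightarrow> 0 \<and> (\<lambda>k. c k *\<^sub>R W k) \<longlonglongrightarrow> (0, \<eta>)"
        using l l2 l3 tr reg tpos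
        by (rule_tac exI[of _ "\<lambda>k. (X (r k), U (r k))"], rule_tac exI[of _ "\<lambda>k. (V (r k), Y (r k))"],
            rule_tac exI[of _ "\<lambda>k. t (r k)"]) auto
    qed
    then show False using bcq \<eta>(1) by auto
  qed
  then show thesis using that by blast
qed

text \<open>Compactness over the multipliers: if the property failed for every k, the offending
  multipliers, bounded by K, would cluster at some yb, which closedness makes a multiplier at xb,
  and the local property around yb would be violated. Since Q depends on k, the constants in Q may
  weaken together with the radius.\<close>

lemma multiplier_uniform:
  assumes cl: "closed_fun \<phi>" and c: "\<phi> (xb, 0) = ereal c"
    and \<rho>0: "\<rho>0 > 0" and K: "\<And>x u v y. multiplier_near \<phi> xb \<rho>0 x u v y \<Longrightarrow> norm y \<le> K"
    and loc: "\<And>yb. (0, yb) \<in> subgrad \<phi> (xb, 0) \<Longrightarrow> \<exists>\<rho>>0. \<exists>N. \<forall>k\<ge>N. \<forall>x u v y.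
        multiplier_near \<phi> xb \<rho> x u v y \<and> norm (y - yb) < \<rho> \<longrightarrow> Q (k::nat) x u v y"
  shows "\<exists>k. \<forall>x u v y. multiplier_near \<phi> xb (1 / real (Suc k)) x u v y \<longrightarrow> Q k x u v y"
proof (rule ccontr)
  assume "\<not> ?thesis"
  then have "\<forall>k. \<exists>x u v y. multiplier_near \<phi> xb (1 / real (Suc k)) x u v y \<and> \<not> Q k x u v y" by blast
  then obtain X U V Y where near: "\<And>k. multiplier_near \<phi> xb (1 / real (Suc k)) (X k) (U k) (V k) (Y k)"
    and nQ: "\<And>k. \<not> Q k (X k) (U k) (V k) (Y k)" by metis
  note lim = multiplier_near_tendsto[OF cl c near]
  \<comment> \<open>From N0 on the radius is below \<rho>0, so K bounds the shifted
    sequence.\<close>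
  obtain N0 where N0: "1 / real (Suc N0) < \<rho>0" using \<rho>0 nat_approx_posE by metis
  have small: "1 / real (Suc k) \<le> 1 / real (Suc n)" if "n \<le> k" for k n
    using that by (simp add: frac_le)
  have "Y (k + N0) \<in> cball 0 K" for k
    using K[OF multiplier_near_mono[OF near]] N0 small[of N0 "k + N0"] by (simp add: less_imp_le)
  then obtain yb r where r: "strict_mono r" "((\<lambda>k. Y (k + N0)) \<circ> r) \<longlonglongrightarrow> yb"
    using compact_cball[of 0 K] unfolding compact_def by (metis (no_types, lifting))
  define q where "q k = r k + N0" for k
  have q: "strict_mono q" using r(1) by (simp add: q_def strict_mono_def)
  have Yq: "(\<lambda>k. Y (q k)) \<longlonglongrightarrow> yb" using r(2) by (simp add: o_def q_def)
  have "(0, yb) \<in> subgrad \<phi> (xb, 0)"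
  proof (rule subgrad_closed)
    show "(V (q k), Y (q k)) \<in> subgrad \<phi> (X (q k), U (q k))" for k
      using near[of "q k"] by (simp add: multiplier_near_def)
    show "(\<lambda>k. (X (q k), U (q k))) \<longlonglongrightarrow> (xb, 0)"
      by (intro tendsto_intros LIMSEQ_subseq_LIMSEQ[OF lim(1) q, unfolded o_def]
          LIMSEQ_subseq_LIMSEQ[OF lim(2) q, unfolded o_def])
    show "(\<lambda>k. \<phi> (X (q k), U (q k))) \<longlonglongrightarrow> \<phi> (xb, 0)"
      using LIMSEQ_subseq_LIMSEQ[OF lim(4) q] by (simp add: o_def)
    show "(\<lambda>k. (V (q k), Y (q k))) \<longlonglongrightarrow> (0, yb)"
      by (intro tendsto_intros Yq LIMSEQ_subseq_LIMSEQ[OF lim(3) q, unfolded o_def])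
  qed (simp add: c)
  then obtain \<rho> N where \<rho>: "\<rho> > 0" "\<forall>k\<ge>N. \<forall>x u v y.
        multiplier_near \<phi> xb \<rho> x u v y \<and> norm (y - yb) < \<rho> \<longrightarrow> Q (k::nat) x u v y"
    using loc by blast
  obtain N1 where N1: "1 / real (Suc N1) < \<rho>" using \<rho>(1) nat_approx_posE by metis
  have "\<forall>\<^sub>F k in sequentially. dist (Y (q k)) yb < \<rho> \<and> k \<ge> N + N1"
    by (intro eventually_conj tendstoD[OF Yq \<rho>(1)] eventually_ge_at_top)
  then obtain k where k: "dist (Y (q k)) yb < \<rho>" "k \<ge> N + N1"
    by (auto dest!: eventually_happens'[OF sequentially_bot])
  have "q k \<ge> N + N1" using seq_suble[OF q, of k] k(2) by linarith
  then have "q k \<ge> N" "multiplier_near \<phi> xb \<rho> (X (q k)) (U (q k)) (V (q k)) (Y (q k))"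
    using multiplier_near_mono[OF near] N1 small[of N1 "q k"] by auto
  then show False using \<rho>(2) k(1) nQ[of "q k"] by (auto simp: dist_norm)
qed

text \<open>The multiplier is the limit of the partial gradients in \<open>u\<close> of a penalty for the
  constraint on \<open>u\<close>.\<close>

lemma local_min_has_multiplier:
  fixes \<phi> :: "'a::euclidean_space \<times> 'b::euclidean_space \<Rightarrow> ereal"
  assumes cl: "closed_fun \<phi>" and pr: "proper_fun \<phi>" and a: "\<phi> (x, u) = ereal a"
    and h: "h > 0" and min: "\<And>x'. x' \<in> cball x h \<Longrightarrow> \<phi> (x, u) + ereal (v \<bullet> (x' - x)) \<le> \<phi> (x', u)"
    and near: "norm (x - xb) < \<rho>" "norm u < \<rho>" "norm v < \<rho>" "\<phi> (x, u) < \<phi> (xb, 0) + ereal \<rho>"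
    and K: "\<And>x u v y. multiplier_near \<phi> xb \<rho> x u v y \<Longrightarrow> norm y \<le> K"
  shows "\<exists>y. (v, y) \<in> subgrad \<phi> (x, u)"
proof -
  have nm: "\<phi> z \<noteq> -\<infinity>" for z using pr unfolding proper_fun_def by blast
  define C where "C = cball x h \<times> cball u h"
  have C: "compact C" "C \<noteq> {}" "(x, u) \<in> C" using h by (auto simp: C_def compact_Times)
  \<comment> \<open>The term k |u' - u|^2 drives the minimizers to u, and |x' - x|^2 makes x the
    only possible limit of their x-parts. The gradients of both terms in x vanish in the limit
    except for -v.\<close>
  define g where "g k z = - (v \<bullet> (fst z - x)) + (norm (fst z - x))\<^sup>2 + real k * (norm (snd z - u))\<^sup>2"
    for k :: nat and z :: "'a \<times> 'b"
  have "\<exists>z. z \<in> C \<and> (\<forall>z'\<in>C. \<phi> z + ereal (g k z) \<le> \<phi> z' + ereal (g k z'))" for k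
  proof -
    have "closed_fun (\<lambda>z. \<phi> z + ereal (g k z))"
      unfolding g_def by (intro closed_fun_add_continuous cl continuous_intros)
    from closed_fun_attains_min[OF this C(1,2)] show ?thesis by metis
  qed
  then obtain Z where Z: "\<And>k. Z k \<in> C" and Zmin: "\<And>k z. z \<in> C \<Longrightarrow> \<phi> (Z k) + ereal (g k (Z k)) \<le> \<phi> z + ereal (g k z)"
    by metis
  define X where "X k = fst (Z k)" for k
  define U where "U k = snd (Z k)" for k
  have XU: "Z k = (X k, U k)" for k by (simp add: X_def U_def)
  have XC: "norm (X k - x) \<le> h" "norm (U k - u) \<le> h" for k
    using Z[of k] by (auto simp: C_def XU dist_norm norm_minus_commute)
  have Zle: "\<phi> (Z k) + ereal (g k (Z k)) \<le> ereal a" for k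
    using Zmin[OF C(3), of k] by (simp add: a g_def)
  define A where "A k = real_of_ereal (\<phi> (Z k))" for k
  have "\<bar>\<phi> (Z k)\<bar> \<noteq> \<infinity>" for k using Zle[of k] nm[of "Z k"] by (cases "\<phi> (Z k)") auto
  then have A: "\<phi> (Z k) = ereal (A k)" for k by (simp add: A_def ereal_real)
  have Ag: "A k + g k (Z k) \<le> a" for k using Zle[of k] by (simp add: A)
  obtain z0 where z0: "\<And>z. z \<in> C \<Longrightarrow> \<phi> z0 \<le> \<phi> z"
    by (rule closed_fun_attains_min[OF cl C(1,2)]) blast
  have "\<bar>\<phi> z0\<bar> \<noteq> \<infinity>" using nm[of z0] z0[OF C(3)] a by (cases "\<phi> z0") auto
  then obtain b where "\<phi> z0 = ereal b" by (cases "\<phi> z0") auto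
  then have b: "\<And>z. z \<in> C \<Longrightarrow> ereal b \<le> \<phi> z" using z0 by simp
  \<comment> \<open>Since \<phi> is at least b on C and the tilt is at most |v| h there, the penalty
    term cannot exceed B.\<close>
  define B where "B = a - b + norm v * h"
  have vX: "v \<bullet> (X k - x) \<le> norm v * h" for k
    using norm_cauchy_schwarz[of v "X k - x"] mult_left_mono[OF XC(1)[of k] norm_ge_zero[of v]] by linarith
  have kB: "real k * (norm (U k - u))\<^sup>2 \<le> B" for k
  proof -
    have "b \<le> A k" using b[OF Z[of k]] by (simp add: A)
    moreover have "0 \<le> (norm (X k - x))\<^sup>2" by simp
    ultimately show ?thesis
      using Ag[of k] vX[of k] unfolding g_def B_def XU fst_conv snd_conv by linarith
  qed
  have U: "U \<longlonglongrightarrow> u"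
  proof -
    have "(\<lambda>k. (norm (U k - u))\<^sup>2) \<longlonglongrightarrow> 0"
    proof (rule tendsto_sandwich[OF _ _ tendsto_const])
      show "\<forall>\<^sub>F k in sequentially. (norm (U k - u))\<^sup>2 \<le> B / real k"
        using eventually_gt_at_top[of 0] by eventually_elim (use kB in \<open>simp add: field_simps\<close>)
      show "(\<lambda>k. B / real k) \<longlonglongrightarrow> 0" by (rule lim_const_over_n)
    qed simp
    then have "(\<lambda>k. sqrt ((norm (U k - u))\<^sup>2)) \<longlonglongrightarrow> sqrt 0" by (rule tendsto_real_sqrt)
    then have "(\<lambda>k. norm (U k - u)) \<longlonglongrightarrow> 0" by simp
    then show ?thesis by (metis LIM_zero_cancel tendsto_norm_zero_cancel)
  qed
  obtain xh r where r: "strict_mono r" "(X \<circ> r) \<longlonglongrightarrow> xh" "xh \<in> cball x h"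
    using compact_cball[of x h] XC(1) unfolding compact_def
    by (metis (no_types, lifting) dist_norm mem_cball norm_minus_commute)
  have Xr: "(\<lambda>k. X (r k)) \<longlonglongrightarrow> xh" using r(2) by (simp add: o_def)
  have Ur: "(\<lambda>k. U (r k)) \<longlonglongrightarrow> u" using LIMSEQ_subseq_LIMSEQ[OF U r(1)] by (simp add: o_def)
  have Ale: "A k \<le> a + v \<bullet> (X k - x) - (norm (X k - x))\<^sup>2" for k
  proof -
    have "0 \<le> real k * (norm (U k - u))\<^sup>2" by simp
    then show ?thesis using Ag[of k] unfolding g_def XU fst_conv snd_conv by linarith
  qed
  have Zr: "(\<lambda>k. Z (r k)) \<longlonglongrightarrow> (xh, u)" unfolding XU by (intro tendsto_intros Xr Ur)
  have Blim: "(\<lambda>k. a + v \<bullet> (X (r k) - x) - (norm (X (r k) - x))\<^sup>2) \<longlonglongrightarrow> a + v \<bullet> (xh - x) - (norm (xh - x))\<^sup>2"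
    by (intro tendsto_intros Xr)
  \<comment> \<open>The limit inherits the gain - |xh - x|^2 from the added square, while
    \<open>min\<close> says that there is no gain; hence xh = x.\<close>
  have "\<phi> (xh, u) \<le> ereal (a + v \<bullet> (xh - x) - (norm (xh - x))\<^sup>2)"
    by (rule closed_fun_limit_le[OF cl Zr _ Blim]) (simp add: A Ale)
  moreover have "ereal (a + v \<bullet> (xh - x)) \<le> \<phi> (xh, u)" using min[OF r(3)] by (simp add: a)
  ultimately have "ereal (a + v \<bullet> (xh - x)) \<le> ereal (a + v \<bullet> (xh - x) - (norm (xh - x))\<^sup>2)" by (rule order_trans[rotated])
  then have "(norm (xh - x))\<^sup>2 \<le> 0" by simp
  then have xh: "xh = x" by simp
  have \<phi>r: "(\<lambda>k. \<phi> (Z (r k))) \<longlonglongrightarrow> \<phi> (x, u)"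
    by (rule closed_fun_tendsto[OF cl Zr[unfolded xh] a _ Blim[unfolded xh, simplified]]) (simp add: A Ale)
  define V where "V k = v - 2 *\<^sub>R (X k - x)" for k
  define Y where "Y k = - (2 * real k) *\<^sub>R (U k - u)" for k
  have Vr: "(\<lambda>k. V (r k)) \<longlonglongrightarrow> v"
  proof -
    have "(\<lambda>k. V (r k)) \<longlonglongrightarrow> v - 2 *\<^sub>R (x - x)" unfolding V_def by (intro tendsto_intros Xr[unfolded xh])
    then show ?thesis by simp
  qed
  have reg: "(V k, Y k) \<in> regular_subgrad \<phi> (Z k)" if int: "norm (X k - x) < h" "norm (U k - u) < h" for k
  proof -
    have "Z k \<in> ball x h \<times> ball u h" using int by (auto simp: XU dist_norm norm_minus_commute)
    then have "\<forall>\<^sub>F z in nhds (Z k). z \<in> ball x h \<times> ball u h"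
      by (intro eventually_nhds_in_open open_Times) auto
    then have ev: "\<forall>\<^sub>F z in nhds (Z k). \<phi> (Z k) + ereal (g k (Z k)) \<le> \<phi> z + ereal (g k z)"
      by eventually_elim (rule Zmin, auto simp: C_def)
    have "(g k has_derivative (\<lambda>h. (- V k, - Y k) \<bullet> h)) (at (Z k))"
      unfolding g_def V_def Y_def power2_norm_eq_inner XU
      by (auto intro!: derivative_eq_intros simp: inner_prod_def inner_simps inner_commute algebra_simps)
    from regular_subgradI_min[OF _ ev this] show ?thesis by (simp add: A)
  qed
  have "\<forall>\<^sub>F k in sequentially. norm (X (r k) - x) < h \<and> norm (U (r k) - u) < h \<and>
      norm (X (r k) - xb) < \<rho> \<and> norm (U (r k)) < \<rho> \<and> norm (V (r k)) < \<rho> \<and> \<phi> (Z (r k)) < \<phi> (xb, 0) + ereal \<rho>"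
  proof (intro eventually_conj)
    have "(\<lambda>k. norm (X (r k) - x)) \<longlonglongrightarrow> norm (x - x)" by (intro tendsto_intros Xr[unfolded xh])
    then show "\<forall>\<^sub>F k in sequentially. norm (X (r k) - x) < h" by (rule order_tendstoD(2)) (simp add: h)
    have "(\<lambda>k. norm (U (r k) - u)) \<longlonglongrightarrow> norm (u - u)" by (intro tendsto_intros Ur)
    then show "\<forall>\<^sub>F k in sequentially. norm (U (r k) - u) < h" by (rule order_tendstoD(2)) (simp add: h)
    have "(\<lambda>k. norm (X (r k) - xb)) \<longlonglongrightarrow> norm (x - xb)" by (intro tendsto_intros Xr[unfolded xh])
    then show "\<forall>\<^sub>F k in sequentially. norm (X (r k) - xb) < \<rho>" by (rule order_tendstoD(2)) (rule near)
    show "\<forall>\<^sub>F k in sequentially. norm (U (r k)) < \<rho>" by (rule order_tendstoD(2)[OF tendsto_norm[OF Ur]]) (rule near)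
    show "\<forall>\<^sub>F k in sequentially. norm (V (r k)) < \<rho>" by (rule order_tendstoD(2)[OF tendsto_norm[OF Vr]]) (rule near)
    show "\<forall>\<^sub>F k in sequentially. \<phi> (Z (r k)) < \<phi> (xb, 0) + ereal \<rho>" by (rule order_tendstoD(2)[OF \<phi>r]) (rule near)
  qed
  then obtain N where N: "\<And>k. k \<ge> N \<Longrightarrow> norm (X (r k) - x) < h \<and> norm (U (r k) - u) < h \<and>
      norm (X (r k) - xb) < \<rho> \<and> norm (U (r k)) < \<rho> \<and> norm (V (r k)) < \<rho> \<and> \<phi> (Z (r k)) < \<phi> (xb, 0) + ereal \<rho>"
    unfolding eventually_sequentially by blast
  have reg': "(V (r k), Y (r k)) \<in> subgrad \<phi> (Z (r k))" if "k \<ge> N" for k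
    using reg[of "r k"] N[OF that] regular_subset_subgrad by blast
  have "Y (r (k + N)) \<in> cball 0 K" for k
    using N[of "k + N"] K[of "X (r (k + N))" "U (r (k + N))" "V (r (k + N))" "Y (r (k + N))"] reg'[of "k + N"]
    by (simp add: multiplier_near_def XU)
  then obtain y r' where y: "strict_mono r'" "((\<lambda>k. Y (r (k + N))) \<circ> r') \<longlonglongrightarrow> y"
    using compact_cball[of 0 K] unfolding compact_def by (metis (no_types, lifting))
  define q where "q k = r' k + N" for k
  have q: "strict_mono q" using y(1) by (simp add: q_def strict_mono_def)
  have "(v, y) \<in> subgrad \<phi> (x, u)"
  proof (rule subgrad_closed)
    show "(V (r (q k)), Y (r (q k))) \<in> subgrad \<phi> (Z (r (q k)))" for k
      by (rule reg') (simp add: q_def)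
    show "(\<lambda>k. Z (r (q k))) \<longlonglongrightarrow> (x, u)" using LIMSEQ_subseq_LIMSEQ[OF Zr q] by (simp add: o_def xh)
    show "(\<lambda>k. \<phi> (Z (r (q k)))) \<longlonglongrightarrow> \<phi> (x, u)" using LIMSEQ_subseq_LIMSEQ[OF \<phi>r q] by (simp add: o_def)
    have "(\<lambda>k. V (r (q k))) \<longlonglongrightarrow> v" using LIMSEQ_subseq_LIMSEQ[OF Vr q] by (simp add: o_def)
    moreover have "(\<lambda>k. Y (r (q k))) \<longlonglongrightarrow> y" using y(2) by (simp add: o_def q_def)
    ultimately show "(\<lambda>k. (V (r (q k)), Y (r (q k)))) \<longlonglongrightarrow> (v, y)" by (rule tendsto_Pair)
  qed (simp add: a)
  then show ?thesis by blast
qed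


subsection \<open>Localized solutions\<close>

text \<open>The set Y restricts only the multipliers: a ball around one yb carries the constants of
  that multiplier, and \<open>UNIV\<close> expresses that they serve all of them. A negative s is
  allowed.\<close>

definition local_growth ::
    "('a::euclidean_space \<times> 'b::euclidean_space \<Rightarrow> ereal) \<Rightarrow> 'a \<Rightarrow> 'b set \<Rightarrow> real \<Rightarrow> real \<Rightarrow> real \<Rightarrow> bool" where
  "local_growth \<phi> xb Y \<rho> s e \<longleftrightarrow> (\<forall>x u v y x' u'. multiplier_near \<phi> xb \<rho> x u v y \<and> y \<in> Y \<and>
     norm (x' - xb) < \<rho> \<and> norm u' < \<rho> \<longrightarrow>
     \<phi> (x, u) + ereal (v \<bullet> (x' - x) + y \<bullet> (u' - u) + s / 2 * (norm (x' - x))\<^sup>2 - e / 2 * (norm (u' - u))\<^sup>2)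
       \<le> \<phi> (x', u'))"

lemma local_growthD:
  assumes "local_growth \<phi> xb Y \<rho> s e" "multiplier_near \<phi> xb \<rho> x u v y" "y \<in> Y" "norm (x' - xb) < \<rho>" "norm u' < \<rho>"
  shows "\<phi> (x, u) + ereal (v \<bullet> (x' - x) + y \<bullet> (u' - u) + s / 2 * (norm (x' - x))\<^sup>2 - e / 2 * (norm (u' - u))\<^sup>2)
       \<le> \<phi> (x', u')"
  using assms unfolding local_growth_def by blast

lemma local_growth_mono:
  fixes \<phi> :: "'a::euclidean_space \<times> 'b::euclidean_space \<Rightarrow> ereal"
  assumes "local_growth \<phi> xb Y \<rho> s e" "Y' \<subseteq> Y" "\<rho>' \<le> \<rho>" "s' \<le> s" "e \<le> e'"
  shows "local_growth \<phi> xb Y' \<rho>' s' e'"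
  unfolding local_growth_def
proof (intro allI impI, elim conjE)
  fix x v x' :: 'a and u y u' :: 'b
  assume *: "multiplier_near \<phi> xb \<rho>' x u v y" "y \<in> Y'" "norm (x' - xb) < \<rho>'" "norm u' < \<rho>'"
  have "s' / 2 * (norm (x' - x))\<^sup>2 \<le> s / 2 * (norm (x' - x))\<^sup>2" "e / 2 * (norm (u' - u))\<^sup>2 \<le> e' / 2 * (norm (u' - u))\<^sup>2"
    using assms by (auto intro!: mult_right_mono)
  then have "\<phi> (x, u) + ereal (v \<bullet> (x' - x) + y \<bullet> (u' - u) + s' / 2 * (norm (x' - x))\<^sup>2 - e' / 2 * (norm (u' - u))\<^sup>2)
     \<le> \<phi> (x, u) + ereal (v \<bullet> (x' - x) + y \<bullet> (u' - u) + s / 2 * (norm (x' - x))\<^sup>2 - e / 2 * (norm (u' - u))\<^sup>2)"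
    by (intro add_left_mono) simp
  also have "\<dots> \<le> \<phi> (x', u')"
    using * assms by (intro local_growthD[OF assms(1)]) (auto intro: multiplier_near_mono)
  finally show "\<phi> (x, u) + ereal (v \<bullet> (x' - x) + y \<bullet> (u' - u) + s' / 2 * (norm (x' - x))\<^sup>2 - e' / 2 * (norm (u' - u))\<^sup>2)
     \<le> \<phi> (x', u')" .
qed

text \<open>The pairs (s k, e k) become weaker than each local pair from some k on, so that
  \<open>multiplier_uniform\<close> selects one k serving every multiplier, with radius 1 / (k +
  1).\<close>

lemma local_growth_uniform:
  assumes cl: "closed_fun \<phi>" and c: "\<phi> (xb, 0) = ereal c"
    and bcq: "\<forall>y. (0, y) \<in> horizon_subgrad \<phi> (xb, 0) \<longrightarrow> y = 0"
    and loc: "\<And>yb. (0, yb) \<in> subgrad \<phi> (xb, 0) \<Longrightarrow> \<exists>\<rho>>0. \<exists>s' e'. local_growth \<phi> xb (ball yb \<rho>) \<rho> s' e' \<and>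
      (\<forall>\<^sub>F k in sequentially. s k \<le> s' \<and> e' \<le> e k)"
  obtains k where "local_growth \<phi> xb UNIV (1 / real (Suc k)) (s k) (e k)"
proof -
  obtain \<rho>0 K where \<rho>0: "\<rho>0 > 0" "\<And>x u v y. multiplier_near \<phi> xb \<rho>0 x u v y \<Longrightarrow> norm y \<le> K"
    by (rule multiplier_near_bounded[OF cl c bcq]) blast
  define Q where "Q k x u v y \<longleftrightarrow> (\<forall>x' u'. norm (x' - xb) < 1 / real (Suc k) \<and> norm u' < 1 / real (Suc k) \<longrightarrow>
     \<phi> (x, u) + ereal (v \<bullet> (x' - x) + y \<bullet> (u' - u) + s k / 2 * (norm (x' - x))\<^sup>2 - e k / 2 * (norm (u' - u))\<^sup>2)
       \<le> \<phi> (x', u'))" for k x u v y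
  have "\<exists>k. \<forall>x u v y. multiplier_near \<phi> xb (1 / real (Suc k)) x u v y \<longrightarrow> Q k x u v y"
  proof (rule multiplier_uniform[OF cl c \<rho>0])
    fix yb assume "(0, yb) \<in> subgrad \<phi> (xb, 0)"
    then obtain \<rho> s' e' N where \<rho>: "\<rho> > 0" "local_growth \<phi> xb (ball yb \<rho>) \<rho> s' e'" "\<And>k. k \<ge> N \<Longrightarrow> s k \<le> s' \<and> e' \<le> e k"
      using loc unfolding eventually_sequentially by metis
    obtain N1 where N1: "1 / real (Suc N1) < \<rho>" using \<rho>(1) nat_approx_posE by metis
    show "\<exists>\<rho>>0. \<exists>N. \<forall>k\<ge>N. \<forall>x u v y. multiplier_near \<phi> xb \<rho> x u v y \<and> norm (y - yb) < \<rho> \<longrightarrow> Q k x u v y"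
    proof (intro exI[of _ \<rho>] conjI exI[of _ "max N N1"] allI impI \<rho>)
      fix k x u v y assume k: "max N N1 \<le> k" and near: "multiplier_near \<phi> xb \<rho> x u v y \<and> norm (y - yb) < \<rho>"
      have "1 / real (Suc k) \<le> 1 / real (Suc N1)" using k by (simp add: frac_le)
      with N1 have "1 / real (Suc k) < \<rho>" by simp
      moreover have "local_growth \<phi> xb (ball yb \<rho>) \<rho> (s k) (e k)"
        using \<rho>(3)[of k] k by (intro local_growth_mono[OF \<rho>(2)]) auto
      ultimately show "Q k x u v y" unfolding Q_def
        using near by (intro allI impI, elim conjE, intro local_growthD[of \<phi> xb "ball yb \<rho>" \<rho>]) (auto simp: dist_norm norm_minus_commute)
    qed
  qed
  then show thesis using that unfolding local_growth_def Q_def by blast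
qed

section \<open>Localized minimizers and the optimal value as functions of the tilt\<close>

abbreviation M_sol where "M_sol \<phi> xb \<delta> v u \<equiv> the_elem (M_loc \<phi> xb \<delta> v u)"

abbreviation m_val where "m_val \<phi> xb \<delta> v u \<equiv> real_of_ereal (m_loc \<phi> xb \<delta> v u)"

lemma M_loc_memD:
  assumes "x \<in> M_loc \<phi> xb \<delta> v u"
  shows "norm (x - xb) < \<delta>" "tilted \<phi> xb v u x = m_loc \<phi> xb \<delta> v u" "tilted \<phi> xb v u x < \<infinity>"
  using assms unfolding M_loc_def argmin_on_def m_loc_def by auto

lemma M_loc_singletonD:
  fixes \<phi> :: "(real^'n) \<times> (real^'m) \<Rightarrow> ereal"
  assumes pr: "proper_fun \<phi>" and M: "M_loc \<phi> xb \<delta> v u = {x}"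
  defines "m \<equiv> m_val \<phi> xb \<delta> v u"
  shows "norm (x - xb) < \<delta>" "m_loc \<phi> xb \<delta> v u = ereal m" "\<phi> (x, u) = ereal (m + v \<bullet> (x - xb))"
    "\<And>x'. norm (x' - xb) < \<delta> \<Longrightarrow> ereal (m + v \<bullet> (x' - xb)) \<le> \<phi> (x', u)"
proof -
  have x: "norm (x - xb) < \<delta>" "tilted \<phi> xb v u x = m_loc \<phi> xb \<delta> v u" "tilted \<phi> xb v u x < \<infinity>"
    using M_loc_memD[of x \<phi> xb \<delta> v u] M by auto
  then show "norm (x - xb) < \<delta>" by simp
  have "\<bar>tilted \<phi> xb v u x\<bar> \<noteq> \<infinity>"
    using x(3) proper_fun_def[of \<phi>] pr unfolding tilted_def by (cases "\<phi> (x, u)") auto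
  then show m: "m_loc \<phi> xb \<delta> v u = ereal m" unfolding m_def x(2) by (simp add: ereal_real)
  show "\<phi> (x, u) = ereal (m + v \<bullet> (x - xb))"
    using x(2) unfolding m tilted_def by (cases "\<phi> (x, u)") auto
  fix x' assume "norm (x' - xb) < \<delta>"
  then have "ereal m \<le> tilted \<phi> xb v u x'"
    unfolding m[symmetric] m_loc_def by (intro INF_lower) auto
  then show "ereal (m + v \<bullet> (x' - xb)) \<le> \<phi> (x', u)"
    unfolding tilted_def by (cases "\<phi> (x', u)") auto
qed

lemma M_loc_singletonI:
  assumes x: "norm (x - xb) < \<delta>" and a: "\<phi> (x, u) = ereal a"
    and min: "\<And>x'. norm (x' - xb) < \<delta> \<Longrightarrow> x' \<noteq> x \<Longrightarrow> ereal (a + v \<bullet> (x' - x)) < \<phi> (x', u)"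
  shows "M_loc \<phi> xb \<delta> v u = {x}"
proof -
  have t: "tilted \<phi> xb v u x = ereal (a - v \<bullet> (x - xb))" by (simp add: tilted_def a)
  have less: "tilted \<phi> xb v u x < tilted \<phi> xb v u x'" if "norm (x' - xb) < \<delta>" "x' \<noteq> x" for x'
  proof -
    have "v \<bullet> (x' - x) = v \<bullet> (x' - xb) - v \<bullet> (x - xb)" by (simp add: inner_diff_right)
    then show ?thesis using min[OF that] unfolding t unfolding tilted_def by (cases "\<phi> (x', u)") auto
  qed
  then have le: "tilted \<phi> xb v u x \<le> tilted \<phi> xb v u x'" if "norm (x' - xb) < \<delta>" for x'
    using that by (cases "x' = x") (auto intro: less_imp_le)
  have inf: "(INF z\<in>{x. norm (x - xb) < \<delta>}. tilted \<phi> xb v u z) = tilted \<phi> xb v u x"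
    by (rule antisym) (use x le in \<open>auto intro!: INF_lower INF_greatest\<close>)
  show ?thesis
    unfolding M_loc_def argmin_on_def inf using x less by (auto simp: t) (metis less_irrefl t)
qed

text \<open>Data obtained for one radius \<delta>1 carry over to each smaller \<delta> as long as
  the minimizer stays in the smaller ball.\<close>

lemma M_loc_shrink:
  assumes M: "M_loc \<phi> xb \<delta>1 v u = {x}" and x: "norm (x - xb) < \<delta>" and \<delta>: "\<delta> \<le> \<delta>1"
  shows "M_loc \<phi> xb \<delta> v u = {x}" "m_loc \<phi> xb \<delta> v u = m_loc \<phi> xb \<delta>1 v u"
proof -
  have x1: "tilted \<phi> xb v u x = m_loc \<phi> xb \<delta>1 v u" "tilted \<phi> xb v u x < \<infinity>"
    using M_loc_memD[of x \<phi> xb \<delta>1 v u] M by auto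
  have "m_loc \<phi> xb \<delta> v u \<le> tilted \<phi> xb v u x" unfolding m_loc_def by (rule INF_lower) (use x in auto)
  moreover have "m_loc \<phi> xb \<delta>1 v u \<le> m_loc \<phi> xb \<delta> v u"
    unfolding m_loc_def by (rule INF_superset_mono) (use \<delta> in auto)
  ultimately show eq: "m_loc \<phi> xb \<delta> v u = m_loc \<phi> xb \<delta>1 v u" using x1(1) by simp
  have "M_loc \<phi> xb \<delta> v u \<subseteq> M_loc \<phi> xb \<delta>1 v u"
    using eq \<delta> unfolding M_loc_def argmin_on_def m_loc_def by auto
  moreover have "x \<in> M_loc \<phi> xb \<delta> v u"
    using x x1 eq unfolding M_loc_def argmin_on_def m_loc_def by auto
  ultimately show "M_loc \<phi> xb \<delta> v u = {x}" unfolding M by blast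
qed

text \<open>As a function of v, \<open>m_val\<close> is an infimum of affine functions, and the
  minimizer x at v is still a competitor at v'. So xb - x is a supergradient at v.\<close>

lemma m_loc_supergradient:
  fixes \<phi> :: "(real^'n) \<times> (real^'m) \<Rightarrow> ereal"
  assumes pr: "proper_fun \<phi>" and "M_loc \<phi> xb \<delta> v u = {x}" "is_singleton (M_loc \<phi> xb \<delta> v' u)"
  shows "m_val \<phi> xb \<delta> v' u \<le> m_val \<phi> xb \<delta> v u - (v' - v) \<bullet> (x - xb)"
proof -
  from assms(3) obtain x' where x': "M_loc \<phi> xb \<delta> v' u = {x'}" by (auto simp: is_singleton_def)
  note 1 = M_loc_singletonD[OF pr assms(2)]
  note 2 = M_loc_singletonD[OF pr x']
  from 2(4)[OF 1(1)] show ?thesis unfolding 1(3) by (simp add: inner_diff_left)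
qed

lemma M_loc_the_elem:
  assumes "is_singleton (M_loc \<phi> xb \<delta> v u)"
  shows "M_loc \<phi> xb \<delta> v u = {M_sol \<phi> xb \<delta> v u}"
  using assms by (simp add: is_singleton_the_elem)

text \<open>The supergradient inequalities at v and at w enclose the linearization error between 0
  and (w - v) \<bullet> (M w - M v) up to sign; continuity of M makes that o(|w - v|).\<close>

lemma m_loc_gradient:
  fixes \<phi> :: "(real^'n) \<times> (real^'m) \<Rightarrow> ereal"
  assumes pr: "proper_fun \<phi>" and V: "open V" "v \<in> V"
    and sing: "\<And>v. v \<in> V \<Longrightarrow> is_singleton (M_loc \<phi> xb \<delta> v u)"
    and cont: "continuous_on V (\<lambda>v. M_sol \<phi> xb \<delta> v u)"
  shows "GDERIV (\<lambda>v'. m_val \<phi> xb \<delta> v' u) v :> (xb - M_sol \<phi> xb \<delta> v u)"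
  unfolding gderiv_def has_derivative_at_alt
proof (intro conjI allI impI)
  define M where "M v = M_sol \<phi> xb \<delta> v u" for v
  define m where "m v = m_val \<phi> xb \<delta> v u" for v
  show "bounded_linear (\<lambda>h. h \<bullet> (xb - M_sol \<phi> xb \<delta> v u))" by (rule bounded_linear_inner_left)
  fix e :: real assume "e > 0"
  obtain d1 where d1: "d1 > 0" "ball v d1 \<subseteq> V" using V open_contains_ball by metis
  obtain d2 where d2: "d2 > 0" "\<And>w. w \<in> V \<Longrightarrow> dist w v < d2 \<Longrightarrow> dist (M w) (M v) < e"
    using cont V(2) \<open>e > 0\<close> unfolding continuous_on_iff M_def by metis
  have "norm (m w - m v - (w - v) \<bullet> (xb - M v)) \<le> e * norm (w - v)" if "norm (w - v) < min d1 d2" for w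
  proof -
    have w: "w \<in> V" "dist w v < d2" using that d1(2) by (auto simp: dist_norm norm_minus_commute)
    have "m w \<le> m v - (w - v) \<bullet> (M v - xb)"
      unfolding m_def M_def by (rule m_loc_supergradient[OF pr M_loc_the_elem[OF sing[OF V(2)]] sing[OF w(1)]])
    moreover have "m v \<le> m w - (v - w) \<bullet> (M w - xb)"
      unfolding m_def M_def by (rule m_loc_supergradient[OF pr M_loc_the_elem[OF sing[OF w(1)]] sing[OF V(2)]])
    moreover have "(w - v) \<bullet> (M w - M v) \<le> norm (w - v) * norm (M w - M v)" by (rule norm_cauchy_schwarz)
    moreover have "norm (w - v) * norm (M w - M v) \<le> norm (w - v) * e"
      using d2(2)[OF w] by (intro mult_left_mono) (auto simp: dist_norm)
    ultimately show ?thesis by (simp add: inner_simps mult.commute abs_le_iff)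
  qed
  then show "\<exists>d>0. \<forall>w. norm (w - v) < d \<longrightarrow> norm (m_val \<phi> xb \<delta> w u - m_val \<phi> xb \<delta> v u
      - (w - v) \<bullet> (xb - M_sol \<phi> xb \<delta> v u)) \<le> e * norm (w - v)"
    using d1(1) d2(1) unfolding m_def M_def by (intro exI[of _ "min d1 d2"]) auto
qed

lemma continuous_near_0:
  fixes F :: "'a::real_normed_vector \<Rightarrow> 'b::real_normed_vector \<Rightarrow> 'c::metric_space"
  assumes "continuous_on (ball 0 \<tau> \<times> ball 0 \<tau>) (\<lambda>(v, u). F v u)" "\<tau> > 0" "\<kappa> > 0"
  obtains \<tau>' where "0 < \<tau>'" "\<tau>' \<le> \<tau>" "\<And>v u. norm v < \<tau>' \<Longrightarrow> norm u < \<tau>' \<Longrightarrow> dist (F v u) (F 0 0) < \<kappa>"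
proof -
  have "(0, 0) \<in> ball 0 \<tau> \<times> ball 0 \<tau>" using assms by auto
  then obtain d where d: "d > 0" "\<And>z. z \<in> ball 0 \<tau> \<times> ball 0 \<tau> \<Longrightarrow> dist z (0, 0) < d \<Longrightarrow>
      dist ((\<lambda>(v, u). F v u) z) ((\<lambda>(v, u). F v u) (0, 0)) < \<kappa>"
    using assms(1,3) unfolding continuous_on_iff by metis
  show thesis
  proof (rule that[of "min \<tau> (d / 2)"])
    fix v :: 'a and u :: 'b assume *: "norm v < min \<tau> (d / 2)" "norm u < min \<tau> (d / 2)"
    have "dist (v, u) (0, 0) < d" using norm_Pair_le[of v u] * by (simp add: dist_norm)
    then show "dist (F v u) (F 0 0) < \<kappa>" using d(2)[of "(v, u)"] * by auto
  qed (use assms d in auto)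
qed

text \<open>The equation
  \<open>v' + r M(v', u) = v + r x\<close> has a solution \<open>v'\<close> because it is the optimality condition of a
  strongly convex problem, and prox-regularity at \<open>x\<close> combined with optimality of
  \<open>M(v', u)\<close> then forces \<open>M(v', u) = x\<close> and \<open>v' = v\<close>.\<close>

lemma stationary_is_solution:
  fixes \<phi> :: "(real^'n) \<times> (real^'m) \<Rightarrow> ereal"
  assumes pr: "proper_fun \<phi>" and \<tau>1: "\<tau>1 > 0" and \<delta>: "\<delta> > 0"
    and sing: "\<And>v u. norm v < \<tau>1 \<Longrightarrow> norm u < \<tau>1 \<Longrightarrow> is_singleton (M_loc \<phi> xb \<delta> v u)"
    and cont0: "continuous_on (ball 0 \<tau>1 \<times> ball 0 \<tau>1) (\<lambda>(v, u). M_sol \<phi> xb \<delta> v u)"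
    and M0: "M_loc \<phi> xb \<delta> 0 0 = {xb}"
    and growth: "local_growth \<phi> xb UNIV \<rho> (- r) r" and r: "r > 0" and \<rho>: "\<rho> > 0"
  obtains \<sigma> where "\<sigma> > 0" "\<And>x u v y. multiplier_near \<phi> xb \<sigma> x u v y \<Longrightarrow> M_loc \<phi> xb \<delta> v u = {x}"
proof -
  define M where "M v u = M_sol \<phi> xb \<delta> v u" for v u
  note cont = cont0[folded M_def]
  have M00: "M 0 0 = xb" by (simp add: M_def M0)
  obtain \<tau>2 where \<tau>2: "0 < \<tau>2" "\<tau>2 \<le> \<tau>1" "\<And>v u. norm v < \<tau>2 \<Longrightarrow> norm u < \<tau>2 \<Longrightarrow> norm (M v u - xb) < \<rho>"
    using continuous_near_0[OF cont \<tau>1 \<rho>] unfolding M00 dist_norm by metis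
  \<comment> \<open>The factor 8 r yields |M(v, u) - x| < 2 \<kappa> = \<tau>2 / (4 r), exactly what
    keeps the minimizer of h below off the sphere of radius \<tau>2 / 2.\<close>
  define \<kappa> where "\<kappa> = \<tau>2 / (8 * r)"
  have \<kappa>: "\<kappa> > 0" using \<tau>2 r by (simp add: \<kappa>_def)
  obtain \<tau>3 where \<tau>3: "0 < \<tau>3" "\<tau>3 \<le> \<tau>1" "\<And>v u. norm v < \<tau>3 \<Longrightarrow> norm u < \<tau>3 \<Longrightarrow> norm (M v u - xb) < \<kappa>"
    using continuous_near_0[OF cont \<tau>1 \<kappa>] unfolding M00 dist_norm by metis
  define \<sigma> where "\<sigma> = Min {\<kappa>, \<delta>, \<rho>, \<tau>2 / 4, \<tau>3}"
  have \<sigma>: "\<sigma> > 0" "\<sigma> \<le> \<kappa>" "\<sigma> \<le> \<delta>" "\<sigma> \<le> \<rho>" "\<sigma> \<le> \<tau>2 / 4" "\<sigma> \<le> \<tau>3"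
    unfolding \<sigma>_def using \<kappa> \<delta> \<rho> \<tau>2 \<tau>3 by auto
  show thesis
  proof (rule that[OF \<sigma>(1)])
    fix x u v y assume near: "multiplier_near \<phi> xb \<sigma> x u v y"
    then have n: "norm (x - xb) < \<sigma>" "norm u < \<sigma>" "norm v < \<sigma>" and "(v, y) \<in> subgrad \<phi> (x, u)"
      unfolding multiplier_near_def by auto
    then obtain a where a: "\<phi> (x, u) = ereal a" unfolding subgrad_iff by blast
    have u2: "norm u < \<tau>2" "norm u < \<tau>1" using n(2) \<sigma>(5) \<tau>2 by auto
    have v2: "norm v' < \<tau>2" if "v' \<in> cball v (\<tau>2 / 2)" for v'
      using that n(3) \<sigma>(5) \<tau>2(1) norm_triangle_sub[of v' v] by (auto simp: dist_norm norm_minus_commute)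
    define m where "m v = m_val \<phi> xb \<delta> v u" for v
    define N where "N v = M v u" for v
    have single: "M_loc \<phi> xb \<delta> v' u = {N v'}" if "norm v' < \<tau>2" for v'
      unfolding N_def M_def by (rule M_loc_the_elem) (use sing that u2 \<tau>2 in auto)
    have contN: "continuous_on (ball 0 \<tau>2) N"
    proof -
      have "continuous_on (ball 0 \<tau>2) ((\<lambda>(v, u). M v u) \<circ> (\<lambda>v. (v, u)))"
        by (rule continuous_on_compose[OF _ continuous_on_subset[OF cont]])
          (use u2 \<tau>2 in \<open>auto intro!: continuous_intros\<close>)
      then show ?thesis by (simp add: o_def N_def)
    qed
    have grad: "(m has_derivative (\<lambda>k. k \<bullet> (xb - N w))) (at w)" if "norm w < \<tau>2" for w
      using m_loc_gradient[OF pr, where V="ball 0 \<tau>2" and v=w and xb=xb and \<delta>=\<delta> and u=u] single that contN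
      unfolding m_def N_def M_def gderiv_def by (auto simp: is_singleton_def)
    \<comment> \<open>The gradient of h is (w - v) / r + N w - x, so a critical point solves w + r N
      w = v + r x. As -m is convex, h is strongly convex.\<close>
    define h where "h w = 1 / (2 * r) * ((w - v) \<bullet> (w - v)) - m w - (w - v) \<bullet> (x - xb)" for w
    have hder: "(h has_derivative (\<lambda>k. k \<bullet> ((1 / r) *\<^sub>R (w - v) + N w - x))) (at w)" if "norm w < \<tau>2" for w
      unfolding h_def
      by (rule derivative_eq_intros grad[OF that] refl | simp)+
        (use r in \<open>auto simp: fun_eq_iff inner_simps inner_commute field_simps\<close>)
    have "continuous_on (cball v (\<tau>2 / 2)) h"
      using hder v2 by (intro continuous_at_imp_continuous_on ballI has_derivative_continuous) blast
    then obtain w where w: "w \<in> cball v (\<tau>2 / 2)" "\<And>w'. w' \<in> cball v (\<tau>2 / 2) \<Longrightarrow> h w \<le> h w'"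
      using continuous_attains_inf[OF compact_cball, of v "\<tau>2 / 2" h] \<tau>2(1) by force
    have v\<tau>: "norm v < \<tau>2" using v2[of v] \<tau>2(1) by auto
    have w\<tau>: "norm w < \<tau>2" using v2 w by auto
    have Nv: "norm (N v - x) < \<tau>2 / (4 * r)"
    proof -
      have "norm (N v - xb) < \<kappa>" unfolding N_def using \<tau>3 n \<sigma> by auto
      moreover have "norm (N v - x) \<le> norm (N v - xb) + norm (x - xb)"
        using norm_triangle_ineq4[of "N v - xb" "x - xb"] by simp
      ultimately have "norm (N v - x) < 2 * \<kappa>" using n(1) \<sigma>(2) by linarith
      then show ?thesis by (simp add: \<kappa>_def)
    qed
    \<comment> \<open>On the sphere the quadratic term of h equals (\<tau>2 / 2) (\<tau>2 / (4 r)).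
      By the supergradient inequality of m at v, the remaining terms fall below h v by strictly
      less, so h would be larger there than at v.\<close>
    have "w \<in> ball v (\<tau>2 / 2)"
    proof (rule ccontr)
      assume "w \<notin> ball v (\<tau>2 / 2)"
      then have d: "norm (w - v) = \<tau>2 / 2" using w(1) by (auto simp: dist_norm norm_minus_commute)
      have "is_singleton (M_loc \<phi> xb \<delta> w u)" using single[OF w\<tau>] by (simp add: is_singleton_def)
      from m_loc_supergradient[OF pr single[OF v\<tau>] this]
      have "m w \<le> m v - (w - v) \<bullet> (N v - xb)" by (simp add: m_def)
      moreover have "- ((w - v) \<bullet> (N v - x)) \<le> norm (w - v) * norm (N v - x)"
        using Cauchy_Schwarz_ineq2[of "w - v" "N v - x"] by linarith
      moreover have "norm (w - v) * norm (N v - x) < (\<tau>2 / 2) * (\<tau>2 / (4 * r))"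
        unfolding d using Nv \<tau>2(1) by (intro mult_strict_left_mono) auto
      moreover have "h w = 1 / (2 * r) * (\<tau>2 / 2)\<^sup>2 - m w - (w - v) \<bullet> (x - xb)"
        by (simp only: h_def power2_norm_eq_inner[symmetric] d)
      moreover have "1 / (2 * r) * (\<tau>2 / 2)\<^sup>2 = (\<tau>2 / 2) * (\<tau>2 / (4 * r))" by (simp add: power2_eq_square)
      moreover have "h v = - m v" by (simp add: h_def)
      moreover have "h w \<le> h v" using w(2) \<tau>2(1) by simp
      ultimately show False by (simp add: inner_diff_right)
    qed
    then have "(\<lambda>k. k \<bullet> ((1 / r) *\<^sub>R (w - v) + N w - x)) = (\<lambda>k. 0)"
      by (rule differential_zero_maxmin[OF _ open_ball hder[OF w\<tau>] disjI2]) (use w in auto)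
    then have "((1 / r) *\<^sub>R (w - v) + N w - x) \<bullet> ((1 / r) *\<^sub>R (w - v) + N w - x) = 0" by metis
    then have "(1 / r) *\<^sub>R (w - v) + N w - x = 0" by simp
    then have "(1 / r) *\<^sub>R (w - v) = x - N w" by (simp add: algebra_simps)
    then have "r *\<^sub>R ((1 / r) *\<^sub>R (w - v)) = r *\<^sub>R (x - N w)" by simp
    then have wv: "w = v + r *\<^sub>R (x - N w)" using r by (simp add: diff_eq_eq add.commute)
    \<comment> \<open>Prox-regularity at x, tested at N w, loses r/2 |N w - x|^2; optimality of N w
      for the tilt w, tested at x, involves w - v = r (x - N w) and gains r |N w - x|^2. The gain
      exceeds the loss unless N w = x.\<close>
    note sol = M_loc_singletonD[OF pr single[OF w\<tau>]]
    have "norm (N w - xb) < \<rho>" unfolding N_def using \<tau>2(3) w\<tau> u2 by auto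
    from local_growthD[OF growth multiplier_near_mono[OF near \<sigma>(4)] UNIV_I this, of u]
    have 1: "a + v \<bullet> (N w - x) - r / 2 * (norm (N w - x))\<^sup>2 \<le> m w + w \<bullet> (N w - xb)"
      using n(2) \<sigma>(4) unfolding sol(3) a by (simp add: m_def)
    have "norm (x - xb) < \<delta>" using n(1) \<sigma>(3) by simp
    from sol(4)[OF this] have 2: "m w + w \<bullet> (x - xb) \<le> a" by (simp add: a m_def)
    have "w \<bullet> (N w - x) = v \<bullet> (N w - x) + r *\<^sub>R (x - N w) \<bullet> (N w - x)"
      by (subst (1) wv) (simp add: inner_add_left)
    also have "r *\<^sub>R (x - N w) \<bullet> (N w - x) = - r * (norm (N w - x))\<^sup>2"
      by (simp add: power2_norm_eq_inner inner_simps algebra_simps)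
    finally have "r * (norm (N w - x))\<^sup>2 \<le> 0" using 1 2 by (simp add: inner_diff_right)
    then have "N w = x" using r by (simp add: mult_le_0_iff)
    moreover have "w = v" using wv \<open>N w = x\<close> by simp
    ultimately show "M_loc \<phi> xb \<delta> v u = {x}" using single[OF w\<tau>] by simp
  qed
qed


subsection \<open>Uniform growth in terms of prox-regularity and variational convexity\<close>

lemma prox_regular_imp_local_growth:
  fixes \<phi> :: "'a::euclidean_space \<times> 'b::euclidean_space \<Rightarrow> ereal"
  assumes c: "\<phi> (xb, 0) = ereal c" and prox: "prox_regular \<phi> (xb, 0) (0, yb)"
  shows "\<exists>\<rho>>0. \<exists>r. local_growth \<phi> xb (ball yb \<rho>) \<rho> (- r) r"
proof -
  from prox obtain X W \<alpha> r where h: "open X" "(xb, 0) \<in> X" "open W" "(0, yb) \<in> W" "\<phi> (xb, 0) < ereal \<alpha>"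
    and I: "\<forall>z'\<in>X. \<forall>(z, w) \<in> ({x \<in> X. \<phi> x < ereal \<alpha>} \<times> W) \<inter> gph (subgrad \<phi>).
           \<phi> z' \<ge> \<phi> z + ereal (w \<bullet> (z' - z) - r / 2 * (norm (z' - z))\<^sup>2)"
    unfolding prox_regular_def by blast
  have ineq: "\<phi> z + ereal (w \<bullet> (z' - z) - r / 2 * (norm (z' - z))\<^sup>2) \<le> \<phi> z'"
    if "z' \<in> X" "z \<in> X" "\<phi> z < ereal \<alpha>" "w \<in> W" "w \<in> subgrad \<phi> z" for z z' w
  proof -
    have "(z, w) \<in> ({x \<in> X. \<phi> x < ereal \<alpha>} \<times> W) \<inter> gph (subgrad \<phi>)" using that by (simp add: gph_def)
    from bspec[OF bspec[OF I that(1)] this] show ?thesis by simp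
  qed
  obtain r1 where r1: "r1 > 0" "ball (xb, 0) r1 \<subseteq> X" using h(1,2) open_contains_ball by metis
  obtain r2 where r2: "r2 > 0" "ball (0, yb) r2 \<subseteq> W" using h(3,4) open_contains_ball by metis
  \<comment> \<open>Halved radii, as the norm of a pair is estimated by the sum of the norms;
    \<alpha> - c keeps the values below \<alpha>.\<close>
  define \<rho> where "\<rho> = Min {r1 / 2, r2 / 2, \<alpha> - c}"
  have \<rho>: "\<rho> > 0" "\<rho> \<le> r1 / 2" "\<rho> \<le> r2 / 2" "\<rho> \<le> \<alpha> - c"
    unfolding \<rho>_def using r1(1) r2(1) h(5) by (simp_all only: Min_gr_iff Min_le finite.intros insertI1 insertI2 insert_not_empty) (auto simp: c)
  have inX: "(x, u) \<in> X" if "norm (x - xb) < \<rho>" "norm u < \<rho>" for x u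
  proof -
    have "dist (x, u) (xb, 0) < r1" using norm_Pair_le[of "x - xb" u] that \<rho>(2) by (simp add: dist_norm)
    then show ?thesis using r1(2) by (auto simp: dist_commute)
  qed
  have inW: "(v, y) \<in> W" if "norm v < \<rho>" "y \<in> ball yb \<rho>" for v y
  proof -
    have "norm (y - yb) < \<rho>" using that(2) by (simp add: dist_norm norm_minus_commute)
    then have "dist (v, y) (0, yb) < r2" using norm_Pair_le[of v "y - yb"] that(1) \<rho>(3) by (simp add: dist_norm)
    then show ?thesis using r2(2) by (auto simp: dist_commute)
  qed
  have "local_growth \<phi> xb (ball yb \<rho>) \<rho> (- r) r"
    unfolding local_growth_def
  proof (intro allI impI, elim conjE)
    fix x v x' :: 'a and u y u' :: 'b
    assume near: "multiplier_near \<phi> xb \<rho> x u v y" and y: "y \<in> ball yb \<rho>" and n: "norm (x' - xb) < \<rho>" "norm u' < \<rho>"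
    have "\<phi> (x, u) < ereal (c + \<rho>)" using near by (simp add: multiplier_near_def c)
    also have "\<dots> \<le> ereal \<alpha>" using \<rho>(4) by simp
    finally have "\<phi> (x, u) < ereal \<alpha>" .
    then have "\<phi> (x, u) + ereal ((v, y) \<bullet> ((x', u') - (x, u)) - r / 2 * (norm ((x', u') - (x, u)))\<^sup>2) \<le> \<phi> (x', u')"
      using near y n by (intro ineq inX inW) (auto simp: multiplier_near_def)
    then show "\<phi> (x, u) + ereal (v \<bullet> (x' - x) + y \<bullet> (u' - u) + - r / 2 * (norm (x' - x))\<^sup>2
        - r / 2 * (norm (u' - u))\<^sup>2) \<le> \<phi> (x', u')"
      by (simp add: norm_Pair algebra_simps add_divide_distrib)
  qed
  then show ?thesis using \<rho>(1) by blast
qed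

lemma local_growth_imp_prox_regular:
  fixes \<phi> :: "'a::euclidean_space \<times> 'b::euclidean_space \<Rightarrow> ereal"
  assumes c: "\<phi> (xb, 0) = ereal c" and growth: "local_growth \<phi> xb UNIV \<rho> s e" and \<rho>: "\<rho> > 0"
    and s: "s > 0" and e: "e \<ge> 0" and yb: "(0, yb) \<in> subgrad \<phi> (xb, 0)"
  shows "prox_regular \<phi> (xb, 0) (0, yb)"
  unfolding prox_regular_def
proof (intro conjI yb, rule exI[of _ "ball (xb, 0) \<rho>"], rule exI[of _ "ball (0, yb) \<rho>"], rule exI[of _ "c + \<rho>"],
    rule exI[of _ e], intro conjI ballI)
  show "\<phi> (xb, 0) < ereal (c + \<rho>)" by (simp add: c \<rho>)
  fix z' :: "'a \<times> 'b" and q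
  assume z': "z' \<in> ball (xb, 0) \<rho>" and q: "q \<in> {x \<in> ball (xb, 0) \<rho>. \<phi> x < ereal (c + \<rho>)} \<times> ball (0, yb) \<rho> \<inter> gph (subgrad \<phi>)"
  obtain x u v y where qq: "q = ((x, u), (v, y))" by (metis surj_pair)
  obtain x' u' where zz: "z' = (x', u')" by (metis surj_pair)
  have mem: "norm (x - xb) < \<rho>" "norm u < \<rho>" if "(x, u) \<in> ball (xb, 0) \<rho>" for x and u :: 'b
    using that dist_fst_le[of "(xb, 0)" "(x, u)"] dist_snd_le[of "(xb, 0)" "(x, u)"]
    by (auto simp: dist_norm norm_minus_commute)
  have "norm v < \<rho>" using q dist_fst_le[of "(0, yb)" "(v, y)"] by (auto simp: qq)
  then have near: "multiplier_near \<phi> xb \<rho> x u v y"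
    using q mem[of x u] unfolding multiplier_near_def by (auto simp: qq c gph_def)
  \<comment> \<open>Giving up the growth in x makes both coefficients equal to -e, so the two
    squares merge into the squared norm of the pair.\<close>
  have "local_growth \<phi> xb UNIV \<rho> (- e) e" by (rule local_growth_mono[OF growth]) (use s e in auto)
  from local_growthD[OF this near UNIV_I mem[OF z'[unfolded zz]]]
  have "\<phi> (x, u) + ereal ((v, y) \<bullet> ((x', u') - (x, u)) - e / 2 * (norm ((x', u') - (x, u)))\<^sup>2) \<le> \<phi> (x', u')"
    by (simp add: norm_Pair algebra_simps add_divide_distrib)
  then show "case q of (z, w) \<Rightarrow> \<phi> z + ereal (w \<bullet> (z' - z) - e / 2 * (norm (z' - z))\<^sup>2) \<le> \<phi> z'"
    by (simp add: qq zz)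
qed (use \<rho> in auto)

text \<open>The sum rule gives one inclusion; applied with -e to the perturbed function it gives the
  other.\<close>

lemma subgrad_add_quadratic:
  fixes \<phi> :: "'a::euclidean_space \<times> 'b::euclidean_space \<Rightarrow> ereal"
  defines "\<psi> \<equiv> \<lambda>e. \<lambda>(x, u). \<phi> (x, u) + ereal (e / 2 * (norm u)\<^sup>2)"
  shows "(v, y) \<in> subgrad \<phi> (x, u) \<longleftrightarrow> (v, y + e *\<^sub>R u) \<in> subgrad (\<psi> e) (x, u)"
proof -
  define D :: "real \<Rightarrow> 'a \<times> 'b \<Rightarrow> 'a \<times> 'b" where "D e z = (0, e *\<^sub>R snd z)" for e z
  define q where "q e z = e / 2 * (norm (snd z :: 'b))\<^sup>2" for e :: real and z :: "'a \<times> 'b"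
  have der: "(q e has_derivative (\<lambda>h. D e z \<bullet> h)) (at z)" for e z
    unfolding q_def D_def power2_norm_eq_inner
    by (auto intro!: derivative_eq_intros simp: inner_prod_def inner_commute)
  have cont: "continuous_on UNIV (D e)" for e unfolding D_def by (intro continuous_intros)
  have add: "w + D e z \<in> subgrad (\<lambda>z. f z + ereal (q e z)) z" if "w \<in> subgrad f z" for w e z f
    by (rule subgrad_add_smooth[OF that der cont])
  have \<psi>: "\<psi> e = (\<lambda>z. \<phi> z + ereal (q e z))" by (auto simp: \<psi>_def q_def)
  have "\<phi> z + ereal (q e z) + ereal (q (- e) z) = \<phi> z" for z by (cases "\<phi> z") (auto simp: q_def)
  then have \<phi>: "\<phi> = (\<lambda>z. \<psi> e z + ereal (q (- e) z))" unfolding \<psi> by simp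
  show ?thesis
  proof
    assume "(v, y) \<in> subgrad \<phi> (x, u)"
    from add[OF this, of e] show "(v, y + e *\<^sub>R u) \<in> subgrad (\<psi> e) (x, u)" by (simp add: D_def \<psi>)
  next
    assume "(v, y + e *\<^sub>R u) \<in> subgrad (\<psi> e) (x, u)"
    from add[OF this, of "- e"] show "(v, y) \<in> subgrad \<phi> (x, u)"
      unfolding \<phi>[symmetric] by (simp add: D_def)
  qed
qed

text \<open>The linearization error of e/2 |u|^2 is exactly e/2 |u' - u|^2. Moving the quadratic
  back to the right-hand side therefore costs the term with e in the growth inequality, and the
  surplus growth in u is given up.\<close>

lemma variationally_convex_imp_local_growth:
  fixes \<phi> :: "'a::euclidean_space \<times> 'b::euclidean_space \<Rightarrow> ereal"
  assumes c: "\<phi> (xb, 0) = ereal c" and e: "e \<ge> 0" and s: "s > 0"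
    and vc: "variationally_convex s (\<lambda>(x, u). \<phi> (x, u) + ereal (e / 2 * (norm u)\<^sup>2)) (xb, 0) (0, yb)"
  shows "\<exists>\<rho>>0. local_growth \<phi> xb (ball yb \<rho>) \<rho> s e"
proof -
  define \<psi> where "\<psi> = (\<lambda>(x, u). \<phi> (x, u) + ereal (e / 2 * (norm u)\<^sup>2))"
  obtain r \<alpha> where r: "r > 0" "\<psi> (xb, 0) < ereal \<alpha>" and
    ineq: "\<And>z w z'. \<lbrakk>z \<in> ball (xb, 0) r; \<psi> z < ereal \<alpha>; w \<in> ball (0, yb) r; w \<in> subgrad \<psi> z; z' \<in> ball (xb, 0) r\<rbrakk>
      \<Longrightarrow> \<psi> z + ereal (w \<bullet> (z' - z) + s / 2 * (norm (z' - z))\<^sup>2) \<le> \<psi> z'"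
    using variationally_convexD[OF vc[folded \<psi>_def]] by metis
  have c\<alpha>: "c < \<alpha>" using r(2) by (simp add: \<psi>_def c)
  \<comment> \<open>The added quadratic shifts the multiplier by e u, so the subgradient lies within
    (2 + e) \<rho> of (0, yb), and it raises the value by at most e \<rho> because |u|^2 \<le>
    \<rho> for \<rho> \<le> 1.\<close>
  define \<rho> where "\<rho> = Min {1, r / 2, r / (2 + e), (\<alpha> - c) / (1 + e)}"
  have \<rho>: "\<rho> > 0" "\<rho> \<le> 1" "\<rho> \<le> r / 2" "\<rho> \<le> r / (2 + e)" "\<rho> \<le> (\<alpha> - c) / (1 + e)"
    unfolding \<rho>_def using r(1) e c\<alpha>
    by (simp_all only: Min_gr_iff Min_le finite.intros insertI1 insertI2 insert_not_empty) auto
  have \<rho>r: "(2 + e) * \<rho> \<le> r" "(1 + e) * \<rho> \<le> \<alpha> - c"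
    using \<rho>(4,5) e by (auto simp: pos_le_divide_eq mult.commute)
  have inX: "(x, u) \<in> ball (xb, 0) r" if "norm (x - xb) < \<rho>" "norm u < \<rho>" for x u
  proof -
    have "dist (x, u) (xb, 0) < r" using norm_Pair_le[of "x - xb" u] that \<rho>(3) by (simp add: dist_norm)
    then show ?thesis by (simp add: dist_commute)
  qed
  have "local_growth \<phi> xb (ball yb \<rho>) \<rho> s e"
    unfolding local_growth_def
  proof (intro allI impI, elim conjE)
    fix x v x' :: 'a and u y u' :: 'b
    assume near: "multiplier_near \<phi> xb \<rho> x u v y" and y: "y \<in> ball yb \<rho>" and n: "norm (x' - xb) < \<rho>" "norm u' < \<rho>"
    have nn: "norm (x - xb) < \<rho>" "norm u < \<rho>" "norm v < \<rho>" "\<phi> (x, u) < ereal (c + \<rho>)" "(v, y) \<in> subgrad \<phi> (x, u)"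
      using near by (auto simp: multiplier_near_def c)
    obtain a where a: "\<phi> (x, u) = ereal a" using nn(5) unfolding subgrad_iff by blast
    have "(norm u)\<^sup>2 \<le> \<rho>"
      using nn(2) \<rho>(2) by (metis less_imp_le mult_left_le norm_ge_zero order_trans power2_eq_square)
    then have "e / 2 * (norm u)\<^sup>2 \<le> e / 2 * \<rho>" using e by (intro mult_left_mono) auto
    also have "\<dots> \<le> e * \<rho>" using e \<rho>(1) by simp
    finally have "a + e / 2 * (norm u)\<^sup>2 < \<alpha>" using nn(4) \<rho>r(2) by (simp add: a algebra_simps)
    then have 1: "\<psi> (x, u) < ereal \<alpha>" by (simp add: \<psi>_def a)
    have "norm (v, y + e *\<^sub>R u - yb) \<le> norm v + norm (y + e *\<^sub>R u - yb)" by (rule norm_Pair_le)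
    moreover have "norm (y + e *\<^sub>R u - yb) \<le> norm (y - yb) + norm (e *\<^sub>R u)"
      using norm_triangle_ineq[of "y - yb" "e *\<^sub>R u"] by (simp add: algebra_simps)
    moreover have "norm (e *\<^sub>R u) \<le> e * \<rho>" using e nn(2) by (auto intro!: mult_left_mono)
    moreover have "norm (y - yb) < \<rho>" using y by (simp add: dist_norm norm_minus_commute)
    ultimately have "dist (v, y + e *\<^sub>R u) (0, yb) < (2 + e) * \<rho>"
      using nn(3) by (simp add: dist_norm algebra_simps)
    then have 2: "(v, y + e *\<^sub>R u) \<in> ball (0, yb) r" using \<rho>r(1) by (simp add: dist_commute)
    have 3: "(v, y + e *\<^sub>R u) \<in> subgrad \<psi> (x, u)"
      using nn(5) subgrad_add_quadratic[of v y \<phi> x u e] by (simp add: \<psi>_def)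
    have *: "\<psi> (x, u) + ereal ((v, y + e *\<^sub>R u) \<bullet> ((x', u') - (x, u)) + s / 2 * (norm ((x', u') - (x, u)))\<^sup>2) \<le> \<psi> (x', u')"
      by (rule ineq[OF inX[OF nn(1,2)] 1 2 3 inX[OF n]])
    have N: "(norm ((x', u') - (x, u)))\<^sup>2 = (norm (x' - x))\<^sup>2 + (norm (u' - u))\<^sup>2" by (simp add: norm_Pair)
    have J: "e / 2 * (norm u)\<^sup>2 + e *\<^sub>R u \<bullet> (u' - u) - e / 2 * (norm u')\<^sup>2 = - (e / 2 * (norm (u' - u))\<^sup>2)"
      by (simp add: power2_norm_eq_inner inner_simps inner_commute algebra_simps)
    have s0: "s / 2 * (norm (u' - u))\<^sup>2 \<ge> 0" using s by simp
    have S: "s / 2 * ((norm (x' - x))\<^sup>2 + (norm (u' - u))\<^sup>2) = s / 2 * (norm (x' - x))\<^sup>2 + s / 2 * (norm (u' - u))\<^sup>2"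
      by (rule distrib_left)
    have I: "(v, y + e *\<^sub>R u) \<bullet> ((x', u') - (x, u)) = v \<bullet> (x' - x) + y \<bullet> (u' - u) + e *\<^sub>R u \<bullet> (u' - u)"
      by (simp add: inner_add_left)
    have **: "ereal (a + e / 2 * (norm u)\<^sup>2 + (v \<bullet> (x' - x) + y \<bullet> (u' - u) + e *\<^sub>R u \<bullet> (u' - u)
        + (s / 2 * (norm (x' - x))\<^sup>2 + s / 2 * (norm (u' - u))\<^sup>2))) \<le> \<phi> (x', u') + ereal (e / 2 * (norm u')\<^sup>2)"
      using * unfolding N S I unfolding \<psi>_def prod.case a plus_ereal.simps .
    show "\<phi> (x, u) + ereal (v \<bullet> (x' - x) + y \<bullet> (u' - u) + s / 2 * (norm (x' - x))\<^sup>2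
        - e / 2 * (norm (u' - u))\<^sup>2) \<le> \<phi> (x', u')"
    proof (cases "\<phi> (x', u')")
      case (real b)
      from ** J s0 show ?thesis unfolding real a plus_ereal.simps ereal_less_eq by linarith
    qed (use ** in auto)
  qed
  then show ?thesis using \<rho>(1) by blast
qed

text \<open>Why e + s instead of e: the part e cancels the loss - e/2 |u' - u|^2, and the part s
  supplies in u the same growth as in x, so that together they are s/2 times the squared norm of the
  pair.\<close>

lemma local_growth_imp_variationally_convex:
  fixes \<phi> :: "'a::euclidean_space \<times> 'b::euclidean_space \<Rightarrow> ereal"
  assumes cl: "closed_fun \<phi>" and c: "\<phi> (xb, 0) = ereal c" and growth: "local_growth \<phi> xb UNIV \<rho> s e" and \<rho>: "\<rho> > 0"
    and s: "s > 0" and e: "e \<ge> 0" and yb: "(0, yb) \<in> subgrad \<phi> (xb, 0)"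
  shows "variationally_convex s (\<lambda>(x, u). \<phi> (x, u) + ereal ((e + s) / 2 * (norm u)\<^sup>2)) (xb, 0) (0, yb)"
proof (rule variationally_convexI[OF _ _ s \<rho>, where \<alpha>="c + \<rho>"])
  define \<psi> where "\<psi> = (\<lambda>(x, u). \<phi> (x, u) + ereal ((e + s) / 2 * (norm u)\<^sup>2))"
  have "closed_fun (\<lambda>z. \<phi> z + ereal ((e + s) / 2 * (norm (snd z))\<^sup>2))"
    by (intro closed_fun_add_continuous cl continuous_intros)
  then show "closed_fun (\<lambda>(x, u). \<phi> (x, u) + ereal ((e + s) / 2 * (norm u)\<^sup>2))" by (simp add: case_prod_unfold)
  show "(0, yb) \<in> subgrad (\<lambda>(x, u). \<phi> (x, u) + ereal ((e + s) / 2 * (norm u)\<^sup>2)) (xb, 0)"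
    using yb subgrad_add_quadratic[of 0 yb \<phi> xb 0 "e + s"] by simp
  show "(case (xb, 0) of (x, u) \<Rightarrow> \<phi> (x, u) + ereal ((e + s) / 2 * (norm u)\<^sup>2)) < ereal (c + \<rho>)"
    by (simp add: c \<rho>)
  fix z w z' :: "'a \<times> 'b"
  assume A: "z \<in> ball (xb, 0) \<rho>" "(case z of (x, u) \<Rightarrow> \<phi> (x, u) + ereal ((e + s) / 2 * (norm u)\<^sup>2)) < ereal (c + \<rho>)"
    "w \<in> ball (0, yb) \<rho>" "w \<in> subgrad (\<lambda>(x, u). \<phi> (x, u) + ereal ((e + s) / 2 * (norm u)\<^sup>2)) z" "z' \<in> ball (xb, 0) \<rho>"
  obtain x u v y' where zw: "z = (x, u)" "w = (v, y')" by (metis surj_pair)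
  obtain x' u' where zz: "z' = (x', u')" by (metis surj_pair)
  define y where "y = y' - (e + s) *\<^sub>R u"
  have w: "w = (v, y + (e + s) *\<^sub>R u)" by (simp add: zw y_def)
  have mem: "norm (x - xb) < \<rho>" "norm u < \<rho>" if "(x, u) \<in> ball (xb, 0) \<rho>" for x and u :: 'b
    using that dist_fst_le[of "(xb, 0)" "(x, u)"] dist_snd_le[of "(xb, 0)" "(x, u)"]
    by (auto simp: dist_norm norm_minus_commute)
  have nv: "norm v < \<rho>" using A(3) dist_fst_le[of "(0, yb)" "(v, y')"] by (auto simp: zw)
  have sub: "(v, y) \<in> subgrad \<phi> (x, u)"
    using A(4) subgrad_add_quadratic[of v y \<phi> x u "e + s"] by (simp add: w zw(1))
  then obtain a where a: "\<phi> (x, u) = ereal a" unfolding subgrad_iff by blast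
  have "0 \<le> (e + s) / 2 * (norm u)\<^sup>2" using s e by simp
  then have "a < c + \<rho>" using A(2) by (simp add: zw(1) a)
  then have near: "multiplier_near \<phi> xb \<rho> x u v y"
    using sub nv mem[of x u] A(1) unfolding multiplier_near_def by (simp add: a c zw(1))
  from local_growthD[OF growth near UNIV_I mem[OF A(5)[unfolded zz]]]
  have *: "ereal (a + (v \<bullet> (x' - x) + y \<bullet> (u' - u) + s / 2 * (norm (x' - x))\<^sup>2 - e / 2 * (norm (u' - u))\<^sup>2)) \<le> \<phi> (x', u')"
    by (simp add: a)
  have N: "(norm ((x', u') - (x, u)))\<^sup>2 = (norm (x' - x))\<^sup>2 + (norm (u' - u))\<^sup>2" by (simp add: norm_Pair)
  define E where "E = e + s"
  have "E / 2 * (norm u)\<^sup>2 + E *\<^sub>R u \<bullet> (u' - u) - E / 2 * (norm u')\<^sup>2 = - (E / 2 * (norm (u' - u))\<^sup>2)"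
    by (simp add: power2_norm_eq_inner inner_simps inner_commute algebra_simps)
  moreover have "E / 2 * (norm (u' - u))\<^sup>2 = e / 2 * (norm (u' - u))\<^sup>2 + s / 2 * (norm (u' - u))\<^sup>2"
    by (simp add: E_def field_simps)
  moreover have S: "s / 2 * ((norm (x' - x))\<^sup>2 + (norm (u' - u))\<^sup>2) = s / 2 * (norm (x' - x))\<^sup>2 + s / 2 * (norm (u' - u))\<^sup>2"
    by (rule distrib_left)
  moreover have I: "(v, y + E *\<^sub>R u) \<bullet> ((x', u') - (x, u)) = v \<bullet> (x' - x) + y \<bullet> (u' - u) + E *\<^sub>R u \<bullet> (u' - u)"
    by (simp add: inner_add_left)
  ultimately have le: "a + E / 2 * (norm u)\<^sup>2 + ((v, y + E *\<^sub>R u) \<bullet> ((x', u') - (x, u))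
      + s / 2 * ((norm (x' - x))\<^sup>2 + (norm (u' - u))\<^sup>2)) = a + (v \<bullet> (x' - x) + y \<bullet> (u' - u) + s / 2 * (norm (x' - x))\<^sup>2
      - e / 2 * (norm (u' - u))\<^sup>2) + E / 2 * (norm u')\<^sup>2"
    by linarith
  have "\<phi> (x, u) + ereal (E / 2 * (norm u)\<^sup>2) + ereal ((v, y + E *\<^sub>R u) \<bullet> ((x', u') - (x, u))
      + s / 2 * (norm ((x', u') - (x, u)))\<^sup>2) \<le> \<phi> (x', u') + ereal (E / 2 * (norm u')\<^sup>2)"
    unfolding N a plus_ereal.simps le unfolding plus_ereal.simps(1)[symmetric]
    by (rule add_right_mono) (use * in simp)
  then show "(case z of (x, u) \<Rightarrow> \<phi> (x, u) + ereal ((e + s) / 2 * (norm u)\<^sup>2)) +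
      ereal (w \<bullet> (z' - z) + s / 2 * (norm (z' - z))\<^sup>2) \<le> (case z' of (x, u) \<Rightarrow> \<phi> (x, u) + ereal ((e + s) / 2 * (norm u)\<^sup>2))"
    by (simp add: zz zw(1) w E_def)
qed


section \<open>Growth constants uniform over all multipliers\<close>

lemma prox_regular_imp_uniform_growth:
  fixes \<phi> :: "(real^'n) \<times> (real^'m) \<Rightarrow> ereal"
  assumes cl: "closed_fun \<phi>" and c: "\<phi> (xb, 0) = ereal c"
    and bcq: "\<forall>y. (0, y) \<in> horizon_subgrad \<phi> (xb, 0) \<longrightarrow> y = 0"
    and prox: "full_multiplier_prox_regularity \<phi> xb"
  obtains \<rho> r where "\<rho> > 0" "r > 0" "local_growth \<phi> xb UNIV \<rho> (- r) r"
proof -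
  have "\<exists>\<rho>>0. \<exists>s' e'. local_growth \<phi> xb (ball yb \<rho>) \<rho> s' e' \<and>
      (\<forall>\<^sub>F k in sequentially. - real (Suc k) \<le> s' \<and> e' \<le> real (Suc k))" if yb: "(0, yb) \<in> subgrad \<phi> (xb, 0)" for yb
  proof -
    have "prox_regular \<phi> (xb, 0) (0, yb)"
      using prox yb by (simp add: full_multiplier_prox_regularity_def Y_mult_def)
    then obtain \<rho> r where \<rho>: "\<rho> > 0" "local_growth \<phi> xb (ball yb \<rho>) \<rho> (- r) r"
      using prox_regular_imp_local_growth[where \<phi>=\<phi> and xb=xb, OF c] by blast
    obtain N where "r \<le> real N" using real_arch_simple by blast
    then have "\<forall>\<^sub>F k in sequentially. - real (Suc k) \<le> - r \<and> r \<le> real (Suc k)"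
      unfolding eventually_sequentially by (intro exI[of _ N]) auto
    with \<rho> show ?thesis by blast
  qed
  then obtain k where "local_growth \<phi> xb UNIV (1 / real (Suc k)) (- real (Suc k)) (real (Suc k))"
    by (rule local_growth_uniform[OF cl c bcq])
  then show thesis by (rule that[rotated 2]) auto
qed

text \<open>The moduli 1 / (k + 1) eventually drop below every local modulus but remain positive, so
  strong convexity survives the passage to uniform constants even without a common lower bound
  assumed in advance.\<close>

lemma variational_sufficiency_imp_uniform_growth:
  fixes \<phi> :: "(real^'n) \<times> (real^'m) \<Rightarrow> ereal"
  assumes cl: "closed_fun \<phi>" and c: "\<phi> (xb, 0) = ereal c"
    and bcq: "\<forall>y. (0, y) \<in> horizon_subgrad \<phi> (xb, 0) \<longrightarrow> y = 0"
    and suff: "strong_variational_sufficiency \<phi> xb"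
  obtains \<rho> s e where "\<rho> > 0" "s > 0" "e \<ge> 0" "local_growth \<phi> xb UNIV \<rho> s e"
proof -
  have "\<exists>\<rho>>0. \<exists>s' e'. local_growth \<phi> xb (ball yb \<rho>) \<rho> s' e' \<and>
      (\<forall>\<^sub>F k in sequentially. 1 / real (Suc k) \<le> s' \<and> e' \<le> real (Suc k))" if yb: "(0, yb) \<in> subgrad \<phi> (xb, 0)" for yb
  proof -
    obtain e s where es: "e \<ge> 0" "s > 0"
      "variationally_convex s (\<lambda>(x, u). \<phi> (x, u) + ereal (e / 2 * (norm u)\<^sup>2)) (xb, 0) (0, yb)"
      using suff yb unfolding strong_variational_sufficiency_def Y_mult_def variationally_strongly_convex_def by blast
    then obtain \<rho> where \<rho>: "\<rho> > 0" "local_growth \<phi> xb (ball yb \<rho>) \<rho> s e"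
      using variationally_convex_imp_local_growth[where \<phi>=\<phi> and xb=xb, OF c] by blast
    obtain N where N: "e \<le> real N" using real_arch_simple by blast
    obtain N' where N': "1 / real (Suc N') < s" using es(2) nat_approx_posE by metis
    have "1 / real (Suc k) \<le> s \<and> e \<le> real (Suc k)" if "k \<ge> max N N'" for k
    proof -
      have "1 / real (Suc k) \<le> 1 / real (Suc N')" using that by (simp add: frac_le)
      then show ?thesis using N N' that by (auto simp del: of_nat_Suc)
    qed
    then have "\<forall>\<^sub>F k in sequentially. 1 / real (Suc k) \<le> s \<and> e \<le> real (Suc k)"
      unfolding eventually_sequentially by blast
    with \<rho> show ?thesis by blast
  qed
  then obtain k where "local_growth \<phi> xb UNIV (1 / real (Suc k)) (1 / real (Suc k)) (real (Suc k))"
    by (rule local_growth_uniform[OF cl c bcq])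
  then show thesis by (rule that[rotated 3]) auto
qed

lemma m_loc_0_eq:
  fixes \<phi> :: "(real^'n) \<times> (real^'m) \<Rightarrow> ereal"
  assumes "proper_fun \<phi>" "M_loc \<phi> xb \<delta> 0 0 = {xb}"
  shows "m_loc \<phi> xb \<delta> 0 0 = \<phi> (xb, 0)"
  using M_loc_singletonD[OF assms] by simp

text \<open>A minimizer inside the open \<delta>-ball is a local minimizer and so has a multiplier;
  continuity of M and m puts it in the ball and its value below \<alpha>. Conversely, stationary
  points satisfying both bounds are minimizers by \<open>stationary_is_solution\<close>. All data
  come from one radius \<delta>1 and are then shrunk.\<close>

lemma substability_localized_solution:
  fixes \<phi> :: "(real^'n) \<times> (real^'m) \<Rightarrow> ereal"
  assumes cl: "closed_fun \<phi>" and pr: "proper_fun \<phi>" and c: "\<phi> (xb, 0) = ereal c"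
    and bcq: "\<forall>y. (0, y) \<in> horizon_subgrad \<phi> (xb, 0) \<longrightarrow> y = 0"
    and stab: "full_substability \<phi> xb" and prox: "full_multiplier_prox_regularity \<phi> xb"
  shows "\<exists>\<delta>0>0. \<exists>\<alpha>0. \<phi> (xb, 0) < ereal \<alpha>0 \<and>
           (\<forall>\<delta>. 0 < \<delta> \<and> \<delta> < \<delta>0 \<longrightarrow> m_loc \<phi> xb \<delta> 0 0 = \<phi> (xb, 0) \<and>
              (\<forall>\<alpha>. m_loc \<phi> xb \<delta> 0 0 < ereal \<alpha> \<and> \<alpha> < \<alpha>0 \<longrightarrow>
                 (\<exists>V U. open V \<and> convex V \<and> 0 \<in> V \<and> open U \<and> convex U \<and> 0 \<in> U \<and>
                    localized_solution_property \<phi> xb \<delta> \<alpha> V U)))"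
proof -
  obtain \<rho>b K where \<rho>b: "\<rho>b > 0" and K: "\<And>x u v y. multiplier_near \<phi> xb \<rho>b x u v y \<Longrightarrow> norm y \<le> K"
    by (rule multiplier_near_bounded[OF cl c bcq]) blast
  obtain \<rho> r where \<rho>: "\<rho> > 0" "r > 0" "local_growth \<phi> xb UNIV \<rho> (- r) r"
    by (rule prox_regular_imp_uniform_growth[OF cl c bcq prox])
  define Q where "Q \<delta> \<longleftrightarrow> M_loc \<phi> xb \<delta> 0 0 = {xb} \<and>
     (\<exists>V U. open V \<and> 0 \<in> V \<and> open U \<and> 0 \<in> U \<and>
        (\<forall>v\<in>V. \<forall>u\<in>U. is_singleton (M_loc \<phi> xb \<delta> v u)) \<and>
        continuous_on (V \<times> U) (\<lambda>(v, u). M_sol \<phi> xb \<delta> v u) \<and>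
        continuous_on (V \<times> U) (\<lambda>(v, u). m_val \<phi> xb \<delta> v u) \<and>
        (\<exists>L. \<forall>u\<in>U. L-lipschitz_on V (\<lambda>v. M_sol \<phi> xb \<delta> v u)) \<and>
        (\<exists>L. \<forall>u\<in>U. L-lipschitz_on V (\<lambda>v. m_val \<phi> xb \<delta> v u)))" for \<delta>
  have "\<exists>\<delta>0>0. \<forall>\<delta>. 0 < \<delta> \<and> \<delta> < \<delta>0 \<longrightarrow> Q \<delta>" using stab unfolding full_substability_def Q_def .
  then obtain \<delta>s where \<delta>s: "\<delta>s > 0" and S: "\<forall>\<delta>. 0 < \<delta> \<and> \<delta> < \<delta>s \<longrightarrow> Q \<delta>" by blast
  define \<delta>1 where "\<delta>1 = \<delta>s / 2"
  have \<delta>1: "\<delta>1 > 0" "\<delta>1 < \<delta>s" using \<delta>s by (auto simp: \<delta>1_def)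
  define M where "M v u = M_sol \<phi> xb \<delta>1 v u" for v u
  define m where "m v u = m_val \<phi> xb \<delta>1 v u" for v u
  have "Q \<delta>1" using S \<delta>1 by blast
  then obtain V U where VU: "open V" "0 \<in> V" "open U" "0 \<in> U" "\<forall>v\<in>V. \<forall>u\<in>U. is_singleton (M_loc \<phi> xb \<delta>1 v u)"
      "continuous_on (V \<times> U) (\<lambda>(v, u). M v u)" "continuous_on (V \<times> U) (\<lambda>(v, u). m v u)"
      and M0: "M_loc \<phi> xb \<delta>1 0 0 = {xb}"
    unfolding Q_def M_def m_def by blast
  obtain t1 where t1: "t1 > 0" "ball 0 t1 \<subseteq> V" using VU(1,2) open_contains_ball by metis
  obtain t2 where t2: "t2 > 0" "ball 0 t2 \<subseteq> U" using VU(3,4) open_contains_ball by metis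
  define \<tau>1 where "\<tau>1 = min t1 t2"
  have \<tau>1: "\<tau>1 > 0" and sub: "ball 0 \<tau>1 \<subseteq> V" "ball 0 \<tau>1 \<subseteq> U" using t1 t2 by (auto simp: \<tau>1_def)
  have contM: "continuous_on (ball 0 \<tau>1 \<times> ball 0 \<tau>1) (\<lambda>(v, u). M v u)"
    and contm: "continuous_on (ball 0 \<tau>1 \<times> ball 0 \<tau>1) (\<lambda>(v, u). m v u)"
    using VU(6,7) sub by (auto intro: continuous_on_subset[OF _ Sigma_mono])
  have sing: "is_singleton (M_loc \<phi> xb \<delta>1 v u)" if "norm v < \<tau>1" "norm u < \<tau>1" for v u
    using VU(5) sub that by (meson mem_ball_0 subsetD)
  obtain \<sigma> where \<sigma>: "\<sigma> > 0" and sol: "\<And>x u v y. multiplier_near \<phi> xb \<sigma> x u v y \<Longrightarrow> M_loc \<phi> xb \<delta>1 v u = {x}"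
    using stationary_is_solution[OF pr \<tau>1 \<delta>1(1) sing contM[unfolded M_def] M0 \<rho>(3) \<rho>(2) \<rho>(1)] by metis
  have M00: "M 0 0 = xb" by (simp add: M_def M0)
  have m00: "m 0 0 = c" using m_loc_0_eq[OF pr M0] by (simp add: m_def c)
  \<comment> \<open>With \<delta> < \<delta>0 and \<alpha> < \<alpha>0, every point of the
    \<delta>-ball with value below \<alpha> is close enough for both \<open>sol\<close> and the
    bound on multipliers.\<close>
  define \<delta>0 where "\<delta>0 = Min {\<sigma>, \<rho>b, \<delta>1}"
  define \<alpha>0 where "\<alpha>0 = c + min \<sigma> \<rho>b"
  have \<delta>0: "\<delta>0 > 0" "\<delta>0 \<le> \<sigma>" "\<delta>0 \<le> \<rho>b" "\<delta>0 \<le> \<delta>1" using \<sigma> \<rho>b \<delta>1 by (auto simp: \<delta>0_def)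
  show ?thesis
  proof (rule exI[of _ \<delta>0], intro conjI \<delta>0(1), rule exI[of _ \<alpha>0], intro conjI allI impI)
    show "\<phi> (xb, 0) < ereal \<alpha>0" using \<sigma> \<rho>b by (simp add: c \<alpha>0_def)
    fix \<delta> assume d: "0 < \<delta> \<and> \<delta> < \<delta>0"
    then have \<delta>: "\<delta> > 0" "\<delta> < \<sigma>" "\<delta> < \<rho>b" "\<delta> < \<delta>1" using \<delta>0 by auto
    have shrink: "M_loc \<phi> xb \<delta> v u = {M v u}" "m_loc \<phi> xb \<delta> v u = m_loc \<phi> xb \<delta>1 v u"
      if "norm v < \<tau>1" "norm u < \<tau>1" "norm (M v u - xb) < \<delta>" for v u
      using M_loc_shrink[OF M_loc_the_elem[OF sing[OF that(1,2)]]] that(3) \<delta>(4) unfolding M_def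
      by (meson less_imp_le)+
    show m0: "m_loc \<phi> xb \<delta> 0 0 = \<phi> (xb, 0)"
      using shrink(2)[of 0 0] \<tau>1 \<delta>(1) m_loc_0_eq[OF pr M0] by (simp add: M00)
    fix \<alpha> assume "m_loc \<phi> xb \<delta> 0 0 < ereal \<alpha> \<and> \<alpha> < \<alpha>0"
    then have \<alpha>: "c < \<alpha>" "\<alpha> < c + \<sigma>" "\<alpha> < c + \<rho>b" by (auto simp: m0 c \<alpha>0_def)
    obtain \<tau>2 where \<tau>2: "0 < \<tau>2" "\<tau>2 \<le> \<tau>1" "\<And>v u. norm v < \<tau>2 \<Longrightarrow> norm u < \<tau>2 \<Longrightarrow> norm (M v u - xb) < \<delta>"
      using continuous_near_0[OF contM \<tau>1 \<delta>(1)] unfolding M00 dist_norm by metis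
    have "(\<alpha> - c) / 2 > 0" using \<alpha> by simp
    from continuous_near_0[OF contm \<tau>1 this]
    obtain \<tau>3 where \<tau>3: "0 < \<tau>3" "\<tau>3 \<le> \<tau>1" "\<And>v u. norm v < \<tau>3 \<Longrightarrow> norm u < \<tau>3 \<Longrightarrow> \<bar>m v u - c\<bar> < (\<alpha> - c) / 2"
      unfolding m00 dist_real_def by metis
    \<comment> \<open>The last entry gives |v| \<delta> \<le> (\<alpha> - c) / 2. The other half of
      \<alpha> - c is spent on the continuity of m, and \<phi> at the minimizer is m + v \<bullet>
      (M - xb).\<close>
    define \<tau> where "\<tau> = Min {\<tau>2, \<tau>3, \<sigma>, \<rho>b, (\<alpha> - c) / (2 * \<delta>)}"
    have \<tau>: "\<tau> > 0" "\<tau> \<le> \<tau>2" "\<tau> \<le> \<tau>3" "\<tau> \<le> \<sigma>" "\<tau> \<le> \<rho>b" "\<tau> \<le> (\<alpha> - c) / (2 * \<delta>)"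
      unfolding \<tau>_def using \<tau>2(1) \<tau>3(1) \<sigma> \<rho>b \<alpha>(1) \<delta>(1)
      by (simp_all only: Min_gr_iff Min_le finite.intros insertI1 insertI2 insert_not_empty) auto
    have near: "norm v < \<tau>1" "norm u < \<tau>1" "norm (M v u - xb) < \<delta>" "M_loc \<phi> xb \<delta> v u = {M v u}"
        "\<phi> (M v u, u) < ereal \<alpha>" if "norm v < \<tau>" "norm u < \<tau>" for v u
    proof -
      show 1: "norm v < \<tau>1" "norm u < \<tau>1" "norm (M v u - xb) < \<delta>" using that \<tau> \<tau>2 by auto
      then show 2: "M_loc \<phi> xb \<delta> v u = {M v u}" by (rule shrink)
      have "m v u < c + (\<alpha> - c) / 2" using \<tau>3(3)[of v u] that \<tau>(3) by linarith
      moreover have "v \<bullet> (M v u - xb) \<le> norm v * norm (M v u - xb)" by (rule norm_cauchy_schwarz)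
      moreover have "norm v * norm (M v u - xb) \<le> \<tau> * \<delta>" using 1(3) that(1) \<tau>(1) by (intro mult_mono) auto
      moreover have "\<tau> * \<delta> \<le> (\<alpha> - c) / (2 * \<delta>) * \<delta>" using \<tau>(6) \<delta>(1) by (intro mult_right_mono) auto
      moreover have "(\<alpha> - c) / (2 * \<delta>) * \<delta> = (\<alpha> - c) / 2" using \<delta>(1) by simp
      ultimately have "m v u + v \<bullet> (M v u - xb) < \<alpha>" by argo
      then show "\<phi> (M v u, u) < ereal \<alpha>"
        using M_loc_singletonD(3)[OF pr 2] by (simp add: shrink(2)[OF 1] m_def)
    qed
    have loc: "localized_solution_property \<phi> xb \<delta> \<alpha> (ball 0 \<tau>) (ball 0 \<tau>)"
      unfolding localized_solution_property_def
    proof (intro conjI ballI)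
      fix v :: "real^'n" and u :: "real^'m" assume "v \<in> ball 0 \<tau>" "u \<in> ball 0 \<tau>"
      then have vu: "norm v < \<tau>" "norm u < \<tau>" by auto
      note n = near[OF vu]
      show "is_singleton (M_loc \<phi> xb \<delta> v u)" unfolding n(4) by simp
      note S1 = M_loc_singletonD[OF pr n(4)]
      have "\<exists>y. (v, y) \<in> subgrad \<phi> (M v u, u)"
      proof (rule local_min_has_multiplier[OF cl pr S1(3) _ _ _ _ _ _ K])
        show "norm (M v u - xb) < \<rho>b" "norm u < \<rho>b" "norm v < \<rho>b" using vu \<tau> n(3) \<delta>(3) by auto
        have "ereal \<alpha> < \<phi> (xb, 0) + ereal \<rho>b" using \<alpha>(3) by (simp add: c)
        with n(5) show "\<phi> (M v u, u) < \<phi> (xb, 0) + ereal \<rho>b" by (rule order.strict_trans)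
        show "(\<delta> - norm (M v u - xb)) / 2 > 0" using n(3) by simp
        fix x' assume "x' \<in> cball (M v u) ((\<delta> - norm (M v u - xb)) / 2)"
        then have "norm (x' - xb) < \<delta>"
          using n(3) norm_triangle_ineq[of "x' - M v u" "M v u - xb"] by (simp add: dist_norm norm_minus_commute)
        from S1(4)[OF this] show "\<phi> (M v u, u) + ereal (v \<bullet> (x' - M v u)) \<le> \<phi> (x', u)"
          by (simp add: S1(3) inner_diff_right)
      qed
      then have stat: "M v u \<in> M_stat \<phi> v u" unfolding M_stat_def Y_mult_def by blast
      have uniq: "x = M v u" if "x \<in> M_stat \<phi> v u" "norm (x - xb) < \<delta>" "\<phi> (x, u) < ereal \<alpha>" for x
      proof -
        obtain y where y: "(v, y) \<in> subgrad \<phi> (x, u)" using \<open>x \<in> M_stat \<phi> v u\<close> unfolding M_stat_def Y_mult_def by blast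
        have "ereal \<alpha> < \<phi> (xb, 0) + ereal \<sigma>" using \<alpha>(2) by (simp add: c)
        with that(3) have "\<phi> (x, u) < \<phi> (xb, 0) + ereal \<sigma>" by (rule order.strict_trans)
        then have "multiplier_near \<phi> xb \<sigma> x u v y"
          using y that(2) \<delta>(2) vu \<tau>(4) by (simp add: multiplier_near_def)
        then show ?thesis using sol by (simp add: M_def)
      qed
      show "M_loc \<phi> xb \<delta> v u = M_stat \<phi> v u \<inter> {x. norm (x - xb) < \<delta> \<and> \<phi> (x, u) < ereal \<alpha>}"
        unfolding n(4) using n(3,5) stat uniq by blast
    next
      fix u :: "real^'m" assume "u \<in> ball 0 \<tau>"
      then have u: "norm u < \<tau>" by simp
      have "continuous_on (ball 0 \<tau>) ((\<lambda>(v, u). M v u) \<circ> (\<lambda>v. (v, u)))"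
        by (rule continuous_on_compose[OF _ continuous_on_subset[OF contM]])
          (use u near in \<open>auto intro!: continuous_intros\<close>)
      then have "continuous_on (ball 0 \<tau>) (\<lambda>v. M v u)" by (simp add: o_def)
      then have cont: "continuous_on (ball 0 \<tau>) (\<lambda>v. M_sol \<phi> xb \<delta> v u)"
        by (rule continuous_on_eq) (use near u in auto)
      then show "continuous_on (ball 0 \<tau>) (\<lambda>v. xb - M_sol \<phi> xb \<delta> v u)"
        by (intro continuous_intros)
      fix v :: "real^'n" assume "v \<in> ball 0 \<tau>"
      then show "GDERIV (\<lambda>v'. m_val \<phi> xb \<delta> v' u) v :> (xb - M_sol \<phi> xb \<delta> v u)"
        by (rule m_loc_gradient[OF pr open_ball _ _ cont]) (use near u in auto)
    qed
    show "\<exists>V U. open V \<and> convex V \<and> 0 \<in> V \<and> open U \<and> convex U \<and> 0 \<in> U \<and> localized_solution_property \<phi> xb \<delta> \<alpha> V U"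
      by (rule exI[of _ "ball 0 \<tau>"], rule exI[of _ "ball 0 \<tau>"]) (use loc \<tau>(1) in auto)
  qed
qed


subsection \<open>Growth from full stability\<close>

text \<open>For \<open>v + h\<close> in place of \<open>v\<close>, with \<open>h\<close> a small multiple of \<open>x' - M(v, u')\<close>, the lower bound
  \<open>m(v + h, u') + (v + h) \<bullet> (x' - xb)\<close> of \<open>\<phi>(x', u')\<close> gains a positive multiple of
  \<open>|x' - M(v, u')|\<^sup>2\<close>, as \<open>M\<close> is Lipschitz in \<open>v\<close>; Lipschitz continuity in \<open>u\<close> trades
  \<open>M(v, u')\<close> for \<open>M(v, u)\<close>.\<close>

lemma stability_imp_uniform_growth:
  fixes \<phi> :: "(real^'n) \<times> (real^'m) \<Rightarrow> ereal"
  assumes cl: "closed_fun \<phi>" and pr: "proper_fun \<phi>" and c: "\<phi> (xb, 0) = ereal c"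
    and bcq: "\<forall>y. (0, y) \<in> horizon_subgrad \<phi> (xb, 0) \<longrightarrow> y = 0"
    and stab: "full_stability \<phi> xb" and prox: "full_multiplier_prox_regularity \<phi> xb"
  obtains \<rho> s e where "\<rho> > 0" "s > 0" "e \<ge> 0" "local_growth \<phi> xb UNIV \<rho> s e"
proof -
  obtain \<rho> r where \<rho>: "\<rho> > 0" "r > 0" "local_growth \<phi> xb UNIV \<rho> (- r) r"
    by (rule prox_regular_imp_uniform_growth[OF cl c bcq prox])
  define Q where "Q \<delta> \<longleftrightarrow> M_loc \<phi> xb \<delta> 0 0 = {xb} \<and>
     (\<exists>N. open N \<and> (0, 0) \<in> N \<and>
        (\<forall>(v, u)\<in>N. is_singleton (M_loc \<phi> xb \<delta> v u)) \<and>
        (\<exists>L. L-lipschitz_on N (\<lambda>(v, u). M_sol \<phi> xb \<delta> v u)) \<and>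
        (\<exists>L. L-lipschitz_on N (\<lambda>(v, u). m_val \<phi> xb \<delta> v u)))" for \<delta>
  have "\<exists>\<delta>0>0. \<forall>\<delta>. 0 < \<delta> \<and> \<delta> < \<delta>0 \<longrightarrow> Q \<delta>" using stab unfolding full_stability_def Q_def .
  then obtain \<delta>s where \<delta>s: "\<delta>s > 0" and S: "\<forall>\<delta>. 0 < \<delta> \<and> \<delta> < \<delta>s \<longrightarrow> Q \<delta>" by blast
  define \<delta> where "\<delta> = \<delta>s / 2"
  have \<delta>: "\<delta> > 0" "\<delta> < \<delta>s" using \<delta>s by (auto simp: \<delta>_def)
  define M where "M v u = M_sol \<phi> xb \<delta> v u" for v u
  define m where "m v u = m_val \<phi> xb \<delta> v u" for v u
  have "Q \<delta>" using S \<delta> by blast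
  then obtain N L0 where N: "open N" "(0, 0) \<in> N" "\<forall>(v, u)\<in>N. is_singleton (M_loc \<phi> xb \<delta> v u)"
      "L0-lipschitz_on N (\<lambda>(v, u). M v u)" and M0: "M_loc \<phi> xb \<delta> 0 0 = {xb}"
    unfolding Q_def M_def by blast
  obtain d where d: "d > 0" "ball (0, 0) d \<subseteq> N" using N(1,2) open_contains_ball by metis
  define \<tau> where "\<tau> = d / 2"
  have \<tau>: "\<tau> > 0" using d by (simp add: \<tau>_def)
  have inN: "(v, u) \<in> N" if "norm v < \<tau>" "norm u < \<tau>" for v u
  proof -
    have "dist (v, u) (0, 0) < d" using norm_Pair_le[of v u] that by (simp add: dist_norm \<tau>_def)
    then show ?thesis using d(2) by (auto simp: dist_commute)
  qed
  have sing: "is_singleton (M_loc \<phi> xb \<delta> v u)" if "norm v < \<tau>" "norm u < \<tau>" for v u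
    using N(3) inN[OF that] by blast
  have contM: "continuous_on (ball 0 \<tau> \<times> ball 0 \<tau>) (\<lambda>(v, u). M v u)"
    using lipschitz_on_continuous_on[OF N(4)] by (rule continuous_on_subset) (use inN in auto)
  define L where "L = max L0 1"
  have L: "L \<ge> 1" "L > 0" by (auto simp: L_def)
  have lip: "norm (M v' u' - M v u) \<le> L * (norm (v' - v) + norm (u' - u))"
    if "norm v < \<tau>" "norm u < \<tau>" "norm v' < \<tau>" "norm u' < \<tau>" for v u v' u'
  proof -
    have "norm (M v' u' - M v u) \<le> L0 * dist (v', u') (v, u)"
      using lipschitz_onD[OF N(4) inN[OF that(3,4)] inN[OF that(1,2)]] by (simp add: dist_norm)
    also have "\<dots> \<le> L * dist (v', u') (v, u)" by (rule mult_right_mono) (auto simp: L_def)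
    also have "\<dots> \<le> L * (norm (v' - v) + norm (u' - u))"
      using L norm_Pair_le[of "v' - v" "u' - u"] by (intro mult_left_mono) (auto simp: dist_norm)
    finally show ?thesis .
  qed
  obtain \<sigma> where \<sigma>: "\<sigma> > 0" and sol: "\<And>x u v y. multiplier_near \<phi> xb \<sigma> x u v y \<Longrightarrow> M_loc \<phi> xb \<delta> v u = {x}"
    using stationary_is_solution[OF pr \<tau> \<delta>(1) sing contM[unfolded M_def] M0 \<rho>(3) \<rho>(2) \<rho>(1)] by metis
  have M00: "M 0 0 = xb" by (simp add: M_def M0)
  \<comment> \<open>The last entry keeps M(v, u') within \<rho> of xb, where prox-regularity can be
    tested. The third of \<tau> is needed for v + h, whose norm stays below \<rho>' + 2
    \<rho>'.\<close>
  define \<rho>' where "\<rho>' = Min {\<sigma>, \<rho>, \<delta>, \<tau> / 3, \<rho> / (2 * L)}"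
  have \<rho>': "\<rho>' > 0" "\<rho>' \<le> \<sigma>" "\<rho>' \<le> \<rho>" "\<rho>' \<le> \<delta>" "\<rho>' \<le> \<tau> / 3" "\<rho>' \<le> \<rho> / (2 * L)"
    unfolding \<rho>'_def using \<sigma> \<rho>(1) \<delta>(1) \<tau> L(2)
    by (simp_all only: Min_gr_iff Min_le finite.intros insertI1 insertI2 insert_not_empty) auto
  have L\<rho>: "L * (2 * \<rho>') \<le> \<rho>" using \<rho>'(6) L(2) by (simp add: pos_le_divide_eq mult_ac)
  \<comment> \<open>The gain |x' - x2|^2 / (4 L) is at least half of 1 / (4 L) times |x' - x|^2,
    less L/4 |u' - u|^2 for replacing x2 by x. Prox-regularity at the distance |x2 - x| \<le> L |u'
    - u| costs the multiple r/2 (L^2 + 1) of |u' - u|^2.\<close>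
  have "local_growth \<phi> xb UNIV \<rho>' (1 / (4 * L)) (r * (L\<^sup>2 + 1) + L / 2)"
    unfolding local_growth_def
  proof (intro allI impI, elim conjE)
    fix x v x' :: "real^'n" and u y u' :: "real^'m"
    assume near: "multiplier_near \<phi> xb \<rho>' x u v y" and n': "norm (x' - xb) < \<rho>'" "norm u' < \<rho>'"
    have n: "norm (x - xb) < \<rho>'" "norm u < \<rho>'" "norm v < \<rho>'" using near by (auto simp: multiplier_near_def)
    have Mx: "M_loc \<phi> xb \<delta> v u = {x}" by (rule sol[OF multiplier_near_mono[OF near \<rho>'(2)]])
    then have Mvu: "M v u = x" by (simp add: M_def)
    have t: "norm v < \<tau>" "norm u < \<tau>" "norm u' < \<tau>" using n n' \<rho>'(1,5) by auto
    note S1 = M_loc_singletonD[OF pr Mx, folded m_def]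
    define x2 where "x2 = M v u'"
    have Mx2: "M_loc \<phi> xb \<delta> v u' = {x2}"
      unfolding x2_def M_def by (rule M_loc_the_elem[OF sing[OF t(1,3)]])
    note S2 = M_loc_singletonD[OF pr Mx2, folded m_def]
    have "norm (M v u' - M 0 0) \<le> L * (norm (v - 0) + norm (u' - 0))" by (rule lip) (use t \<tau> in auto)
    also have "\<dots> < L * (2 * \<rho>')" using n(3) n'(2) L(2) by (intro mult_strict_left_mono) auto
    finally have x2n: "norm (x2 - xb) < L * (2 * \<rho>')" by (simp add: M00 x2_def)
    \<comment> \<open>For h = t (x' - x2) the net gain is (t - L t^2) |x' - x2|^2, which is largest
      at t = 1 / (2 L), with value 1 / (4 L) times the square.\<close>
    define h where "h = (1 / (2 * L)) *\<^sub>R (x' - x2)"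
    have "norm (x' - x2) \<le> norm (x' - xb) + norm (x2 - xb)"
      using norm_triangle_ineq4[of "x' - xb" "x2 - xb"] by simp
    also have "\<dots> \<le> \<rho>' + L * (2 * \<rho>')" using n'(1) x2n by simp
    also have "\<dots> \<le> L * (4 * \<rho>')" using mult_right_mono[OF L(1), of \<rho>'] \<rho>'(1) by simp
    finally have "norm (x' - x2) \<le> L * (4 * \<rho>')" .
    moreover have "norm (x' - x2) = 2 * L * norm h" unfolding h_def using L(2) by simp
    ultimately have "L * norm h \<le> L * (2 * \<rho>')" by simp
    then have "norm h \<le> 2 * \<rho>'" using L(2) by simp
    then have vh: "norm (v + h) < \<tau>" using norm_triangle_ineq[of v h] n(3) \<rho>'(5) by simp
    define x3 where "x3 = M (v + h) u'"
    have Mx3: "M_loc \<phi> xb \<delta> (v + h) u' = {x3}"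
      unfolding x3_def M_def by (rule M_loc_the_elem[OF sing[OF vh t(3)]])
    note S3 = M_loc_singletonD[OF pr Mx3, folded m_def]
    \<comment> \<open>Lowers the bound through the minimizer x3 at v + h; replacing x3 by x2 costs
      at most L |h|^2, the quadratic term in the choice of h.\<close>
    have "m v u' \<le> m (v + h) u' - (v - (v + h)) \<bullet> (x3 - xb)"
      unfolding m_def by (rule m_loc_supergradient[OF pr Mx3 sing[OF t(1,3)]])
    then have m1: "m (v + h) u' \<ge> m v u' - h \<bullet> (x3 - xb)" by simp
    have "norm (x3 - x2) \<le> L * norm h" using lip[OF t(1,3) vh t(3)] by (simp add: x3_def x2_def)
    then have "norm h * norm (x3 - x2) \<le> norm h * (L * norm h)" by (intro mult_left_mono) auto
    then have hx: "h \<bullet> (x3 - x2) \<le> L * (norm h)\<^sup>2"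
      using norm_cauchy_schwarz[of h "x3 - x2"] by (simp add: power2_eq_square mult_ac)
    have "norm (x' - xb) < \<delta>" using n'(1) \<rho>'(4) by simp
    from S3(4)[OF this] have lower: "ereal (m (v + h) u' + (v + h) \<bullet> (x' - xb)) \<le> \<phi> (x', u')" .
    define D where "D = (norm (x' - x2))\<^sup>2"
    have hD1: "h \<bullet> (x' - x2) = 1 / (2 * L) * D"
      unfolding h_def D_def inner_scaleR_left power2_norm_eq_inner by (rule refl)
    have "norm h = 1 / (2 * L) * norm (x' - x2)" unfolding h_def norm_scaleR using L(2) by simp
    then have "L * (norm h)\<^sup>2 = L * (1 / (2 * L) * norm (x' - x2))\<^sup>2" by (simp only:)
    also have "\<dots> = 1 / (4 * L) * D"
      unfolding D_def power_mult_distrib using L(2) by (simp add: power2_eq_square)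
    finally have hD2: "L * (norm h)\<^sup>2 = 1 / (4 * L) * D" .
    define x2x where "x2x = (norm (x2 - x))\<^sup>2"
    define du where "du = (norm (u' - u))\<^sup>2"
    have "norm (x2 - x) \<le> L * norm (u' - u)" using lip[OF t(1,2) t(1,3)] by (simp add: x2_def Mvu)
    then have "x2x \<le> (L * norm (u' - u))\<^sup>2" unfolding x2x_def by (intro power_mono) auto
    then have x2x: "x2x \<le> L\<^sup>2 * du" by (simp add: du_def power_mult_distrib)
    have DD: "(norm (x' - x))\<^sup>2 \<le> 2 * D + 2 * x2x"
    proof -
      have "norm (x' - x) \<le> norm (x' - x2) + norm (x2 - x)"
        using norm_triangle_ineq[of "x' - x2" "x2 - x"] by simp
      then have "(norm (x' - x))\<^sup>2 \<le> (norm (x' - x2) + norm (x2 - x))\<^sup>2" by (intro power_mono) auto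
      also have "\<dots> \<le> 2 * D + 2 * x2x"
        using sum_squares_bound[of "norm (x' - x2)" "norm (x2 - x)"] by (simp add: D_def x2x_def power2_sum)
      finally show ?thesis .
    qed
    have x2\<rho>: "norm (x2 - xb) < \<rho>" using x2n L\<rho> by simp
    have u'\<rho>: "norm u' < \<rho>" using n'(2) \<rho>'(3) by simp
    \<comment> \<open>Prox-regularity enters only here: tested at (x2, u') it bounds m(v, u') from
      below by m(v, u) and the linear term in u' - u.\<close>
    from local_growthD[OF \<rho>(3) multiplier_near_mono[OF near \<rho>'(3)] UNIV_I x2\<rho> u'\<rho>]
    have prox': "m v u + v \<bullet> (x - xb) + (v \<bullet> (x2 - x) + y \<bullet> (u' - u) - r / 2 * x2x - r / 2 * du) \<le> m v u' + v \<bullet> (x2 - xb)"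
      unfolding S1(3) S2(3) by (simp add: x2x_def du_def)
    define P where "P = 1 / (4 * L) * D"
    define R where "R = r / 2 * (L\<^sup>2 * du)"
    define S where "S = L / 4 * du"
    define T where "T = 1 / (4 * L) / 2 * (norm (x' - x))\<^sup>2"
    have "r / 2 * x2x \<le> R" unfolding R_def using x2x \<rho>(2) by (intro mult_left_mono) auto
    moreover have "T \<le> P + S"
    proof -
      have "T \<le> 1 / (4 * L) / 2 * (2 * D + 2 * (L\<^sup>2 * du))"
        unfolding T_def using DD x2x L(2) by (intro mult_left_mono) auto
      also have "\<dots> = P + S" unfolding P_def S_def using L(2) by (simp add: field_simps power2_eq_square)
      finally show ?thesis .
    qed
    moreover have "h \<bullet> (x' - x2) = 2 * P" "L * (norm h)\<^sup>2 = P"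
      using hD1 hD2 by (simp_all add: P_def)
    moreover have "(v + h) \<bullet> (x' - xb) = v \<bullet> (x' - x) + v \<bullet> (x - xb) + h \<bullet> (x' - x2) + h \<bullet> (x2 - xb)"
      "h \<bullet> (x3 - xb) = h \<bullet> (x3 - x2) + h \<bullet> (x2 - xb)" "v \<bullet> (x2 - x) = v \<bullet> (x2 - xb) - v \<bullet> (x - xb)"
      by (simp_all add: inner_simps)
    moreover have "(r * (L\<^sup>2 + 1) + L / 2) / 2 * du = R + r / 2 * du + S"
      by (simp add: R_def S_def field_simps)
    ultimately have "m v u + v \<bullet> (x - xb) + (v \<bullet> (x' - x) + y \<bullet> (u' - u) + T
        - (r * (L\<^sup>2 + 1) + L / 2) / 2 * du) \<le> m (v + h) u' + (v + h) \<bullet> (x' - xb)"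
      using m1 hx prox' by argo
    then have "m v u + v \<bullet> (x - xb) + (v \<bullet> (x' - x) + y \<bullet> (u' - u) + 1 / (4 * L) / 2 * (norm (x' - x))\<^sup>2
        - (r * (L\<^sup>2 + 1) + L / 2) / 2 * du) \<le> m (v + h) u' + (v + h) \<bullet> (x' - xb)" unfolding T_def .
    then have "ereal (m v u + v \<bullet> (x - xb)) + ereal (v \<bullet> (x' - x) + y \<bullet> (u' - u) + 1 / (4 * L) / 2 * (norm (x' - x))\<^sup>2
        - (r * (L\<^sup>2 + 1) + L / 2) / 2 * du) \<le> ereal (m (v + h) u' + (v + h) \<bullet> (x' - xb))"
      unfolding plus_ereal.simps ereal_less_eq .
    then show "\<phi> (x, u) + ereal (v \<bullet> (x' - x) + y \<bullet> (u' - u) + 1 / (4 * L) / 2 * (norm (x' - x))\<^sup>2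
        - (r * (L\<^sup>2 + 1) + L / 2) / 2 * (norm (u' - u))\<^sup>2) \<le> \<phi> (x', u')"
      using lower unfolding S1(3) du_def by (rule order_trans)
  qed
  then show thesis by (rule that[OF \<rho>'(1), rotated 2]) (use L \<rho>(2) in auto)
qed

text \<open>The joint minimizer for the tilt v and the penalty at rate K + 1 sits at u' = u. Tested
  at a solution for u', this becomes a bound of m at u by m at u' plus (K + 1) |u' - u|. The box has
  a fixed radius \<delta>1 while \<sigma> locates the minimizer, so one box serves all \<delta>
  \<le> \<delta>1.\<close>

definition exact_at ::
    "('a::euclidean_space \<times> 'b::euclidean_space \<Rightarrow> ereal) \<Rightarrow> 'a \<Rightarrow> real \<Rightarrow> real \<Rightarrow> real \<Rightarrow> real \<Rightarrow> 'a \<Rightarrow> 'b \<Rightarrow> bool" where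
  "exact_at \<phi> xb c K \<delta>1 \<sigma> v u \<longleftrightarrow>
      (\<exists>x a. norm (x - xb) < \<sigma> \<and> \<phi> (x, u) = ereal a \<and> a < c + \<sigma> \<and>
        (\<forall>x' u'. norm (x' - xb) \<le> \<delta>1 \<and> norm u' \<le> \<delta>1 \<longrightarrow>
           ereal (a + v \<bullet> (x' - x) - (K + 1) * norm (u' - u)) \<le> \<phi> (x', u')))"

text \<open>The penalty \<open>(K + 1) |u' - u|\<close> is exact: off \<open>u' = u\<close> a minimizer would have a multiplier of
  norm \<open>K + 1\<close>.\<close>

lemma exact_penalty:
  fixes \<phi> :: "'a::euclidean_space \<times> 'b::euclidean_space \<Rightarrow> ereal"
  assumes cl: "closed_fun \<phi>" and pr: "proper_fun \<phi>" and c: "\<phi> (xb, 0) = ereal c"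
    and growth: "local_growth \<phi> xb UNIV \<rho> s e" and \<rho>: "\<rho> > 0" and s: "s > 0" and e: "e \<ge> 0"
    and \<rho>b: "\<rho>b > 0" and K: "\<And>x u v y. multiplier_near \<phi> xb \<rho>b x u v y \<Longrightarrow> norm y \<le> K"
    and yb: "(0, yb) \<in> subgrad \<phi> (xb, 0)"
  obtains \<delta>1 where "\<delta>1 > 0" "\<delta>1 < \<rho>" "\<And>\<sigma>. \<sigma> > 0 \<Longrightarrow> \<exists>\<tau>>0. \<forall>v u. norm v < \<tau> \<and> norm u < \<tau> \<longrightarrow> exact_at \<phi> xb c K \<delta>1 \<sigma> v u"
proof -
  have "multiplier_near \<phi> xb \<rho>b xb 0 0 yb" using \<rho>b yb by (simp add: multiplier_near_def c)
  then have ybK: "norm yb \<le> K" by (rule K)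
  then have K0: "K \<ge> 0" using norm_ge_zero order_trans by blast
  have near0: "multiplier_near \<phi> xb \<rho> xb 0 0 yb" using \<rho> yb by (simp add: multiplier_near_def c)
  \<comment> \<open>The bound 1 / (e + 1) gives e/2 |w|^2 \<le> |w| / 2 in the box. Of the rate K +
    1, the part K pays for the multiplier yb and half of the remaining 1 for this term, so |w| / 2
    is left.\<close>
  define \<delta>1 where "\<delta>1 = min (\<rho> / 2) (1 / (e + 1))"
  have \<delta>1: "\<delta>1 > 0" "\<delta>1 < \<rho>" "\<delta>1 \<le> 1 / (e + 1)" using \<rho> e by (auto simp: \<delta>1_def)
  have e\<delta>: "e * \<delta>1 \<le> 1"
    using \<delta>1 e by (simp add: pos_le_divide_eq algebra_simps)
  show thesis
  proof (rule that[OF \<delta>1(1,2)])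
    fix \<sigma>0 :: real assume "\<sigma>0 > 0"
    define \<sigma> where "\<sigma> = Min {\<sigma>0, \<rho>b, \<delta>1}"
    have \<sigma>: "\<sigma> > 0" "\<sigma> \<le> \<sigma>0" "\<sigma> \<le> \<rho>b" "\<sigma> \<le> \<delta>1" using \<open>\<sigma>0 > 0\<close> \<rho>b \<delta>1 by (auto simp: \<sigma>_def)
    \<comment> \<open>The estimate |w| / 2 + s/2 |x - xb|^2 < B below then gives |w| < \<sigma> and
      |x - xb| < \<sigma>.\<close>
    define B where "B = min (\<sigma> / 2) (s / 2 * \<sigma>\<^sup>2)"
    have B: "B > 0" "B \<le> \<sigma> / 2" "B \<le> s / 2 * \<sigma>\<^sup>2" using \<sigma>(1) s by (auto simp: B_def)
    define \<tau> where "\<tau> = Min {\<sigma>, B / (2 * (\<delta>1 + 2 * (K + 1)))}"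
    have den: "\<delta>1 + 2 * (K + 1) > 0" using \<delta>1(1) K0 by (simp add: add_pos_nonneg)
    have \<tau>: "\<tau> > 0" "\<tau> \<le> \<sigma>" "\<tau> \<le> B / (2 * (\<delta>1 + 2 * (K + 1)))"
      unfolding \<tau>_def using \<sigma>(1) B(1) den
      by (simp_all only: Min_gr_iff Min_le finite.intros insertI1 insertI2 insert_not_empty) auto
    have "\<tau> * (2 * (\<delta>1 + 2 * (K + 1))) \<le> B" using \<tau>(3) den by (simp add: pos_le_divide_eq)
    then have \<tau>B: "\<tau> * \<delta>1 + 2 * (K + 1) * \<tau> < B" using B(1) by (simp add: algebra_simps)
    show "\<exists>\<tau>>0. \<forall>v u. norm v < \<tau> \<and> norm u < \<tau> \<longrightarrow> exact_at \<phi> xb c K \<delta>1 \<sigma>0 v u"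
    proof (intro exI[of _ \<tau>] conjI \<tau>(1) allI impI)
      fix v :: 'a and u :: 'b assume vu: "norm v < \<tau> \<and> norm u < \<tau>"
      define C :: "('a \<times> 'b) set" where "C = cball xb \<delta>1 \<times> cball 0 \<delta>1"
      have C: "compact C" "C \<noteq> {}" "(xb, 0) \<in> C" using \<delta>1 by (auto simp: C_def compact_Times)
      define g where "g z = - (v \<bullet> (fst z - xb)) + (K + 1) * norm (snd z - u)" for z
      have "closed_fun (\<lambda>z. \<phi> z + ereal (g z))"
        unfolding g_def by (intro closed_fun_add_continuous cl continuous_intros)
      then obtain z where z: "z \<in> C" and zmin: "\<And>z'. z' \<in> C \<Longrightarrow> \<phi> z + ereal (g z) \<le> \<phi> z' + ereal (g z')"
        by (rule closed_fun_attains_min[OF _ C(1,2)]) blast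
      obtain x w where zz: "z = (x, w)" by (metis surj_pair)
      have z0: "\<phi> z + ereal (g z) \<le> ereal (c + (K + 1) * norm u)" using zmin[OF C(3)] by (simp add: c g_def)
      have "\<phi> z \<noteq> -\<infinity>" using pr unfolding proper_fun_def by blast
      then obtain a where a: "\<phi> (x, w) = ereal a" using z0 zz by (cases "\<phi> z") auto
      define A where "A = norm (x - xb)"
      have xw: "A \<le> \<delta>1" "norm w \<le> \<delta>1" using z by (auto simp: C_def zz A_def dist_norm norm_minus_commute)
      have up: "a - v \<bullet> (x - xb) + (K + 1) * norm (w - u) \<le> c + (K + 1) * norm u"
        using z0 by (simp add: zz a g_def)
      have "norm (x - xb) < \<rho>" "norm w < \<rho>" using xw \<delta>1(2) by (auto simp: A_def)
      \<comment> \<open>Growth at (xb, 0) bounds \<phi>(x, w) from below, and comparison of z with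
        (xb, 0) bounds it from above; together they locate the penalty minimizer.\<close>
      from local_growthD[OF growth near0 UNIV_I this]
      have lo: "c + (yb \<bullet> w + s / 2 * A\<^sup>2 - e / 2 * (norm w)\<^sup>2) \<le> a" by (simp add: a c A_def)
      have "- (yb \<bullet> w) \<le> K * norm w"
        using Cauchy_Schwarz_ineq2[of yb w] mult_right_mono[OF ybK norm_ge_zero[of w]] by linarith
      moreover have "e / 2 * (norm w)\<^sup>2 \<le> 1 / 2 * norm w"
      proof -
        have "e * norm w \<le> 1" using mult_left_mono[OF xw(2) e] e\<delta> by linarith
        then have "(e * norm w) * norm w \<le> 1 * norm w" by (rule mult_right_mono) simp
        then show ?thesis by (simp add: power2_eq_square mult_ac)
      qed
      moreover have "v \<bullet> (x - xb) \<le> \<tau> * \<delta>1"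
        using norm_cauchy_schwarz[of v "x - xb"] mult_mono[of "norm v" \<tau> A \<delta>1] vu xw \<tau>(1) by (simp add: A_def)
      moreover have "(K + 1) * norm w \<le> (K + 1) * norm (w - u) + (K + 1) * norm u"
      proof -
        have "norm w \<le> norm (w - u) + norm u" using norm_triangle_sub[of w u] by simp
        then show ?thesis using K0 mult_left_mono[of "norm w" "norm (w - u) + norm u" "K + 1"] by (simp add: algebra_simps)
      qed
      moreover have Ku: "(K + 1) * norm u \<le> (K + 1) * \<tau>" using vu K0 by (intro mult_left_mono) auto
      moreover have "(K + 1) * norm w = K * norm w + norm w" by (simp add: algebra_simps)
      ultimately have sum: "norm w / 2 + s / 2 * A\<^sup>2 < B" using up lo \<tau>B by linarith
      have "s / 2 * A\<^sup>2 \<ge> 0" using s by simp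
      then have w\<sigma>: "norm w < \<sigma>" using sum B(2) by linarith
      have "s / 2 * A\<^sup>2 < s / 2 * \<sigma>\<^sup>2" using sum B(3) norm_ge_zero[of w] by linarith
      then have "A\<^sup>2 < \<sigma>\<^sup>2" using s by simp
      then have A\<sigma>: "A < \<sigma>" using \<sigma>(1) by (simp add: power_less_imp_less_base)
      have "(K + 1) * norm (w - u) \<ge> 0" using K0 by simp
      then have a\<sigma>: "a < c + \<sigma>" using up Ku \<open>v \<bullet> (x - xb) \<le> \<tau> * \<delta>1\<close> \<tau>B B(2) K0 \<tau>(1) \<sigma>(1)
        mult_nonneg_nonneg[of "K + 1" \<tau>] by linarith
      have wu: "w = u"
      proof (rule ccontr)
        assume ne: "w \<noteq> u"
        have "z \<in> ball xb \<delta>1 \<times> ball 0 \<delta>1" using A\<sigma> w\<sigma> \<sigma>(4) by (auto simp: zz A_def dist_norm norm_minus_commute)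
        then have "\<forall>\<^sub>F z' in nhds z. z' \<in> ball xb \<delta>1 \<times> ball 0 \<delta>1"
          by (intro eventually_nhds_in_open open_Times) auto
        then have ev: "\<forall>\<^sub>F z' in nhds z. \<phi> z + ereal (g z) \<le> \<phi> z' + ereal (g z')"
          by eventually_elim (rule zmin, auto simp: C_def)
        define y where "y = (K + 1) *\<^sub>R sgn (w - u)"
        have "((\<lambda>z. norm (snd z - u)) has_derivative (\<lambda>h. sgn (w - u) \<bullet> snd h)) (at z)"
        proof -
          have 1: "((\<lambda>z::'a\<times>'b. snd z - u) has_derivative snd) (at z)"
            by (auto intro!: derivative_eq_intros)
          have 2: "(norm has_derivative (\<lambda>h. sgn (w - u) \<bullet> h)) (at (snd z - u))"
            using has_derivative_norm[of "w - u"] ne by (simp add: zz inner_commute)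
          show ?thesis using has_derivative_compose[OF 1 2] by simp
        qed
        then have "((\<lambda>z. (K + 1) * norm (snd z - u)) has_derivative (\<lambda>h. (K + 1) * (sgn (w - u) \<bullet> snd h))) (at z)"
          by (rule has_derivative_mult_right)
        moreover have "((\<lambda>z. - (v \<bullet> (fst z - xb))) has_derivative (\<lambda>h. - (v \<bullet> fst h))) (at z)"
          by (auto intro!: derivative_eq_intros)
        ultimately have "(g has_derivative (\<lambda>h. - (v \<bullet> fst h) + (K + 1) * (sgn (w - u) \<bullet> snd h))) (at z)"
          unfolding g_def by (rule has_derivative_add[rotated])
        then have "(g has_derivative (\<lambda>h. (- v, y) \<bullet> h)) (at z)"
          by (simp add: inner_prod_def y_def)
        from regular_subgradI_min[OF _ ev this] have "(v, - y) \<in> regular_subgrad \<phi> (x, w)" by (simp add: zz a)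
        then have "multiplier_near \<phi> xb \<rho>b x w v (- y)"
          using A\<sigma> w\<sigma> a\<sigma> \<sigma>(3) vu \<tau>(2) regular_subset_subgrad unfolding multiplier_near_def
          by (auto simp: A_def a c)
        from K[OF this] have "norm y \<le> K" by simp
        moreover have "norm y = K + 1" using ne K0 by (simp add: y_def norm_sgn)
        ultimately show False by simp
      qed
      show "exact_at \<phi> xb c K \<delta>1 \<sigma>0 v u"
        unfolding exact_at_def
      proof (rule exI[of _ x], rule exI[of _ a], intro conjI allI impI)
        show "norm (x - xb) < \<sigma>0" "\<phi> (x, u) = ereal a" "a < c + \<sigma>0" using A\<sigma> a\<sigma> \<sigma>(2) a wu by (auto simp: A_def)
        fix x' :: 'a and u' :: 'b assume "norm (x' - xb) \<le> \<delta>1 \<and> norm u' \<le> \<delta>1"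
        then have "(x', u') \<in> C" by (simp add: C_def dist_norm norm_minus_commute)
        from zmin[OF this] show "ereal (a + v \<bullet> (x' - x) - (K + 1) * norm (u' - u)) \<le> \<phi> (x', u')"
          using a by (cases "\<phi> (x', u')") (auto simp: zz wu g_def inner_diff_right)
      qed
    qed
  qed
qed


subsection \<open>Substability from growth\<close>

text \<open>The estimate in u is one-sided but required for all pairs u, u', hence amounts to
  Lipschitz continuity. The multiplier is kept so that growth can be applied at the
  solution.\<close>

definition solvable_near ::
    "((real^'n) \<times> (real^'m) \<Rightarrow> ereal) \<Rightarrow> real^'n \<Rightarrow> real \<Rightarrow> real \<Rightarrow> real \<Rightarrow> real \<Rightarrow> bool" where
  "solvable_near \<phi> xb \<rho> K \<delta> \<tau> \<longleftrightarrow> (\<forall>v u. norm v < \<tau> \<and> norm u < \<tau> \<longrightarrow>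
     (\<exists>x y. M_loc \<phi> xb \<delta> v u = {x} \<and> multiplier_near \<phi> xb \<rho> x u v y) \<and>
     (\<forall>u'. norm u' < \<tau> \<longrightarrow>
        m_val \<phi> xb \<delta> v u \<le> m_val \<phi> xb \<delta> v u' + K * norm (u' - u)))"

text \<open>Conditions quantified over the multipliers at xb would be vacuous if there were none.
  Local optimality of xb supplies one.\<close>

lemma multiplier_exists:
  assumes cl: "closed_fun \<phi>" and pr: "proper_fun \<phi>" and c: "\<phi> (xb, 0) = ereal c"
    and lm: "\<forall>\<^sub>F x in nhds xb. \<phi> (xb, 0) \<le> \<phi> (x, 0)"
    and \<rho>b: "\<rho>b > 0" and K: "\<And>x u v y. multiplier_near \<phi> xb \<rho>b x u v y \<Longrightarrow> norm y \<le> K"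
  shows "\<exists>yb. (0, yb) \<in> subgrad \<phi> (xb, 0)"
proof -
  obtain d where d: "d > 0" "\<And>x. dist x xb < d \<Longrightarrow> \<phi> (xb, 0) \<le> \<phi> (x, 0)"
    using lm unfolding eventually_nhds_metric by blast
  show ?thesis
  proof (rule local_min_has_multiplier[OF cl pr c _ _ _ _ _ _ K])
    show "d / 2 > 0" using d by simp
    fix x' assume "x' \<in> cball xb (d / 2)"
    then have "dist x' xb < d" using d(1) by (simp add: dist_commute)
    from d(2)[OF this] show "\<phi> (xb, 0) + ereal (0 \<bullet> (x' - xb)) \<le> \<phi> (x', 0)" by simp
  qed (use \<rho>b c in auto)
qed

text \<open>Existence comes from the exact penalty, whose minimizer at u' = u has a multiplier;
  growth at that multiplier is strict for x' \<noteq> x and yields uniqueness.\<close>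

lemma growth_imp_solvable:
  fixes \<phi> :: "(real^'n) \<times> (real^'m) \<Rightarrow> ereal"
  assumes cl: "closed_fun \<phi>" and pr: "proper_fun \<phi>" and c: "\<phi> (xb, 0) = ereal c"
    and bcq: "\<forall>y. (0, y) \<in> horizon_subgrad \<phi> (xb, 0) \<longrightarrow> y = 0"
    and lm: "\<forall>\<^sub>F x in nhds xb. \<phi> (xb, 0) \<le> \<phi> (x, 0)"
    and growth: "local_growth \<phi> xb UNIV \<rho> s e" and \<rho>: "\<rho> > 0" and s: "s > 0" and e: "e \<ge> 0"
  obtains \<delta>1 K where "\<delta>1 > 0" "\<delta>1 < \<rho>" "K \<ge> 0"
    "\<And>\<delta>. 0 < \<delta> \<Longrightarrow> \<delta> \<le> \<delta>1 \<Longrightarrow> M_loc \<phi> xb \<delta> 0 0 = {xb} \<and> (\<exists>\<tau>>0. solvable_near \<phi> xb \<rho> K \<delta> \<tau>)"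
proof -
  obtain \<rho>b K where \<rho>b: "\<rho>b > 0" and K: "\<And>x u v y. multiplier_near \<phi> xb \<rho>b x u v y \<Longrightarrow> norm y \<le> K"
    by (rule multiplier_near_bounded[OF cl c bcq]) blast
  obtain yb where yb: "(0, yb) \<in> subgrad \<phi> (xb, 0)" using multiplier_exists[OF cl pr c lm \<rho>b, of K] K by blast
  have "multiplier_near \<phi> xb \<rho>b xb 0 0 yb" using \<rho>b yb by (simp add: multiplier_near_def c)
  then have "norm yb \<le> K" by (rule K)
  then have K0: "K + 1 \<ge> 0" using norm_ge_zero[of yb] by linarith
  have near0: "multiplier_near \<phi> xb \<rho> xb 0 0 yb" using \<rho> yb by (simp add: multiplier_near_def c)
  obtain \<delta>1 where \<delta>1: "\<delta>1 > 0" "\<delta>1 < \<rho>" and pen: "\<And>\<sigma>. \<sigma> > 0 \<Longrightarrow> \<exists>\<tau>>0. \<forall>v u. norm v < \<tau> \<and> norm u < \<tau> \<longrightarrow> exact_at \<phi> xb c K \<delta>1 \<sigma> v u"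
    by (rule exact_penalty[OF cl pr c growth \<rho> s e \<rho>b _ yb], erule K, metis)
  have strict: "ereal (a + v \<bullet> (x' - x)) < \<phi> (x', u)"
    if near: "multiplier_near \<phi> xb \<rho> x u v y" and a: "\<phi> (x, u) = ereal a" and x': "norm (x' - xb) < \<rho>" "x' \<noteq> x" for x x' u v y a
  proof -
    have "norm u < \<rho>" using near by (simp add: multiplier_near_def)
    from local_growthD[OF growth near UNIV_I x'(1) this]
    have "ereal (a + (v \<bullet> (x' - x) + s / 2 * (norm (x' - x))\<^sup>2)) \<le> \<phi> (x', u)" by (simp add: a)
    moreover have "s / 2 * (norm (x' - x))\<^sup>2 > 0" using s x'(2) by simp
    ultimately show ?thesis by (cases "\<phi> (x', u)") auto
  qed
  \<comment> \<open>The constant passed on as K is the penalty rate K + 1.\<close>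
  show thesis
  proof (rule that[OF \<delta>1 K0], rule conjI)
    fix \<delta> :: real assume \<delta>: "0 < \<delta>" "\<delta> \<le> \<delta>1"
    show "M_loc \<phi> xb \<delta> 0 0 = {xb}"
      by (rule M_loc_singletonI[where a=c]) (use \<delta> \<delta>1 c strict[OF near0 c] in auto)
    \<comment> \<open>The bound \<delta> keeps the penalty minimizer inside the ball that defines
      \<open>M_loc\<close>, \<rho>b provides its multiplier, and \<rho> makes growth applicable
      there.\<close>
    define \<sigma> where "\<sigma> = Min {\<delta>, \<rho>, \<rho>b}"
    have \<sigma>: "\<sigma> > 0" "\<sigma> \<le> \<delta>" "\<sigma> \<le> \<rho>" "\<sigma> \<le> \<rho>b" using \<delta> \<rho> \<rho>b by (auto simp: \<sigma>_def)
    obtain \<tau>0 where \<tau>0: "\<tau>0 > 0" and P: "\<forall>v u. norm v < \<tau>0 \<and> norm u < \<tau>0 \<longrightarrow> exact_at \<phi> xb c K \<delta>1 \<sigma> v u"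
      using pen[OF \<sigma>(1)] by metis
    define \<tau> where "\<tau> = Min {\<tau>0, \<sigma>, \<delta>1}"
    have \<tau>: "\<tau> > 0" "\<tau> \<le> \<tau>0" "\<tau> \<le> \<sigma>" "\<tau> \<le> \<delta>1" using \<tau>0 \<sigma> \<delta>1 by (auto simp: \<tau>_def)
    have sol: "\<exists>x y a. M_loc \<phi> xb \<delta> v u = {x} \<and> multiplier_near \<phi> xb \<rho> x u v y \<and> \<phi> (x, u) = ereal a \<and>
        (\<forall>x' u'. norm (x' - xb) \<le> \<delta>1 \<and> norm u' \<le> \<delta>1 \<longrightarrow>
           ereal (a + v \<bullet> (x' - x) - (K + 1) * norm (u' - u)) \<le> \<phi> (x', u'))"
      if vu: "norm v < \<tau>" "norm u < \<tau>" for v u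
    proof -
      obtain x a where x: "norm (x - xb) < \<sigma>" "\<phi> (x, u) = ereal a" "a < c + \<sigma>"
        and min: "\<forall>x' u'. norm (x' - xb) \<le> \<delta>1 \<and> norm u' \<le> \<delta>1 \<longrightarrow>
           ereal (a + v \<bullet> (x' - x) - (K + 1) * norm (u' - u)) \<le> \<phi> (x', u')"
        using P vu \<tau>(2) unfolding exact_at_def by (meson order.strict_trans2)
      have "\<exists>y. (v, y) \<in> subgrad \<phi> (x, u)"
      proof (rule local_min_has_multiplier[OF cl pr x(2) _ _ _ _ _ _ K])
        show "norm (x - xb) < \<rho>b" "norm u < \<rho>b" "norm v < \<rho>b" "\<phi> (x, u) < \<phi> (xb, 0) + ereal \<rho>b"
          using x vu \<tau>(3) \<sigma>(4) by (auto simp: c)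
        show "\<delta> - norm (x - xb) > 0" using x(1) \<sigma>(2) by simp
        fix x' assume "x' \<in> cball x (\<delta> - norm (x - xb))"
        then have "norm (x' - xb) \<le> \<delta>1"
          using \<delta>(2) norm_triangle_ineq[of "x' - x" "x - xb"] by (simp add: dist_norm norm_minus_commute)
        moreover have "norm u \<le> \<delta>1" using vu \<tau>(4) by simp
        ultimately have "ereal (a + v \<bullet> (x' - x) - (K + 1) * norm (u - u)) \<le> \<phi> (x', u)" using min by blast
        then show "\<phi> (x, u) + ereal (v \<bullet> (x' - x)) \<le> \<phi> (x', u)" by (simp add: x(2))
      qed
      then obtain y where "(v, y) \<in> subgrad \<phi> (x, u)" ..
      then have near: "multiplier_near \<phi> xb \<rho> x u v y"
        using x vu \<tau>(3) \<sigma>(3) by (simp add: multiplier_near_def c)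
      have "M_loc \<phi> xb \<delta> v u = {x}"
        by (rule M_loc_singletonI[where a=a]) (use x \<sigma> \<delta> \<delta>1 strict[OF near x(2)] in auto)
      with near x(2) min show ?thesis by blast
    qed
    have "solvable_near \<phi> xb \<rho> (K + 1) \<delta> \<tau>"
      unfolding solvable_near_def
    proof (intro allI impI, elim conjE, rule conjI)
      fix v :: "real^'n" and u :: "real^'m" assume vu: "norm v < \<tau>" "norm u < \<tau>"
      show "\<exists>x y. M_loc \<phi> xb \<delta> v u = {x} \<and> multiplier_near \<phi> xb \<rho> x u v y" using sol[OF vu] by blast
      obtain x a where x: "M_loc \<phi> xb \<delta> v u = {x}" "\<phi> (x, u) = ereal a" and
        min: "\<forall>x' u'. norm (x' - xb) \<le> \<delta>1 \<and> norm u' \<le> \<delta>1 \<longrightarrow>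
           ereal (a + v \<bullet> (x' - x) - (K + 1) * norm (u' - u)) \<le> \<phi> (x', u')" using sol[OF vu] by blast
      show "\<forall>u'. norm u' < \<tau> \<longrightarrow>
        m_val \<phi> xb \<delta> v u \<le> m_val \<phi> xb \<delta> v u' + (K + 1) * norm (u' - u)"
      proof (intro allI impI)
        fix u' :: "real^'m" assume u': "norm u' < \<tau>"
        obtain x' where x': "M_loc \<phi> xb \<delta> v u' = {x'}" using sol[OF vu(1) u'] by blast
        note S = M_loc_singletonD[OF pr x(1)]
        note S' = M_loc_singletonD[OF pr x']
        have "norm (x' - xb) \<le> \<delta>1" "norm u' \<le> \<delta>1" using S'(1) \<delta>(2) u' \<tau>(4) by auto
        then have "ereal (a + v \<bullet> (x' - x) - (K + 1) * norm (u' - u)) \<le> \<phi> (x', u')" using min by blast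
        then show "m_val \<phi> xb \<delta> v u \<le> m_val \<phi> xb \<delta> v u' + (K + 1) * norm (u' - u)"
          using S(3) x(2) unfolding S'(3) by (simp add: inner_diff_right)
      qed
    qed
    then show "\<exists>\<tau>>0. solvable_near \<phi> xb \<rho> (K + 1) \<delta> \<tau>" using \<tau>(1) by blast
  qed
qed

lemma solvable_near_singleton:
  fixes \<phi> :: "(real^'n) \<times> (real^'m) \<Rightarrow> ereal"
  assumes "solvable_near \<phi> xb \<rho> K \<delta> \<tau>" "norm v < \<tau>" "norm u < \<tau>"
  obtains y where "M_loc \<phi> xb \<delta> v u = {M_sol \<phi> xb \<delta> v u}"
    "multiplier_near \<phi> xb \<rho> (M_sol \<phi> xb \<delta> v u) u v y"
proof -
  obtain x y where "M_loc \<phi> xb \<delta> v u = {x}" "multiplier_near \<phi> xb \<rho> x u v y"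
    using assms unfolding solvable_near_def by blast
  then show thesis using that by simp
qed

text \<open>The parameters are changed one at a time: v at fixed u by the supergradient inequality,
  with |x - xb| < \<delta> as the rate, then u at fixed v' by \<open>solvable_near\<close>.\<close>

lemma solvable_near_m_loc_le:
  fixes \<phi> :: "(real^'n) \<times> (real^'m) \<Rightarrow> ereal"
  assumes pr: "proper_fun \<phi>" and S: "solvable_near \<phi> xb \<rho> K \<delta> \<tau>"
    and n: "norm v < \<tau>" "norm u < \<tau>" "norm v' < \<tau>" "norm u' < \<tau>"
  shows "m_val \<phi> xb \<delta> v u
    \<le> m_val \<phi> xb \<delta> v' u' + (\<delta> * norm (v' - v) + K * norm (u' - u))"
proof -
  define x where "x = M_sol \<phi> xb \<delta> v' u"
  have x: "M_loc \<phi> xb \<delta> v' u = {x}" unfolding x_def by (rule solvable_near_singleton[OF S n(3,2)])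
  have "is_singleton (M_loc \<phi> xb \<delta> v u)"
    by (rule solvable_near_singleton[OF S n(1,2)]) (metis is_singletonI)
  from m_loc_supergradient[OF pr x this]
  have "m_val \<phi> xb \<delta> v u \<le> m_val \<phi> xb \<delta> v' u + (v' - v) \<bullet> (x - xb)"
    by (simp add: inner_diff_left)
  moreover have "(v' - v) \<bullet> (x - xb) \<le> norm (v' - v) * \<delta>"
    using norm_cauchy_schwarz[of "v' - v" "x - xb"] M_loc_singletonD(1)[OF pr x]
      mult_left_mono[of "norm (x - xb)" \<delta> "norm (v' - v)"] by simp
  moreover have "m_val \<phi> xb \<delta> v' u \<le> m_val \<phi> xb \<delta> v' u' + K * norm (u' - u)"
    using S n unfolding solvable_near_def by blast
  ultimately show ?thesis by (simp add: mult.commute)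
qed

text \<open>Growth between the solutions for two parameters, with \<phi> eliminated in favor of m.
  Continuity of M, its Lipschitz dependence on v, and hypo-convexity of m are all read off from
  it.\<close>

lemma solvable_near_growth:
  fixes \<phi> :: "(real^'n) \<times> (real^'m) \<Rightarrow> ereal"
  assumes pr: "proper_fun \<phi>" and growth: "local_growth \<phi> xb UNIV \<rho> s e" and \<delta>: "\<delta> \<le> \<rho>"
    and x: "M_loc \<phi> xb \<delta> v u = {x}" "multiplier_near \<phi> xb \<rho> x u v y"
    and x': "M_loc \<phi> xb \<delta> v' u' = {x'}" and u': "norm u' < \<rho>"
  shows "m_val \<phi> xb \<delta> v u + (y \<bullet> (u' - u) + s / 2 * (norm (x' - x))\<^sup>2 - e / 2 * (norm (u' - u))\<^sup>2)
    \<le> m_val \<phi> xb \<delta> v' u' + (v' - v) \<bullet> (x' - xb)"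
proof -
  note S = M_loc_singletonD[OF pr x(1)]
  note S' = M_loc_singletonD[OF pr x']
  have "norm (x' - xb) < \<rho>" using S'(1) \<delta> by simp
  from local_growthD[OF growth x(2) UNIV_I this u'] show ?thesis
    unfolding S(3) S'(3) by (simp add: inner_simps)
qed

lemma solvable_near_continuous_m_loc:
  fixes \<phi> :: "(real^'n) \<times> (real^'m) \<Rightarrow> ereal"
  assumes pr: "proper_fun \<phi>" and S: "solvable_near \<phi> xb \<rho> K \<delta> \<tau>" and K: "K \<ge> 0" and \<delta>: "\<delta> \<ge> 0"
  shows "continuous_on (ball 0 \<tau> \<times> ball 0 \<tau>) (\<lambda>(v, u). m_val \<phi> xb \<delta> v u)"
proof (rule lipschitz_on_continuous_on, rule lipschitz_onI)
  fix z z' :: "(real^'n) \<times> (real^'m)" assume "z \<in> ball 0 \<tau> \<times> ball 0 \<tau>" "z' \<in> ball 0 \<tau> \<times> ball 0 \<tau>"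
  then obtain v u v' u' where z: "z = (v, u)" "z' = (v', u')" and n: "norm v < \<tau>" "norm u < \<tau>" "norm v' < \<tau>" "norm u' < \<tau>"
    by auto
  have "\<bar>m_val \<phi> xb \<delta> v u - m_val \<phi> xb \<delta> v' u'\<bar> \<le> \<delta> * norm (v - v') + K * norm (u - u')"
    using solvable_near_m_loc_le[OF pr S n] solvable_near_m_loc_le[OF pr S n(3,4,1,2)]
    by (simp add: norm_minus_commute abs_le_iff)
  also have "\<dots> \<le> \<delta> * dist z z' + K * dist z z'"
    using K \<delta> dist_fst_le[of z z'] dist_snd_le[of z z']
    by (intro add_mono mult_left_mono) (auto simp: z dist_norm)
  finally show "dist (case z of (v, u) \<Rightarrow> m_val \<phi> xb \<delta> v u) (case z' of (v, u) \<Rightarrow> m_val \<phi> xb \<delta> v u)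
      \<le> (\<delta> + K) * dist z z'"
    by (simp add: z dist_real_def algebra_simps)
qed (use K \<delta> in simp)

text \<open>Growth bounds the square of |M z' - M z| by R z', which vanishes at z by continuity of
  m. Since R contains terms of first order in u' - u, the bound gives only a square-root modulus in
  u.\<close>

lemma solvable_near_continuous_M_loc:
  fixes \<phi> :: "(real^'n) \<times> (real^'m) \<Rightarrow> ereal"
  assumes pr: "proper_fun \<phi>" and S: "solvable_near \<phi> xb \<rho> K \<delta> \<tau>" and K: "K \<ge> 0" and \<delta>: "\<delta> \<ge> 0" "\<delta> \<le> \<rho>"
    and growth: "local_growth \<phi> xb UNIV \<rho> s e" and s: "s > 0"
  shows "continuous_on (ball 0 \<tau> \<times> ball 0 \<tau>) (\<lambda>(v, u). M_sol \<phi> xb \<delta> v u)"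
  unfolding continuous_on_def
proof
  define M where "M z = (case z of (v, u) \<Rightarrow> M_sol \<phi> xb \<delta> v u)" for z
  define m where "m z = (case z of (v, u) \<Rightarrow> m_val \<phi> xb \<delta> v u)" for z
  define B where "B = (ball 0 \<tau> :: (real^'n) set) \<times> (ball 0 \<tau> :: (real^'m) set)"
  fix z :: "(real^'n) \<times> (real^'m)" assume z: "z \<in> ball 0 \<tau> \<times> ball 0 \<tau>"
  then obtain v u where vu: "z = (v, u)" "norm v < \<tau>" "norm u < \<tau>" by auto
  obtain y where y: "M_loc \<phi> xb \<delta> v u = {M z}" "multiplier_near \<phi> xb \<rho> (M z) u v y"
    using solvable_near_singleton[OF S vu(2,3)] unfolding M_def vu(1) by auto
  define R where "R z' = 2 / s * ((m z' - m z) + norm (fst z' - v) * \<delta> + norm y * norm (snd z' - u) + e / 2 * (norm (snd z' - u))\<^sup>2)" for z'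
  have bound: "(norm (M z' - M z))\<^sup>2 \<le> R z'" if "z' \<in> B" for z'
  proof -
    obtain v' u' where z': "z' = (v', u')" "norm v' < \<tau>" "norm u' < \<tau>" using \<open>z' \<in> B\<close> by (auto simp: B_def)
    obtain y' where y': "M_loc \<phi> xb \<delta> v' u' = {M z'}" "multiplier_near \<phi> xb \<rho> (M z') u' v' y'"
      using solvable_near_singleton[OF S z'(2,3)] unfolding M_def z'(1) by auto
    have "norm u' < \<rho>" using y'(2) by (simp add: multiplier_near_def)
    from solvable_near_growth[OF pr growth \<delta>(2) y y'(1) this]
    have "m z + (y \<bullet> (u' - u) + s / 2 * (norm (M z' - M z))\<^sup>2 - e / 2 * (norm (u' - u))\<^sup>2) \<le> m z' + (v' - v) \<bullet> (M z' - xb)"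
      by (simp add: m_def vu(1) z'(1))
    moreover have "(v' - v) \<bullet> (M z' - xb) \<le> norm (v' - v) * \<delta>"
      using norm_cauchy_schwarz[of "v' - v" "M z' - xb"] M_loc_singletonD(1)[OF pr y'(1)]
        mult_left_mono[of "norm (M z' - xb)" \<delta> "norm (v' - v)"] by simp
    moreover have "- (y \<bullet> (u' - u)) \<le> norm y * norm (u' - u)"
      using Cauchy_Schwarz_ineq2[of y "u' - u"] by linarith
    ultimately have "s / 2 * (norm (M z' - M z))\<^sup>2
        \<le> (m z' - m z) + norm (v' - v) * \<delta> + norm y * norm (u' - u) + e / 2 * (norm (u' - u))\<^sup>2" by linarith
    then show ?thesis unfolding R_def z'(1) fst_conv snd_conv using s by (simp add: field_simps)
  qed
  have "continuous_on B m"
    using solvable_near_continuous_m_loc[OF pr S K \<delta>(1)] unfolding m_def B_def by (simp add: case_prod_unfold)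
  then have mlim: "(m \<longlongrightarrow> m z) (at z within B)" using z by (auto simp: continuous_on_def B_def)
  have "(R \<longlongrightarrow> 2 / s * ((m z - m z) + norm (fst z - v) * \<delta> + norm y * norm (snd z - u) + e / 2 * (norm (snd z - u))\<^sup>2)) (at z within B)"
    unfolding R_def by (intro tendsto_intros mlim)
  then have "(R \<longlongrightarrow> 0) (at z within B)" by (simp add: vu(1))
  then have "((\<lambda>z'. (norm (M z' - M z))\<^sup>2) \<longlongrightarrow> 0) (at z within B)"
    by (rule tendsto_sandwich[OF _ _ tendsto_const, rotated 2])
      (auto simp: eventually_at_filter intro!: always_eventually bound)
  then have "((\<lambda>z'. sqrt ((norm (M z' - M z))\<^sup>2)) \<longlongrightarrow> sqrt 0) (at z within B)" by (rule tendsto_real_sqrt)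
  then have "((\<lambda>z'. norm (M z' - M z)) \<longlongrightarrow> 0) (at z within B)" by simp
  then have "(M \<longlongrightarrow> M z) (at z within B)" by (metis LIM_zero_cancel tendsto_norm_zero_cancel)
  then show "((\<lambda>(v, u). M_sol \<phi> xb \<delta> v u) \<longlongrightarrow> (case z of (v, u) \<Rightarrow> M_sol \<phi> xb \<delta> v u))
      (at z within ball 0 \<tau> \<times> ball 0 \<tau>)"
    unfolding M_def B_def by (simp add: case_prod_unfold)
qed

text \<open>At fixed u the multiplier terms vanish and the values of m cancel when the growth
  inequalities at v and v' are added. What remains is strong monotonicity: s |x' - x|^2 \<le> (v' -
  v) \<bullet> (x' - x).\<close>

lemma solvable_near_lipschitz_M_loc:
  fixes \<phi> :: "(real^'n) \<times> (real^'m) \<Rightarrow> ereal"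
  assumes pr: "proper_fun \<phi>" and S: "solvable_near \<phi> xb \<rho> K \<delta> \<tau>" and \<delta>: "\<delta> \<le> \<rho>"
    and growth: "local_growth \<phi> xb UNIV \<rho> s e" and s: "s > 0" and u: "norm u < \<tau>"
  shows "(1 / s)-lipschitz_on (ball 0 \<tau>) (\<lambda>v. M_sol \<phi> xb \<delta> v u)"
proof (rule lipschitz_onI)
  fix v v' :: "real^'n" assume "v \<in> ball 0 \<tau>" "v' \<in> ball 0 \<tau>"
  then have n: "norm v < \<tau>" "norm v' < \<tau>" by auto
  define x where "x = M_sol \<phi> xb \<delta> v u"
  define x' where "x' = M_sol \<phi> xb \<delta> v' u"
  obtain y where y: "M_loc \<phi> xb \<delta> v u = {x}" "multiplier_near \<phi> xb \<rho> x u v y"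
    using solvable_near_singleton[OF S n(1) u] unfolding x_def by metis
  obtain y' where y': "M_loc \<phi> xb \<delta> v' u = {x'}" "multiplier_near \<phi> xb \<rho> x' u v' y'"
    using solvable_near_singleton[OF S n(2) u] unfolding x'_def by metis
  have "norm u < \<rho>" using y(2) by (simp add: multiplier_near_def)
  from solvable_near_growth[OF pr growth \<delta> y y'(1) this] solvable_near_growth[OF pr growth \<delta> y' y(1) this]
  have "s * (norm (x' - x))\<^sup>2 \<le> (v' - v) \<bullet> (x' - xb) + (v - v') \<bullet> (x - xb)"
    by (simp add: norm_minus_commute)
  also have "\<dots> = (v' - v) \<bullet> (x' - x)" by (simp add: inner_simps)
  also have "\<dots> \<le> norm (v' - v) * norm (x' - x)" by (rule norm_cauchy_schwarz)
  finally have "(s * norm (x' - x)) * norm (x' - x) \<le> norm (v' - v) * norm (x' - x)"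
    by (simp add: power2_eq_square mult_ac)
  then have "s * norm (x' - x) \<le> norm (v' - v)"
    by (cases "x' = x") (auto simp: mult_le_cancel_right)
  then show "dist (M_sol \<phi> xb \<delta> v u) (M_sol \<phi> xb \<delta> v' u) \<le> 1 / s * dist v v'"
    using s unfolding x_def[symmetric] x'_def[symmetric]
    by (simp add: dist_norm norm_minus_commute field_simps)
qed (use s in simp)

lemma solvable_near_imp_full_substability:
  fixes \<phi> :: "(real^'n) \<times> (real^'m) \<Rightarrow> ereal"
  assumes pr: "proper_fun \<phi>" and growth: "local_growth \<phi> xb UNIV \<rho> s e" and s: "s > 0" and K: "K \<ge> 0"
    and \<delta>1: "\<delta>1 > 0" "\<delta>1 < \<rho>"
    and sol: "\<And>\<delta>. 0 < \<delta> \<Longrightarrow> \<delta> \<le> \<delta>1 \<Longrightarrow> M_loc \<phi> xb \<delta> 0 0 = {xb} \<and> (\<exists>\<tau>>0. solvable_near \<phi> xb \<rho> K \<delta> \<tau>)"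
  shows "full_substability \<phi> xb"
  unfolding full_substability_def
proof (rule exI[of _ \<delta>1], intro conjI \<delta>1(1) allI impI)
  fix \<delta> assume d: "0 < \<delta> \<and> \<delta> < \<delta>1"
  then have \<delta>: "0 < \<delta>" "\<delta> \<le> \<delta>1" "\<delta> \<le> \<rho>" "0 \<le> \<delta>" using \<delta>1 by auto
  show "M_loc \<phi> xb \<delta> 0 0 = {xb}" using sol[OF \<delta>(1,2)] by simp
  obtain \<tau> where \<tau>: "\<tau> > 0" and S: "solvable_near \<phi> xb \<rho> K \<delta> \<tau>" using sol[OF \<delta>(1,2)] by blast
  have sing: "is_singleton (M_loc \<phi> xb \<delta> v u)" if "v \<in> ball 0 \<tau>" "u \<in> ball 0 \<tau>" for v u
    by (rule solvable_near_singleton[OF S, of v u]) (use that is_singletonI in \<open>auto, metis is_singletonI\<close>)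
  have lipM: "\<forall>u\<in>ball 0 \<tau>. (1 / s)-lipschitz_on (ball 0 \<tau>) (\<lambda>v. M_sol \<phi> xb \<delta> v u)"
    using solvable_near_lipschitz_M_loc[OF pr S \<delta>(3) growth s] by simp
  have lipm: "\<forall>u\<in>ball 0 \<tau>. \<delta>-lipschitz_on (ball 0 \<tau>) (\<lambda>v. m_val \<phi> xb \<delta> v u)"
  proof (intro ballI lipschitz_onI \<delta>)
    fix u :: "real^'m" and v v' :: "real^'n" assume "u \<in> ball 0 \<tau>" "v \<in> ball 0 \<tau>" "v' \<in> ball 0 \<tau>"
    then have n: "norm v < \<tau>" "norm u < \<tau>" "norm v' < \<tau>" by auto
    show "dist (m_val \<phi> xb \<delta> v u) (m_val \<phi> xb \<delta> v' u) \<le> \<delta> * dist v v'"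
      using solvable_near_m_loc_le[OF pr S n n(2)] solvable_near_m_loc_le[OF pr S n(3,2,1,2)]
      by (simp add: dist_norm norm_minus_commute abs_le_iff)
  qed
  show "\<exists>V U. open V \<and> 0 \<in> V \<and> open U \<and> 0 \<in> U \<and>
        (\<forall>v\<in>V. \<forall>u\<in>U. is_singleton (M_loc \<phi> xb \<delta> v u)) \<and>
        continuous_on (V \<times> U) (\<lambda>(v, u). M_sol \<phi> xb \<delta> v u) \<and>
        continuous_on (V \<times> U) (\<lambda>(v, u). m_val \<phi> xb \<delta> v u) \<and>
        (\<exists>L. \<forall>u\<in>U. L-lipschitz_on V (\<lambda>v. M_sol \<phi> xb \<delta> v u)) \<and>
        (\<exists>L. \<forall>u\<in>U. L-lipschitz_on V (\<lambda>v. m_val \<phi> xb \<delta> v u))"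
  proof (rule exI[of _ "ball 0 \<tau>"], rule exI[of _ "ball 0 \<tau>"], intro conjI)
    show "\<forall>v\<in>ball 0 \<tau>. \<forall>u\<in>ball 0 \<tau>. is_singleton (M_loc \<phi> xb \<delta> v u)" using sing by blast
    show "\<exists>L. \<forall>u\<in>ball 0 \<tau>. L-lipschitz_on (ball 0 \<tau>) (\<lambda>v. M_sol \<phi> xb \<delta> v u)" using lipM by blast
    show "\<exists>L. \<forall>u\<in>ball 0 \<tau>. L-lipschitz_on (ball 0 \<tau>) (\<lambda>v. m_val \<phi> xb \<delta> v u)" using lipm by blast
  qed (use \<tau> solvable_near_continuous_m_loc[OF pr S K \<delta>(4)]
      solvable_near_continuous_M_loc[OF pr S K \<delta>(4,3) growth s] in auto)
qed


subsection \<open>Hypo-convexity and the theorem\<close>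

text \<open>Since \<phi>(x', u') \<ge> m(v, u') + v \<bullet> (x' - xb) with equality at the
  solution, a first-order lower estimate of m at u lifts to \<phi> at (x, u), with v as the
  component in x.\<close>

lemma regular_subgrad_m_loc:
  fixes \<phi> :: "(real^'n) \<times> (real^'m) \<Rightarrow> ereal"
  assumes pr: "proper_fun \<phi>" and U: "open U" "u \<in> U"
    and sing: "\<And>u. u \<in> U \<Longrightarrow> is_singleton (M_loc \<phi> xb \<delta> v u)"
    and x: "M_loc \<phi> xb \<delta> v u = {x}" and y: "y \<in> regular_subgrad (m_loc \<phi> xb \<delta> v) u"
  shows "(v, y) \<in> regular_subgrad \<phi> (x, u)"
  unfolding regular_subgrad_def
proof (intro CollectI conjI allI impI)
  define m where "m u = m_val \<phi> xb \<delta> v u" for u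
  note S = M_loc_singletonD[OF pr x, folded m_def]
  show "\<bar>\<phi> (x, u)\<bar> \<noteq> \<infinity>" by (simp add: S(3))
  fix r :: real assume r: "r > 0"
  have m: "\<forall>\<^sub>F u' in nhds u. m_loc \<phi> xb \<delta> v u + ereal (y \<bullet> (u' - u) - r * norm (u' - u)) \<le> m_loc \<phi> xb \<delta> v u'"
    using y r unfolding regular_subgrad_def by blast
  have "(snd \<longlongrightarrow> u) (nhds (x, u))"
    using tendsto_snd[OF filterlim_ident, of "(x, u)"] by simp
  then have e1: "\<forall>\<^sub>F z in nhds (x, u). m_loc \<phi> xb \<delta> v u + ereal (y \<bullet> (snd z - u) - r * norm (snd z - u))
      \<le> m_loc \<phi> xb \<delta> v (snd z)"
    using m unfolding filterlim_iff by blast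
  have "(x, u) \<in> ball xb \<delta> \<times> U" using S(1) U by (simp add: dist_norm norm_minus_commute)
  then have "\<forall>\<^sub>F z in nhds (x, u). z \<in> ball xb \<delta> \<times> U"
    by (intro eventually_nhds_in_open open_Times U) auto
  with e1 show "\<forall>\<^sub>F z in nhds (x, u). \<phi> (x, u) + ereal ((v, y) \<bullet> (z - (x, u)) - r * norm (z - (x, u))) \<le> \<phi> z"
  proof eventually_elim
    case (elim z)
    obtain x' u' where z: "z = (x', u')" by (metis surj_pair)
    have x': "norm (x' - xb) < \<delta>" and "u' \<in> U" using elim(2) by (auto simp: z dist_norm norm_minus_commute)
    note S' = M_loc_singletonD[OF pr M_loc_the_elem[OF sing[OF \<open>u' \<in> U\<close>]], folded m_def]
    have "m u + (y \<bullet> (u' - u) - r * norm (u' - u)) \<le> m u'"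
      using elim(1) unfolding z snd_conv S(2) S'(2) by simp
    moreover have "r * norm (u' - u) \<le> r * norm (z - (x, u))"
      using r dist_snd_le[of z "(x, u)"] by (intro mult_left_mono) (auto simp: z dist_norm)
    ultimately have "ereal (m u + v \<bullet> (x - xb) + ((v, y) \<bullet> (z - (x, u)) - r * norm (z - (x, u))))
        \<le> ereal (m u' + v \<bullet> (x' - xb))"
      by (simp add: z inner_diff_right)
    also have "\<dots> \<le> \<phi> z" unfolding z by (rule S'(4)[OF x'])
    finally show ?case by (simp add: S(3))
  qed
qed

text \<open>A multiplier y at M(v, u) supports m(v, .) at u up to - e/2 |u' - u|^2. Such a support
  at every point gives hypo-convexity and also makes y a regular subgradient. Conversely, regular
  subgradients of m lift to \<phi> by \<open>regular_subgrad_m_loc\<close>, and continuity of M and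
  m lets their limits lift too.\<close>

lemma solvable_near_hypo_convex:
  fixes \<phi> :: "(real^'n) \<times> (real^'m) \<Rightarrow> ereal"
  assumes pr: "proper_fun \<phi>" and S: "solvable_near \<phi> xb \<rho> K \<delta> \<tau>" and K: "K \<ge> 0" and \<delta>: "\<delta> \<ge> 0" "\<delta> \<le> \<rho>"
    and growth: "local_growth \<phi> xb UNIV \<rho> s e" and s: "s > 0" and e: "e \<ge> 0"
  shows "hypo_convex_property \<phi> xb \<delta> (ball 0 \<tau>) (ball 0 \<tau>)"
proof -
  define M where "M v u = M_sol \<phi> xb \<delta> v u" for v u
  define m where "m v u = m_val \<phi> xb \<delta> v u" for v u
  have sing: "M_loc \<phi> xb \<delta> v u = {M v u}" if "norm v < \<tau>" "norm u < \<tau>" for v u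
    unfolding M_def by (rule solvable_near_singleton[OF S that])
  have mE: "m_loc \<phi> xb \<delta> v u = ereal (m v u)" if "norm v < \<tau>" "norm u < \<tau>" for v u
    unfolding m_def by (rule M_loc_singletonD(2)[OF pr sing[OF that]])
  have near_ex: "\<exists>y. multiplier_near \<phi> xb \<rho> (M v u) u v y" if "norm v < \<tau>" "norm u < \<tau>" for v u
    using solvable_near_singleton[OF S that] unfolding M_def by metis
  have lower: "m v u + y \<bullet> (u' - u) - e / 2 * (norm (u' - u))\<^sup>2 \<le> m v u'"
    if n: "norm v < \<tau>" "norm u < \<tau>" "norm u' < \<tau>" and near: "multiplier_near \<phi> xb \<rho> (M v u) u v y" for v u u' y
  proof -
    have "norm u' < \<rho>" using near_ex[OF n(1,3)] by (auto simp: multiplier_near_def)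
    from solvable_near_growth[OF pr growth \<delta>(2) sing[OF n(1,2)] near sing[OF n(1,3)] this]
    have "m v u + (y \<bullet> (u' - u) + s / 2 * (norm (M v u' - M v u))\<^sup>2 - e / 2 * (norm (u' - u))\<^sup>2) \<le> m v u'"
      by (simp add: m_def)
    moreover have "s / 2 * (norm (M v u' - M v u))\<^sup>2 \<ge> 0" using s by simp
    ultimately show ?thesis by linarith
  qed
  show ?thesis
    unfolding hypo_convex_property_def
  proof (intro conjI exI[of _ e] e ballI)
    fix v :: "real^'n" assume "v \<in> ball 0 \<tau>"
    then have v: "norm v < \<tau>" by simp
    show "econvex_on (ball 0 \<tau>) (\<lambda>u. m_loc \<phi> xb \<delta> v u + ereal (e / 2 * (norm u)\<^sup>2))"
      unfolding econvex_on_def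
    proof (intro conjI convex_ball ballI allI impI)
      fix a b :: "real^'m" and t :: real assume ab: "a \<in> ball 0 \<tau>" "b \<in> ball 0 \<tau>" and t: "0 < t \<and> t < 1"
      \<comment> \<open>Averaging the supports at p, evaluated at a and b with weights 1 - t and t,
        cancels the linear terms; the squares combine into those of the convexity
        inequality.\<close>
      define p where "p = (1 - t) *\<^sub>R a + t *\<^sub>R b"
      have "p \<in> ball 0 \<tau>" unfolding p_def by (rule convexD_alt[OF convex_ball ab]) (use t in auto)
      then have n: "norm a < \<tau>" "norm b < \<tau>" "norm p < \<tau>" using ab by auto
      obtain y where y: "multiplier_near \<phi> xb \<rho> (M v p) p v y" using near_ex[OF v n(3)] by blast
      have "(1 - t) * (m v p + y \<bullet> (a - p) - e / 2 * (norm (a - p))\<^sup>2) \<le> (1 - t) * m v a"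
        "t * (m v p + y \<bullet> (b - p) - e / 2 * (norm (b - p))\<^sup>2) \<le> t * m v b"
        using lower[OF v n(3,1) y] lower[OF v n(3,2) y] t by (auto intro!: mult_left_mono)
      moreover have "(1 - t) * (m v p + y \<bullet> (a - p) - e / 2 * (norm (a - p))\<^sup>2) + t * (m v p + y \<bullet> (b - p) - e / 2 * (norm (b - p))\<^sup>2)
          = m v p + e / 2 * (norm p)\<^sup>2 - ((1 - t) * (e / 2 * (norm a)\<^sup>2) + t * (e / 2 * (norm b)\<^sup>2))"
        unfolding p_def power2_norm_eq_inner
        by (simp add: inner_simps inner_commute) (simp add: field_simps inner_commute)
      ultimately have "m v p + e / 2 * (norm p)\<^sup>2 \<le> (1 - t) * (m v a + e / 2 * (norm a)\<^sup>2) + t * (m v b + e / 2 * (norm b)\<^sup>2)"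
        by (simp add: algebra_simps)
      then show "m_loc \<phi> xb \<delta> v p + ereal (e / 2 * (norm p)\<^sup>2) \<le> ereal (1 - t) * (m_loc \<phi> xb \<delta> v a + ereal (e / 2 * (norm a)\<^sup>2))
          + ereal t * (m_loc \<phi> xb \<delta> v b + ereal (e / 2 * (norm b)\<^sup>2))"
        by (simp add: mE[OF v n(1)] mE[OF v n(2)] mE[OF v n(3)])
    qed
  next
    fix v :: "real^'n" and u :: "real^'m" assume "v \<in> ball 0 \<tau>" "u \<in> ball 0 \<tau>"
    then have v: "norm v < \<tau>" and u: "norm u < \<tau>" by auto
    have "y \<in> subgrad (m_loc \<phi> xb \<delta> v) u" if "(v, y) \<in> subgrad \<phi> (M v u, u)" for y
    proof (rule subsetD[OF regular_subset_subgrad])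
      \<comment> \<open>\<open>multiplier_near\<close> puts no bound on y, so its remaining
        conditions are inherited from the multiplier known to exist at M(v, u).\<close>
      have near: "multiplier_near \<phi> xb \<rho> (M v u) u v y"
        using near_ex[OF v u] that by (auto simp: multiplier_near_def)
      show "y \<in> regular_subgrad (m_loc \<phi> xb \<delta> v) u"
        unfolding regular_subgrad_def
      proof (intro CollectI conjI allI impI)
        show "\<bar>m_loc \<phi> xb \<delta> v u\<bar> \<noteq> \<infinity>" by (simp add: mE[OF v u])
        fix r :: real assume r: "r > 0"
        have "\<forall>\<^sub>F u' in nhds u. u' \<in> ball 0 \<tau>" by (rule eventually_nhds_in_open) (use u in auto)
        \<comment> \<open>Within this radius e/2 |u' - u|^2 is at most r |u' - u|.\<close>
        moreover have "\<forall>\<^sub>F u' in nhds u. u' \<in> ball u (2 * r / (e + 1))"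
          by (rule eventually_nhds_in_open) (use r e in auto)
        ultimately show "\<forall>\<^sub>F u' in nhds u. m_loc \<phi> xb \<delta> v u + ereal (y \<bullet> (u' - u) - r * norm (u' - u)) \<le> m_loc \<phi> xb \<delta> v u'"
        proof eventually_elim
          case (elim u')
          then have n: "norm u' < \<tau>" "norm (u' - u) < 2 * r / (e + 1)" by (auto simp: dist_norm norm_minus_commute)
          then have "(e + 1) * norm (u' - u) < 2 * r" using e by (simp add: pos_less_divide_eq mult.commute)
          then have "e * norm (u' - u) + norm (u' - u) < 2 * r" by (simp add: distrib_right)
          then have "e * norm (u' - u) \<le> 2 * r" using norm_ge_zero[of "u' - u"] by linarith
          then have "e / 2 * norm (u' - u) \<le> r" by simp
          then have "(e / 2 * norm (u' - u)) * norm (u' - u) \<le> r * norm (u' - u)" by (rule mult_right_mono) simp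
          then show ?case
            using lower[OF v u n(1) near] by (simp add: mE[OF v u] mE[OF v n(1)] power2_eq_square mult.assoc)
        qed
      qed
    qed
    moreover have "(v, y) \<in> subgrad \<phi> (M v u, u)" if y: "y \<in> subgrad (m_loc \<phi> xb \<delta> v) u" for y
    proof -
      obtain X W where X: "X \<longlonglongrightarrow> u" "(\<lambda>k. m_loc \<phi> xb \<delta> v (X k)) \<longlonglongrightarrow> m_loc \<phi> xb \<delta> v u"
        "\<forall>k::nat. W k \<in> regular_subgrad (m_loc \<phi> xb \<delta> v) (X k)" "W \<longlonglongrightarrow> y"
        using y by (rule subgradE)
      have "\<forall>\<^sub>F k in sequentially. norm (X k) < \<tau>"
        by (rule order_tendstoD(2)[OF tendsto_norm[OF X(1)] u])
      then obtain N where N: "\<And>k. k \<ge> N \<Longrightarrow> norm (X k) < \<tau>" unfolding eventually_sequentially by blast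
      define X' where "X' k = X (k + N)" for k
      have X'n: "norm (X' k) < \<tau>" for k using N by (simp add: X'_def)
      have X': "X' \<longlonglongrightarrow> u" unfolding X'_def using X(1) by (rule LIMSEQ_ignore_initial_segment)
      have W': "(\<lambda>k. W (k + N)) \<longlonglongrightarrow> y" using X(4) by (rule LIMSEQ_ignore_initial_segment)
      have pair: "(\<lambda>k. (v, X' k)) \<longlonglongrightarrow> (v, u)" by (intro tendsto_intros X')
      have inB: "(v, u) \<in> ball 0 \<tau> \<times> ball 0 \<tau>" "(v, X' k) \<in> ball 0 \<tau> \<times> ball 0 \<tau>" for k
        using v u X'n by auto
      have Ml: "(\<lambda>k. M v (X' k)) \<longlonglongrightarrow> M v u"
        using continuous_on_tendsto_compose[OF solvable_near_continuous_M_loc[OF pr S K \<delta> growth s] pair inB(1)] inB(2)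
        by (simp add: M_def)
      have ml: "(\<lambda>k. m v (X' k)) \<longlonglongrightarrow> m v u"
        using continuous_on_tendsto_compose[OF solvable_near_continuous_m_loc[OF pr S K \<delta>(1)] pair inB(1)] inB(2)
        by (simp add: m_def)
      have \<phi>M: "\<phi> (M v w, w) = ereal (m v w + v \<bullet> (M v w - xb))" if "norm w < \<tau>" for w
        unfolding m_def by (rule M_loc_singletonD(3)[OF pr sing[OF v that]])
      show ?thesis
      proof (rule subgrad_closed)
        show "(v, W (k + N)) \<in> subgrad \<phi> (M v (X' k), X' k)" for k
        proof (rule subsetD[OF regular_subset_subgrad], rule regular_subgrad_m_loc[OF pr open_ball _ _ sing[OF v X'n]])
          show "X' k \<in> ball 0 \<tau>" using X'n by simp
          show "is_singleton (M_loc \<phi> xb \<delta> v w)" if "w \<in> ball 0 \<tau>" for w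
            using sing[OF v, of w] that by simp
          show "W (k + N) \<in> regular_subgrad (m_loc \<phi> xb \<delta> v) (X' k)" using X(3) by (simp add: X'_def)
        qed
        show "(\<lambda>k. (M v (X' k), X' k)) \<longlonglongrightarrow> (M v u, u)" by (intro tendsto_intros Ml X')
        have "(\<lambda>k. m v (X' k) + v \<bullet> (M v (X' k) - xb)) \<longlonglongrightarrow> m v u + v \<bullet> (M v u - xb)"
          by (intro tendsto_intros ml Ml)
        then show "(\<lambda>k. \<phi> (M v (X' k), X' k)) \<longlonglongrightarrow> \<phi> (M v u, u)" by (simp add: \<phi>M[OF X'n] \<phi>M[OF u])
        show "\<bar>\<phi> (M v u, u)\<bar> \<noteq> \<infinity>" by (simp add: \<phi>M[OF u])
        show "(\<lambda>k. (v, W (k + N))) \<longlonglongrightarrow> (v, y)" by (intro tendsto_intros W')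
      qed
    qed
    ultimately show "subgrad (\<lambda>u'. m_loc \<phi> xb \<delta> v u') u = Y_mult \<phi> (M_sol \<phi> xb \<delta> v u) u v"
      unfolding Y_mult_def M_def[symmetric] by blast
  qed
qed

lemma hypo_convex_property_subset:
  assumes h: "hypo_convex_property \<phi> xb \<delta> V U" and sub: "V' \<subseteq> V" "U' \<subseteq> U" "convex U'"
  shows "hypo_convex_property \<phi> xb \<delta> V' U'"
proof -
  from h obtain e where e: "e \<ge> 0" "\<And>v. v \<in> V \<Longrightarrow> econvex_on U (\<lambda>u. m_loc \<phi> xb \<delta> v u + ereal (e / 2 * (norm u)\<^sup>2))"
    and Y: "\<And>v u. v \<in> V \<Longrightarrow> u \<in> U \<Longrightarrow> subgrad (\<lambda>u'. m_loc \<phi> xb \<delta> v u') u = Y_mult \<phi> (M_sol \<phi> xb \<delta> v u) u v"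
    unfolding hypo_convex_property_def by blast
  have mono: "econvex_on U' f" if "econvex_on U f" for f
    using that sub(2,3) unfolding econvex_on_def by blast
  have "\<forall>v\<in>V'. econvex_on U' (\<lambda>u. m_loc \<phi> xb \<delta> v u + ereal (e / 2 * (norm u)\<^sup>2))"
    using e(2) mono sub(1) by blast
  moreover have "\<forall>v\<in>V'. \<forall>u\<in>U'. subgrad (\<lambda>u'. m_loc \<phi> xb \<delta> v u') u = Y_mult \<phi> (M_sol \<phi> xb \<delta> v u) u v"
    using Y sub by blast
  ultimately show ?thesis unfolding hypo_convex_property_def using e(1) by blast
qed

lemma localized_solution_property_subset:
  assumes "localized_solution_property \<phi> xb \<delta> \<alpha> V U" "V' \<subseteq> V" "U' \<subseteq> U"
  shows "localized_solution_property \<phi> xb \<delta> \<alpha> V' U'"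
  using assms unfolding localized_solution_property_def by (meson continuous_on_subset subsetD)

theorem theorem1p1:
  fixes \<phi> :: "(real^'n) \<times> (real^'m) \<Rightarrow> ereal" and xb :: "real^'n"
  assumes "closed_fun \<phi>" and "proper_fun \<phi>"
    and "\<forall>\<^sub>F x in nhds xb. \<phi> (xb, 0) \<le> \<phi> (x, 0)"
    and "\<bar>\<phi> (xb, 0)\<bar> \<noteq> \<infinity>"
    and "\<forall>y. (0, y) \<in> horizon_subgrad \<phi> (xb, 0) \<longrightarrow> y = 0"
  shows
    "(full_stability \<phi> xb \<and> full_multiplier_prox_regularity \<phi> xb
        \<longrightarrow> strong_variational_sufficiency \<phi> xb) \<and>
     (strong_variational_sufficiency \<phi> xb
        \<longrightarrow> full_substability \<phi> xb \<and> full_multiplier_prox_regularity \<phi> xb) \<and>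
     (full_substability \<phi> xb \<and> full_multiplier_prox_regularity \<phi> xb \<longrightarrow>
        (\<exists>\<delta>0>0. \<exists>\<alpha>0. \<phi> (xb, 0) < ereal \<alpha>0 \<and>
           (\<forall>\<delta>. 0 < \<delta> \<and> \<delta> < \<delta>0 \<longrightarrow> m_loc \<phi> xb \<delta> 0 0 = \<phi> (xb, 0) \<and>
              (\<forall>\<alpha>. m_loc \<phi> xb \<delta> 0 0 < ereal \<alpha> \<and> \<alpha> < \<alpha>0 \<longrightarrow>
                 (\<exists>V U. open V \<and> convex V \<and> 0 \<in> V \<and> open U \<and> convex U \<and> 0 \<in> U \<and>
                    localized_solution_property \<phi> xb \<delta> \<alpha> V U))))) \<and>
     (strong_variational_sufficiency \<phi> xb \<longrightarrow>
        (\<exists>\<delta>0>0. \<exists>\<alpha>0. \<phi> (xb, 0) < ereal \<alpha>0 \<and>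
           (\<forall>\<delta>. 0 < \<delta> \<and> \<delta> < \<delta>0 \<longrightarrow> m_loc \<phi> xb \<delta> 0 0 = \<phi> (xb, 0) \<and>
              (\<forall>\<alpha>. m_loc \<phi> xb \<delta> 0 0 < ereal \<alpha> \<and> \<alpha> < \<alpha>0 \<longrightarrow>
                 (\<exists>V U. open V \<and> convex V \<and> 0 \<in> V \<and> open U \<and> convex U \<and> 0 \<in> U \<and>
                    localized_solution_property \<phi> xb \<delta> \<alpha> V U \<and>
                    hypo_convex_property \<phi> xb \<delta> V U)))))"
proof -
  note cl = assms(1) and pr = assms(2) and lm = assms(3) and bcq = assms(5)
  obtain c where c: "\<phi> (xb, 0) = ereal c" using assms(4) by (cases "\<phi> (xb, 0)") auto
  have A: "strong_variational_sufficiency \<phi> xb" if stab: "full_stability \<phi> xb" and prox: "full_multiplier_prox_regularity \<phi> xb"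
  proof -
    obtain \<rho> s e where h: "\<rho> > 0" "s > 0" "e \<ge> 0" "local_growth \<phi> xb UNIV \<rho> s e"
      by (rule stability_imp_uniform_growth[OF cl pr c bcq stab prox])
    show ?thesis
      unfolding strong_variational_sufficiency_def
    proof (intro ballI exI[of _ "e + s"] conjI)
      fix yb assume "yb \<in> Y_mult \<phi> xb 0 0"
      then have "(0, yb) \<in> subgrad \<phi> (xb, 0)" by (simp add: Y_mult_def)
      from local_growth_imp_variationally_convex[OF cl c h(4,1,2,3) this] h(2)
      show "variationally_strongly_convex (\<lambda>(x, u). \<phi> (x, u) + ereal ((e + s) / 2 * (norm u)\<^sup>2)) (xb, 0) (0, yb)"
        unfolding variationally_strongly_convex_def by blast
    qed (use h in simp)
  qed
  have B: "full_substability \<phi> xb" "full_multiplier_prox_regularity \<phi> xb"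
    and B': "\<exists>\<delta>1>0. \<forall>\<delta>. 0 < \<delta> \<and> \<delta> < \<delta>1 \<longrightarrow> (\<exists>\<tau>>0. hypo_convex_property \<phi> xb \<delta> (ball 0 \<tau>) (ball 0 \<tau>))"
    if suff: "strong_variational_sufficiency \<phi> xb"
  proof -
    obtain \<rho> s e where h: "\<rho> > 0" "s > 0" "e \<ge> 0" "local_growth \<phi> xb UNIV \<rho> s e"
      by (rule variational_sufficiency_imp_uniform_growth[OF cl c bcq suff])
    obtain \<delta>1 K where \<delta>1: "\<delta>1 > 0" "\<delta>1 < \<rho>" and K: "K \<ge> 0" and
      sol: "\<And>\<delta>. 0 < \<delta> \<Longrightarrow> \<delta> \<le> \<delta>1 \<Longrightarrow> M_loc \<phi> xb \<delta> 0 0 = {xb} \<and> (\<exists>\<tau>>0. solvable_near \<phi> xb \<rho> K \<delta> \<tau>)"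
      by (rule growth_imp_solvable[OF cl pr c bcq lm h(4,1,2,3)]) metis
    show "full_substability \<phi> xb"
      by (rule solvable_near_imp_full_substability[OF pr h(4,2) K \<delta>1 sol])
    show "full_multiplier_prox_regularity \<phi> xb"
      unfolding full_multiplier_prox_regularity_def Y_mult_def
      using local_growth_imp_prox_regular[OF c h(4,1,2,3)] by blast
    have "\<exists>\<tau>>0. hypo_convex_property \<phi> xb \<delta> (ball 0 \<tau>) (ball 0 \<tau>)" if "0 < \<delta> \<and> \<delta> < \<delta>1" for \<delta>
    proof -
      obtain \<tau> where "\<tau> > 0" "solvable_near \<phi> xb \<rho> K \<delta> \<tau>" using sol[of \<delta>] \<open>0 < \<delta> \<and> \<delta> < \<delta>1\<close> by auto
      moreover have "hypo_convex_property \<phi> xb \<delta> (ball 0 \<tau>) (ball 0 \<tau>)"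
        by (rule solvable_near_hypo_convex[OF pr \<open>solvable_near \<phi> xb \<rho> K \<delta> \<tau>\<close> K _ _ h(4,2,3)])
          (use that \<delta>1 in auto)
      ultimately show ?thesis by blast
    qed
    then show "\<exists>\<delta>1>0. \<forall>\<delta>. 0 < \<delta> \<and> \<delta> < \<delta>1 \<longrightarrow> (\<exists>\<tau>>0. hypo_convex_property \<phi> xb \<delta> (ball 0 \<tau>) (ball 0 \<tau>))"
      using \<delta>1(1) by blast
  qed
  note C = substability_localized_solution[OF cl pr c bcq]
  have D: "\<exists>\<delta>0>0. \<exists>\<alpha>0. \<phi> (xb, 0) < ereal \<alpha>0 \<and>
           (\<forall>\<delta>. 0 < \<delta> \<and> \<delta> < \<delta>0 \<longrightarrow> m_loc \<phi> xb \<delta> 0 0 = \<phi> (xb, 0) \<and>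
              (\<forall>\<alpha>. m_loc \<phi> xb \<delta> 0 0 < ereal \<alpha> \<and> \<alpha> < \<alpha>0 \<longrightarrow>
                 (\<exists>V U. open V \<and> convex V \<and> 0 \<in> V \<and> open U \<and> convex U \<and> 0 \<in> U \<and>
                    localized_solution_property \<phi> xb \<delta> \<alpha> V U \<and> hypo_convex_property \<phi> xb \<delta> V U)))"
    if suff: "strong_variational_sufficiency \<phi> xb"
  proof -
    define P where "P \<delta> \<alpha> V U \<longleftrightarrow> open V \<and> convex V \<and> 0 \<in> V \<and> open U \<and> convex U \<and> 0 \<in> U \<and>
        localized_solution_property \<phi> xb \<delta> \<alpha> V U" for \<delta> \<alpha> V U
    have "\<exists>\<delta>0>0. \<exists>\<alpha>0. \<phi> (xb, 0) < ereal \<alpha>0 \<and> (\<forall>\<delta>. 0 < \<delta> \<and> \<delta> < \<delta>0 \<longrightarrow> m_loc \<phi> xb \<delta> 0 0 = \<phi> (xb, 0) \<and>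
        (\<forall>\<alpha>. m_loc \<phi> xb \<delta> 0 0 < ereal \<alpha> \<and> \<alpha> < \<alpha>0 \<longrightarrow> (\<exists>V U. P \<delta> \<alpha> V U)))"
      unfolding P_def by (rule C[OF B[OF suff]])
    then obtain \<delta>0 \<alpha>0 where \<delta>0: "\<delta>0 > 0" and \<alpha>0: "\<phi> (xb, 0) < ereal \<alpha>0"
      and L: "\<And>\<delta>. 0 < \<delta> \<Longrightarrow> \<delta> < \<delta>0 \<Longrightarrow> m_loc \<phi> xb \<delta> 0 0 = \<phi> (xb, 0) \<and>
        (\<forall>\<alpha>. m_loc \<phi> xb \<delta> 0 0 < ereal \<alpha> \<and> \<alpha> < \<alpha>0 \<longrightarrow> (\<exists>V U. P \<delta> \<alpha> V U))" by blast
    obtain \<delta>1 where \<delta>1: "\<delta>1 > 0" and H: "\<And>\<delta>. 0 < \<delta> \<Longrightarrow> \<delta> < \<delta>1 \<Longrightarrow> \<exists>\<tau>>0. hypo_convex_property \<phi> xb \<delta> (ball 0 \<tau>) (ball 0 \<tau>)"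
      using B'[OF suff] by blast
    show ?thesis
    proof (rule exI[of _ "min \<delta>0 \<delta>1"], intro conjI, simp add: \<delta>0 \<delta>1, rule exI[of _ \<alpha>0], intro conjI \<alpha>0 allI impI)
      fix \<delta> assume "0 < \<delta> \<and> \<delta> < min \<delta>0 \<delta>1"
      then have \<delta>: "0 < \<delta>" "\<delta> < \<delta>0" "\<delta> < \<delta>1" by auto
      show "m_loc \<phi> xb \<delta> 0 0 = \<phi> (xb, 0)" using L[OF \<delta>(1,2)] by blast
      fix \<alpha> assume "m_loc \<phi> xb \<delta> 0 0 < ereal \<alpha> \<and> \<alpha> < \<alpha>0"
      then obtain V U where "P \<delta> \<alpha> V U" using L[OF \<delta>(1,2)] by blast
      then have VU: "open V" "convex V" "0 \<in> V" "open U" "convex U" "0 \<in> U" "localized_solution_property \<phi> xb \<delta> \<alpha> V U"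
        unfolding P_def by blast+
      obtain \<tau> where \<tau>: "\<tau> > 0" "hypo_convex_property \<phi> xb \<delta> (ball 0 \<tau>) (ball 0 \<tau>)" using H[OF \<delta>(1,3)] by blast
      \<comment> \<open>The neighborhoods from (C) and those for hypo-convexity arise independently;
        both properties pass to the intersections, which are again open and convex.\<close>
      show "\<exists>V U. open V \<and> convex V \<and> 0 \<in> V \<and> open U \<and> convex U \<and> 0 \<in> U \<and>
                    localized_solution_property \<phi> xb \<delta> \<alpha> V U \<and> hypo_convex_property \<phi> xb \<delta> V U"
      proof (rule exI[of _ "V \<inter> ball 0 \<tau>"], rule exI[of _ "U \<inter> ball 0 \<tau>"], intro conjI)
        show "localized_solution_property \<phi> xb \<delta> \<alpha> (V \<inter> ball 0 \<tau>) (U \<inter> ball 0 \<tau>)"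
          by (rule localized_solution_property_subset[OF VU(7)]) auto
        show "hypo_convex_property \<phi> xb \<delta> (V \<inter> ball 0 \<tau>) (U \<inter> ball 0 \<tau>)"
          by (rule hypo_convex_property_subset[OF \<tau>(2)]) (use VU in \<open>auto intro: convex_Int\<close>)
      qed (use VU \<tau>(1) in \<open>auto intro: convex_Int\<close>)
    qed
  qed
  show ?thesis
  proof (intro conjI impI)
    show "strong_variational_sufficiency \<phi> xb" if "full_stability \<phi> xb \<and> full_multiplier_prox_regularity \<phi> xb"
      using A that by blast
    show "full_substability \<phi> xb" "full_multiplier_prox_regularity \<phi> xb" if "strong_variational_sufficiency \<phi> xb"
      using B[OF that] .
  qed (rule C D; blast)+
qed

end
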